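(* Let $m\ge 2$ be an integer, let $B\in\operatorname{GL}(m,\mathbb{Z})$, and suppose that the toral automorphism $T_B\colon\mathbb{T}^m\to\mathbb{T}^m$ given by $T_B(x)=Bx \pmod{\mathbb{Z}^m}$ is ergodic with respect to Lebesgue measure. Then there exist rational numbers $c_k\in\mathbb{Q}$ ($k\in\mathbb{Z}^m\smallsetminus\{0\}$) and a function $\widetilde F\in C(\mathbb{T}^m,\mathbb{R})$ of the form $$\widetilde F(x)=\sum_{k\in\mathbb{Z}^m\smallsetminus\{0\}}c_k\exp(2\pi \mathbf{i}\langle k,x\rangle),$$ such that the square partial sums $$\Sigma_R\widetilde F(x)=\sum_{k\in\mathbb{Z}^m\smallsetminus\{0\},\ \|k\|_\infty\le R}c_k\exp(2\pi \mathbf{i}\langle k,x\rangle)$$ of the Fourier series converge uniformly to $\widetilde F$ on $\mathbb{T}^m$ as $R\to+\infty$, and Lebesgue measure is the unique $T_B$-invariant maximizing measure for $\widetilde F$. Moreover, each coefficient $c_k$ is determined exactly by a finite procedure.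
   Context: $\mathbb{T}^m=(\mathbb{R}/\mathbb{Z})^m$. A $T_B$-invariant Borel probability measure $\mu$ is called maximizing for $f\in C(\mathbb{T}^m,\mathbb{R})$ if $\int f\,\mathrm{d}\mu=\sup_{\nu}\int f\,\mathrm{d}\nu$, the supremum being over all $T_B$-invariant Borel probability measures $\nu$ on $\mathbb{T}^m$. "Each $c_k$ is determined exactly by a finite procedure" means: there is an algorithm which, given $k$, returns the exact value of the rational number $c_k$ (not merely an approximation) after finitely many arithmetic operations. *)

theory Defs
  imports "HOL-Probability.Probability" "HOL-Library.Nat_Bijection"
begin

text \<open>
  The torus \<open>(\<real>/\<int>)\<^sup>m\<close> is the quotient of \<open>real ^ 'n\<close>, with \<open>m = CARD('n)\<close>, by the integer
  lattice. It carries the quotient topology, so that \<open>borel\<close> on this type is its Borel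
  \<open>\<sigma>\<close>-algebra.
\<close>

quotient_type 'n torus = "real ^ ('n::finite)" / "\<lambda>x y. \<forall>i. x $ i - y $ i \<in> \<int>"
  morphisms torus_rep torus_proj
proof (rule equivpI)
  show "reflp (\<lambda>x y::real^'n. \<forall>i. x $ i - y $ i \<in> \<int>)"
    by (simp add: reflp_def)
  show "symp (\<lambda>x y::real^'n. \<forall>i. x $ i - y $ i \<in> \<int>)"
    by (intro sympI allI) (metis minus_diff_eq minus_in_Ints_iff)
  show "transp (\<lambda>x y::real^'n. \<forall>i. x $ i - y $ i \<in> \<int>)"
  proof (intro transpI allI)
    fix x y z :: "real^'n" and i
    assume "\<forall>i. x $ i - y $ i \<in> \<int>" "\<forall>i. y $ i - z $ i \<in> \<int>"
    then have "(x $ i - y $ i) + (y $ i - z $ i) \<in> \<int>"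
      by (intro Ints_add) auto
    then show "x $ i - z $ i \<in> \<int>" by simp
  qed
qed

instantiation torus :: (finite) topological_space
begin

definition open_torus :: "'a torus set \<Rightarrow> bool"
  where "open_torus U \<longleftrightarrow> open (torus_proj -` U)"

instance
proof
  show "open (UNIV :: 'a torus set)"
    by (simp add: open_torus_def)
  show "open (S \<inter> T)" if "open S" "open T" for S T :: "'a torus set"
    using that by (simp add: open_torus_def open_Int)
  show "open (\<Union>K)" if "\<forall>S\<in>K. open S" for K :: "'a torus set set"
    using that unfolding open_torus_def vimage_Union by (intro open_UN) simp
qed

end

lemma continuous_on_torus_proj: "continuous_on A torus_proj"
  by (rule continuous_on_subset[of UNIV])
     (auto simp: continuous_on_open_vimage open_torus_def)

lemma torus_proj_measurable: "torus_proj \<in> borel_measurable borel"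
  by (rule borel_measurable_continuous_onI) (rule continuous_on_torus_proj)

definition torus_cube :: "(real ^ 'n::finite) set"
  where "torus_cube = {x. \<forall>i. 0 \<le> x $ i \<and> x $ i < 1}"

definition torus_lebesgue :: "'n::finite torus measure"
  where "torus_lebesgue = distr (restrict_space lborel torus_cube) borel torus_proj"

definition vec_of_int :: "int ^ 'n \<Rightarrow> real ^ 'n::finite"
  where "vec_of_int k = (\<chi> i. real_of_int (k $ i))"

lift_definition toral_map :: "int ^ 'n ^ 'n \<Rightarrow> 'n::finite torus \<Rightarrow> 'n torus"
  is "\<lambda>B x. map_matrix real_of_int B *v x"
proof -
  fix B :: "int^'n^'n" and x y :: "real^'n" and i
  assume "\<And>i. x $ i - y $ i \<in> \<int>"
  then have "(\<Sum>j\<in>UNIV. real_of_int (B $ i $ j) * (x $ j - y $ j)) \<in> \<int>"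
    by (intro Ints_sum Ints_mult) auto
  then show "(map_matrix real_of_int B *v x) $ i - (map_matrix real_of_int B *v y) $ i \<in> \<int>"
    by (simp add: matrix_vector_mult_def right_diff_distrib sum_subtractf)
qed

lift_definition torus_char :: "int ^ 'n \<Rightarrow> 'n::finite torus \<Rightarrow> complex"
  is "\<lambda>k x. exp (2 * of_real pi * \<i> * of_real (vec_of_int k \<bullet> x))"
proof -
  fix k :: "int^'n" and x y :: "real^'n"
  assume "\<And>i. x $ i - y $ i \<in> \<int>"
  then have "(\<Sum>j\<in>UNIV. real_of_int (k $ j) * (x $ j - y $ j)) \<in> \<int>"
    by (intro Ints_sum Ints_mult) auto
  then have "vec_of_int k \<bullet> x - vec_of_int k \<bullet> y \<in> \<int>"
    by (simp add: vec_of_int_def inner_vec_def right_diff_distrib sum_subtractf)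
  then obtain n where "vec_of_int k \<bullet> x - vec_of_int k \<bullet> y = real_of_int n"
    by (auto elim: Ints_cases)
  then have "vec_of_int k \<bullet> x = vec_of_int k \<bullet> y + real_of_int n"
    by simp
  then have "2 * of_real pi * \<i> * of_real (vec_of_int k \<bullet> x) =
      2 * of_real pi * \<i> * of_real (vec_of_int k \<bullet> y) + of_int (2 * n) * of_real pi * \<i>"
    by (simp only: of_real_add of_real_of_int_eq of_int_mult of_int_numeral distrib_left mult_ac)
  then show "exp (2 * of_real pi * \<i> * of_real (vec_of_int k \<bullet> x)) =
      exp (2 * of_real pi * \<i> * of_real (vec_of_int k \<bullet> y))"
    unfolding exp_eq of_real_mult of_real_of_int_eq by blast
qed

lemma prob_space_torus_lebesgue: "prob_space (torus_lebesgue :: 'n::finite torus measure)"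
proof -
  have box: "(box 0 1 :: (real^'n) set) \<subseteq> torus_cube" "torus_cube \<subseteq> (cbox 0 1 :: (real^'n) set)"
    by (auto simp: torus_cube_def mem_box_cart less_imp_le)
  have meas: "(torus_cube :: (real^'n) set) \<in> sets borel"
    unfolding torus_cube_def by measurable
  have Basis: "1 \<bullet> b = 1" if "b \<in> Basis" for b :: "real^'n"
    using that by (auto simp: Basis_vec_def inner_axis)
  have vol: "emeasure lborel (box 0 1 :: (real^'n) set) = 1"
    "emeasure lborel (cbox 0 1 :: (real^'n) set) = 1"
    by (simp_all add: emeasure_lborel_box_eq emeasure_lborel_cbox_eq Basis)
  have "emeasure lborel (torus_cube :: (real^'n) set) = 1"
  proof (rule antisym)
    show "emeasure lborel (torus_cube :: (real^'n) set) \<le> 1"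
      using emeasure_mono[OF box(2), of lborel] vol by simp
    show "1 \<le> emeasure lborel (torus_cube :: (real^'n) set)"
      using emeasure_mono[OF box(1), of lborel] vol meas by simp
  qed
  then have "prob_space (restrict_space lborel (torus_cube :: (real^'n) set))"
    using meas by (intro prob_spaceI) (simp add: emeasure_restrict_space space_restrict_space)
  then show ?thesis
    unfolding torus_lebesgue_def
    by (rule prob_space.prob_space_distr)
       (intro measurable_restrict_space1, use torus_proj_measurable in simp)
qed

definition ergodic :: "('a \<Rightarrow> 'a) \<Rightarrow> 'a measure \<Rightarrow> bool"
  where "ergodic T M \<longleftrightarrow>
    T \<in> measurable M M \<and> distr M M T = M \<and>
    (\<forall>A\<in>sets M. T -` A \<inter> space M = A \<longrightarrow> emeasure M A = 0 \<or> emeasure M (space M - A) = 0)"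

definition invariant_prob_measures :: "('a::topological_space \<Rightarrow> 'a) \<Rightarrow> 'a measure set"
  where "invariant_prob_measures T =
    {M. sets M = sets borel \<and> prob_space M \<and> T \<in> measurable M M \<and> distr M M T = M}"

definition maximizing :: "('a::topological_space \<Rightarrow> 'a) \<Rightarrow> ('a \<Rightarrow> real) \<Rightarrow> 'a measure \<Rightarrow> bool"
  where "maximizing T f M \<longleftrightarrow>
    M \<in> invariant_prob_measures T \<and>
    integral\<^sup>L M f = (SUP N\<in>invariant_prob_measures T. integral\<^sup>L N f)"

definition fourier_coeff :: "('n::finite torus \<Rightarrow> real) \<Rightarrow> int ^ 'n \<Rightarrow> complex"
  where "fourier_coeff F k = (LINT x|torus_lebesgue. complex_of_real (F x) * torus_char (- k) x)"

definition square_partial_sum ::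
    "(int ^ 'n \<Rightarrow> rat) \<Rightarrow> real \<Rightarrow> 'n::finite torus \<Rightarrow> complex"
  where "square_partial_sum c R x =
    (\<Sum>k | k \<noteq> 0 \<and> infnorm (vec_of_int k) \<le> R. of_rat (c k) * torus_char k x)"

lemma finite_square: "finite {k :: int ^ 'n::finite. k \<noteq> 0 \<and> infnorm (vec_of_int k) \<le> R}"
proof (rule finite_subset)
  have bound: "k $ i \<in> {-\<lceil>R\<rceil>..\<lceil>R\<rceil>}" if "infnorm (vec_of_int k) \<le> R" for k :: "int^'n" and i
  proof -
    have "\<bar>real_of_int (k $ i)\<bar> \<le> R"
      using component_le_infnorm_cart[of "vec_of_int k" i] that by (simp add: vec_of_int_def)
    then have "real_of_int \<bar>k $ i\<bar> \<le> real_of_int \<lceil>R\<rceil>"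
      using le_of_int_ceiling[of R] by linarith
    then show ?thesis
      unfolding of_int_le_iff by auto
  qed
  show "{k :: int^'n. k \<noteq> 0 \<and> infnorm (vec_of_int k) \<le> R} \<subseteq>
      vec_lambda ` (UNIV \<rightarrow>\<^sub>E {-\<lceil>R\<rceil>..\<lceil>R\<rceil>})"
  proof
    fix k :: "int^'n"
    assume "k \<in> {k. k \<noteq> 0 \<and> infnorm (vec_of_int k) \<le> R}"
    then have "vec_nth k \<in> UNIV \<rightarrow>\<^sub>E {-\<lceil>R\<rceil>..\<lceil>R\<rceil>}"
      using bound by (auto simp only: PiE_UNIV_domain)
    then show "k \<in> vec_lambda ` (UNIV \<rightarrow>\<^sub>E {-\<lceil>R\<rceil>..\<lceil>R\<rceil>})"
      by (rule image_eqI[rotated]) simp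
  qed
  show "finite (vec_lambda ` ((UNIV :: 'n set) \<rightarrow>\<^sub>E {-\<lceil>R\<rceil>..\<lceil>R\<rceil>}))"
    by (intro finite_imageI finite_PiE) simp_all
qed

text \<open>
  The total recursive functions, with an \<open>n\<close>-ary function represented as a function on lists,
  of which only the values on lists of length \<open>n\<close> are relevant. The rule \<open>mu\<close>
  requires that the search for a zero always succeeds.
\<close>

inductive recursive :: "nat \<Rightarrow> (nat list \<Rightarrow> nat) \<Rightarrow> bool" where
  zero: "recursive n (\<lambda>xs. 0)"
| succ: "recursive 1 (\<lambda>xs. Suc (xs ! 0))"
| proj: "i < n \<Longrightarrow> recursive n (\<lambda>xs. xs ! i)"
| comp: "recursive (length gs) f \<Longrightarrow> \<forall>g\<in>set gs. recursive n g \<Longrightarrow>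
    recursive n (\<lambda>xs. f (map (\<lambda>g. g xs) gs))"
| prim_rec: "recursive n f \<Longrightarrow> recursive (Suc (Suc n)) g \<Longrightarrow>
    recursive (Suc n) (\<lambda>xs. rec_nat (f (tl xs)) (\<lambda>y r. g (y # r # tl xs)) (hd xs))"
| mu: "recursive (Suc n) f \<Longrightarrow> \<forall>xs. length xs = n \<longrightarrow> (\<exists>y. f (y # xs) = 0) \<Longrightarrow>
    recursive n (\<lambda>xs. LEAST y. f (y # xs) = 0)"

text \<open>
  An algorithm for a function \<open>c\<close> on \<open>S \<subseteq> \<int>\<^sup>m\<close> receives the coordinates of \<open>k \<in> S\<close>, in the order
  given by an enumeration \<open>is\<close> of the index type and coded as natural numbers, and
  returns the numerator (coded likewise) and the denominator of a fraction equal to \<open>c k\<close>.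
\<close>

definition computable_on :: "(int ^ 'n) set \<Rightarrow> (int ^ 'n::finite \<Rightarrow> rat) \<Rightarrow> bool"
  where "computable_on S c \<longleftrightarrow>
    (\<forall>is. distinct is \<and> set is = UNIV \<longrightarrow>
      (\<exists>p q. recursive CARD('n) p \<and> recursive CARD('n) q \<and>
        (\<forall>k\<in>S. let xs = map (\<lambda>i. int_encode (k $ i)) is in
          q xs \<noteq> 0 \<and> c k = of_int (int_decode (p xs)) / of_nat (q xs))))"

end

theory Submission
  imports Defs
begin

text \<open>
  Let \<open>A\<close> be the transpose of \<open>B\<close> and \<open>T\<close> the toral map, and write \<open>e\<^sub>k\<close> for the character
  of frequency \<open>k\<close>, so that \<open>e\<^sub>k \<circ> T\<close> is the character of frequency \<open>A k\<close>. An ergodic \<open>T\<close> has no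
  finite orbit of non-zero frequencies, because summing the characters of such an orbit would
  give a non-constant invariant function (\<open>ergodic_imp_free_dual\<close>). Together with the invariance
  of Lebesgue measure, this is what ergodicity contributes.

  An invariant probability measure \<open>\<mu>\<close> is Lebesgue measure as soon as its Fourier coefficients
  \<open>\<mu>(e\<^sub>k)\<close>, \<open>k \<noteq> 0\<close>, vanish (\<open>torus_measure_eqI\<close>). So it suffices to find \<open>F\<close> with Lebesgue integral
  \<open>0\<close> whose integral is negative for every invariant \<open>\<mu>\<close> with some \<open>\<mu>(e\<^sub>k) \<noteq> 0\<close>. With \<open>S\<close> the
  Birkhoff average of length \<open>N\<close>, the function \<open>1/N - \<bar>S e\<^sub>k\<bar>\<^sup>2\<close> is a first approximation: its
  Lebesgue integral is \<open>0\<close>, since the frequencies in the orbit of \<open>k\<close> are distinct, and its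
  \<open>\<mu>\<close>-integral is at most \<open>1/N - \<bar>\<mu>(e\<^sub>k)\<bar>\<^sup>2\<close>. But this may be positive for \<open>\<mu>\<close> with small Fourier
  coefficients. The remedy uses that \<open>min (S H) 0\<close> has \<open>\<mu>\<close>-integral at most \<open>min (\<integral>H d\<mu>) 0\<close>,
  while its Lebesgue integral is close to \<open>0\<close> for large \<open>N\<close> when \<open>H\<close> has mean \<open>0\<close>: the terms of \<open>S H\<close>
  become small in mean (\<open>integral_abs_pavg_lebesgue\<close>). Hence the recursion
  \<open>H' = min (S H) 0 - a (\<bar>S e\<^sub>k\<bar>\<^sup>2 - 1/N)\<close>, followed by removal of the Lebesgue mean, keeps all values
  of \<open>H\<close> bounded, makes the positive part as small as \<open>4\<^sup>-\<^sup>s\<close> at stage \<open>s\<close>, and satisfies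
  \<open>\<integral>H' d\<mu> \<le> min (\<integral>H d\<mu>) 0 + 4\<^sup>-\<^sup>s / 4 - a \<bar>\<mu>(e\<^sub>k)\<bar>\<^sup>2\<close> with \<open>a = 2\<^sup>-\<^sup>s / 4\<close>; the lemma is
  \<open>next_poly_properties\<close>. Replacing \<open>min\<close> by a polynomial keeps \<open>H\<close> a trigonometric polynomial with
  rational coefficients. If every \<open>k\<close> is used at infinitely many stages, the limit of the
  integrals \<open>\<integral>H d\<mu>\<close> is negative unless \<open>\<mu>\<close> is Lebesgue measure, since the errors \<open>4\<^sup>-\<^sup>s\<close> are
  eventually negligible against \<open>2\<^sup>-\<^sup>s\<close>.

  The increment \<open>d = H' - S H\<close> is uniformly of order \<open>2\<^sup>-\<^sup>s\<close>, because \<open>S H\<close> is nearly non-positive, and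
  it has integral \<open>\<integral>H' d\<mu> - \<integral>H d\<mu>\<close>. So the sum \<open>F\<close> of all increments is continuous and its
  integrals are the limits above. Invariance leaves the freedom to replace \<open>d\<close> by an average
  of functions \<open>d \<circ> T\<^sup>m\<close>. As all orbits of frequencies are infinite, the exponents \<open>m\<close> can be chosen so
  that the summands lie in successive disjoint shells of frequencies, beyond everything used
  before. Then each Fourier coefficient of \<open>F\<close> is known after finitely many stages, and a square
  partial sum cuts through at most one of the \<open>L\<close> copies of a given \<open>d\<close>, which costs no more
  than the sum of the moduli of its coefficients divided by \<open>L\<close> (\<open>emission_properties\<close>). This gives
  the uniform convergence of the square partial sums.

  For the algorithm, types are numbered by a total surjection from the natural numbers, and
  a function is computable if it is tracked by a total recursive function on codes. Computable
  functions are closed under pairing, iteration, list recursion and unbounded search, so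
  the construction, written as a functional program on lists of terms, is computable by
  inspection of its definition (\<open>computable_limit_coeff\<close>).
\<close>

section \<open>Total recursive functions\<close>

text \<open>
  The relation \<open>recursive\<close> constrains functions on lists of all lengths. Closing it under agreement on
  lists of the relevant length makes its rules applicable to functions written in any form.
\<close>

definition rec_fun :: "nat \<Rightarrow> (nat list \<Rightarrow> nat) \<Rightarrow> bool"
  where "rec_fun n f \<longleftrightarrow> (\<exists>f'. recursive n f' \<and> (\<forall>xs. length xs = n \<longrightarrow> f' xs = f xs))"

lemma rec_fun_cong:
  assumes "rec_fun n f" "\<And>xs. length xs = n \<Longrightarrow> f xs = g xs"
  shows "rec_fun n g"
  using assms unfolding rec_fun_def by metis

lemma rec_fun_proj: "i < n \<Longrightarrow> rec_fun n (\<lambda>xs. xs ! i)"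
  unfolding rec_fun_def using recursive.proj by blast

lemma rec_fun_subst:
  assumes f: "rec_fun (length gs) f" and gs: "\<And>g. g \<in> set gs \<Longrightarrow> rec_fun n g"
  shows "rec_fun n (\<lambda>xs. f (map (\<lambda>g. g xs) gs))"
proof -
  obtain f' where f': "recursive (length gs) f'" "\<And>xs. length xs = length gs \<Longrightarrow> f' xs = f xs"
    using f unfolding rec_fun_def by blast
  obtain E where E: "\<And>g. g \<in> set gs \<Longrightarrow> recursive n (E g) \<and> (\<forall>xs. length xs = n \<longrightarrow> E g xs = g xs)"
    using gs unfolding rec_fun_def by metis
  have "recursive n (\<lambda>xs. f' (map (\<lambda>g. g xs) (map E gs)))"
    using f'(1) E by (intro recursive.comp) auto
  moreover have "f' (map (\<lambda>g. g xs) (map E gs)) = f (map (\<lambda>g. g xs) gs)" if "length xs = n" for xs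
  proof -
    have "map (\<lambda>g. g xs) (map E gs) = map (\<lambda>g. g xs) gs"
      using E that by simp
    then show ?thesis using f'(2) by (metis length_map)
  qed
  ultimately show ?thesis unfolding rec_fun_def by blast
qed

text \<open>
  Weakening by one dummy argument in front: bodies of recursions and searches may then refer to
  the ambient arguments.
\<close>

lemma rec_fun_tl:
  assumes "rec_fun n f"
  shows "rec_fun (Suc n) (\<lambda>xs. f (tl xs))"
proof -
  have "rec_fun (Suc n) (\<lambda>xs. f (map (\<lambda>g. g xs) (map (\<lambda>i xs. xs ! Suc i) [0..<n])))"
    using assms by (intro rec_fun_subst) (auto intro: rec_fun_proj)
  then show ?thesis
  proof (rule rec_fun_cong)
    fix xs :: "nat list" assume "length xs = Suc n"
    then have "map (\<lambda>g. g xs) (map (\<lambda>i xs. xs ! Suc i) [0..<n]) = tl xs"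
      by (intro nth_equalityI) (auto simp: nth_tl)
    then show "f (map (\<lambda>g. g xs) (map (\<lambda>i xs. xs ! Suc i) [0..<n])) = f (tl xs)" by simp
  qed
qed

lemma rec_fun_primrec:
  assumes c: "rec_fun n c" and a: "rec_fun n a"
    and g: "rec_fun (Suc (Suc n)) (\<lambda>xs. g (xs ! 0) (xs ! 1) (tl (tl xs)))"
  shows "rec_fun n (\<lambda>xs. rec_nat (a xs) (\<lambda>y r. g y r xs) (c xs))"
proof -
  obtain a' where a': "recursive n a'" "\<And>xs. length xs = n \<Longrightarrow> a' xs = a xs"
    using a unfolding rec_fun_def by blast
  obtain g' where g': "recursive (Suc (Suc n)) g'"
    "\<And>xs. length xs = Suc (Suc n) \<Longrightarrow> g' xs = g (xs ! 0) (xs ! 1) (tl (tl xs))"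
    using g unfolding rec_fun_def by blast
  let ?h = "\<lambda>xs. rec_nat (a' (tl xs)) (\<lambda>y r. g' (y # r # tl xs)) (hd xs)"
  let ?gs = "c # map (\<lambda>i xs. xs ! i) [0..<n]"
  have h: "rec_fun (length ?gs) ?h"
    using recursive.prim_rec[OF a'(1) g'(1)] unfolding rec_fun_def by auto
  have "rec_fun n (\<lambda>xs. ?h (map (\<lambda>g. g xs) ?gs))"
    by (rule rec_fun_subst[OF h]) (use c in \<open>auto intro: rec_fun_proj\<close>)
  then show ?thesis
  proof (rule rec_fun_cong)
    fix xs :: "nat list" assume len: "length xs = n"
    then have "map (\<lambda>g. g xs) ?gs = c xs # xs"
      by (simp add: comp_def) (metis map_nth)
    moreover have "rec_nat (a' xs) (\<lambda>y r. g' (y # r # xs)) m = rec_nat (a xs) (\<lambda>y r. g y r xs) m" for m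
      by (induction m) (use a' g' len in auto)
    ultimately show "?h (map (\<lambda>g. g xs) ?gs) = rec_nat (a xs) (\<lambda>y r. g y r xs) (c xs)"
      by simp
  qed
qed

lemma rec_fun_Least:
  assumes f: "rec_fun (Suc n) (\<lambda>xs. f (hd xs) (tl xs))"
    and ex: "\<And>xs. length xs = n \<Longrightarrow> \<exists>y. f y xs = 0"
  shows "rec_fun n (\<lambda>xs. LEAST y. f y xs = 0)"
proof -
  obtain f' where f': "recursive (Suc n) f'" "\<And>xs. length xs = Suc n \<Longrightarrow> f' xs = f (hd xs) (tl xs)"
    using f unfolding rec_fun_def by blast
  then have eq: "f' (y # xs) = f y xs" if "length xs = n" for xs y
    using that by simp
  have "recursive n (\<lambda>xs. LEAST y. f' (y # xs) = 0)"
    using f'(1) ex eq by (intro recursive.mu) auto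
  then show ?thesis unfolding rec_fun_def using eq by auto
qed

lemma rec_fun_apply1:
  assumes "rec_fun 1 (\<lambda>xs. f (xs ! 0))" "rec_fun n g"
  shows "rec_fun n (\<lambda>xs. f (g xs))"
  using rec_fun_subst[of "[g]" "\<lambda>xs. f (xs ! 0)" n] assms by simp

lemma rec_fun_Suc: "rec_fun n f \<Longrightarrow> rec_fun n (\<lambda>xs. Suc (f xs))"
  by (rule rec_fun_apply1) (use recursive.succ in \<open>auto simp: rec_fun_def\<close>)

lemma rec_fun_const: "rec_fun n (\<lambda>xs. c)"
proof (induction c)
  case 0
  show ?case unfolding rec_fun_def using recursive.zero by blast
next
  case (Suc c)
  then show ?case by (rule rec_fun_Suc)
qed

lemma rec_fun_add:
  assumes "rec_fun n f" "rec_fun n g"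
  shows "rec_fun n (\<lambda>xs. f xs + g xs)"
proof -
  have "rec_fun n (\<lambda>xs. rec_nat (f xs) (\<lambda>y r. Suc r) (g xs))"
    using assms by (intro rec_fun_primrec rec_fun_Suc rec_fun_proj) auto
  moreover have "rec_nat a (\<lambda>y r. Suc r) b = a + b" for a b :: nat
    by (induction b) auto
  ultimately show ?thesis by simp
qed

lemma rec_fun_mult:
  assumes "rec_fun n f" "rec_fun n g"
  shows "rec_fun n (\<lambda>xs. f xs * g xs)"
proof -
  have f2: "rec_fun (Suc (Suc n)) (\<lambda>xs. f (tl (tl xs)))"
    by (rule rec_fun_tl[OF rec_fun_tl[OF assms(1)]])
  have r: "rec_fun (Suc (Suc n)) (\<lambda>xs. xs ! 1)"
    by (rule rec_fun_proj) simp
  have "rec_fun n (\<lambda>xs. rec_nat 0 (\<lambda>y r. r + f xs) (g xs))"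
    by (rule rec_fun_primrec[OF assms(2) rec_fun_const rec_fun_add[OF r f2]])
  moreover have "rec_nat 0 (\<lambda>y r. r + a) b = a * b" for a b :: nat
    by (induction b) auto
  ultimately show ?thesis by simp
qed

lemma rec_fun_diff:
  assumes "rec_fun n f" "rec_fun n g"
  shows "rec_fun n (\<lambda>xs. f xs - g xs)"
proof -
  have pred: "rec_fun m (\<lambda>xs. h xs - 1)" if "rec_fun m h" for m h
  proof -
    have "rec_fun m (\<lambda>xs. rec_nat 0 (\<lambda>y r. y) (h xs))"
      using that by (intro rec_fun_primrec rec_fun_const rec_fun_proj) auto
    moreover have "rec_nat 0 (\<lambda>y r. y) a = a - 1" for a :: nat
      by (cases a) auto
    ultimately show ?thesis by simp
  qed
  have "rec_fun n (\<lambda>xs. rec_nat (f xs) (\<lambda>y r. r - 1) (g xs))"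
    using assms by (intro rec_fun_primrec pred rec_fun_proj) auto
  moreover have "rec_nat a (\<lambda>y r. r - 1) b = a - b" for a b :: nat
    by (induction b) auto
  ultimately show ?thesis by simp
qed

lemma rec_fun_if_le:
  assumes "rec_fun n a" "rec_fun n b" "rec_fun n f" "rec_fun n g"
  shows "rec_fun n (\<lambda>xs. if a xs \<le> b xs then f xs else g xs)"
proof -
  have "rec_fun n (\<lambda>xs. (1 - (a xs - b xs)) * f xs + (1 - (1 - (a xs - b xs))) * g xs)"
    using assms by (intro rec_fun_add rec_fun_mult rec_fun_diff rec_fun_const)
  then show ?thesis by (rule rec_fun_cong) auto
qed

lemma rec_fun_Least_le:
  assumes f: "rec_fun (Suc n) (\<lambda>xs. f (hd xs) (tl xs))" and g: "rec_fun (Suc n) (\<lambda>xs. g (hd xs) (tl xs))"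
    and ex: "\<And>xs. length xs = n \<Longrightarrow> \<exists>y. f y xs \<le> (g y xs :: nat)"
  shows "rec_fun n (\<lambda>xs. LEAST y. f y xs \<le> g y xs)"
  using rec_fun_Least[of n "\<lambda>y xs. f y xs - g y xs"] rec_fun_diff[OF f g] ex by simp

lemma rec_fun_hd: "rec_fun (Suc n) hd"
  by (rule rec_fun_cong[OF rec_fun_proj[of 0]]) (auto simp: length_Suc_conv)

lemma rec_fun_triangle:
  assumes "rec_fun n f"
  shows "rec_fun n (\<lambda>xs. triangle (f xs))"
proof -
  have "rec_fun n (\<lambda>xs. rec_nat 0 (\<lambda>y r. r + Suc y) (f xs))"
    using assms by (intro rec_fun_primrec rec_fun_add rec_fun_Suc rec_fun_const rec_fun_proj) auto
  moreover have "rec_nat 0 (\<lambda>y r. r + Suc y) a = triangle a" for a :: nat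
    by (induction a) auto
  ultimately show ?thesis by simp
qed

lemma rec_fun_prod_encode:
  assumes "rec_fun n f" "rec_fun n g"
  shows "rec_fun n (\<lambda>xs. prod_encode (f xs, g xs))"
  unfolding prod_encode_def using assms by (auto intro!: rec_fun_add rec_fun_triangle)

text \<open>
  The inverse of the pairing function is found by searching for the diagonal that contains \<open>n\<close>.
\<close>

lemma prod_decode_Least:
  defines "s \<equiv> \<lambda>n. LEAST s. Suc n \<le> triangle (Suc s)"
  shows "prod_decode n = (n - triangle (s n), s n - (n - triangle (s n)))"
proof -
  obtain a b where ab: "n = prod_encode (a, b)"
    by (metis prod_decode_inverse surj_pair)
  have mono: "triangle i \<le> triangle j" if "i \<le> j" for i j
    using that by (induction rule: dec_induct) auto
  have "s n = a + b"
    unfolding s_def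
  proof (rule Least_equality)
    show "Suc n \<le> triangle (Suc (a + b))" by (simp add: ab prod_encode_def)
    fix y assume "Suc n \<le> triangle (Suc y)"
    then have "triangle (a + b) < triangle (Suc y)" by (simp add: ab prod_encode_def)
    then show "a + b \<le> y" using mono[of "Suc y" "a + b"] by linarith
  qed
  moreover have "n - triangle (a + b) = a" using ab by (simp add: prod_encode_def)
  ultimately show ?thesis using ab by simp
qed

lemma le_triangle_Suc: "Suc n \<le> triangle (Suc n)"
  by (induction n) auto

lemma rec_fun_prod_decode:
  assumes "rec_fun n f"
  shows "rec_fun n (\<lambda>xs. fst (prod_decode (f xs)))" "rec_fun n (\<lambda>xs. snd (prod_decode (f xs)))"
proof -
  have s: "rec_fun n (\<lambda>xs. LEAST s. Suc (f xs) \<le> triangle (Suc s))"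
    by (rule rec_fun_Least_le[OF rec_fun_Suc[OF rec_fun_tl[OF assms]] rec_fun_triangle[OF rec_fun_Suc[OF rec_fun_hd]]])
       (rule exI, rule le_triangle_Suc)
  show "rec_fun n (\<lambda>xs. fst (prod_decode (f xs)))" "rec_fun n (\<lambda>xs. snd (prod_decode (f xs)))"
    unfolding prod_decode_Least fst_conv snd_conv
    by (intro rec_fun_diff rec_fun_triangle s assms)+
qed

lemma rec_fun_half:
  assumes "rec_fun n f"
  shows "rec_fun n (\<lambda>xs. f xs div 2)"
proof -
  have ex: "\<exists>y. Suc a \<le> 2 * Suc y" for a :: nat
    by (rule exI[of _ a]) simp
  have "rec_fun n (\<lambda>xs. LEAST m. Suc (f xs) \<le> 2 * Suc m)"
    by (rule rec_fun_Least_le[OF rec_fun_Suc[OF rec_fun_tl[OF assms]] rec_fun_mult[OF rec_fun_const rec_fun_Suc[OF rec_fun_hd]]])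
       (rule ex)
  moreover have "(LEAST m. Suc a \<le> 2 * Suc m) = a div 2" for a :: nat
    by (rule Least_equality) auto
  ultimately show ?thesis by simp
qed

lemmas rec_fun_intros =
  rec_fun_const rec_fun_Suc rec_fun_add rec_fun_mult rec_fun_diff rec_fun_prod_encode rec_fun_prod_decode
  rec_fun_half rec_fun_if_le

section \<open>Numbered types and computable functions\<close>

definition rec_nat1 :: "(nat \<Rightarrow> nat) \<Rightarrow> bool"
  where "rec_nat1 f \<longleftrightarrow> rec_fun 1 (\<lambda>xs. f (xs ! 0))"

lemma rec_nat1_id: "rec_nat1 (\<lambda>n. n)"
  unfolding rec_nat1_def by (rule rec_fun_proj) simp

lemma rec_nat1_comp: "rec_nat1 f \<Longrightarrow> rec_nat1 g \<Longrightarrow> rec_nat1 (\<lambda>n. f (g n))"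
  unfolding rec_nat1_def by (rule rec_fun_apply1)

lemma rec_nat1_intros:
  "rec_nat1 (\<lambda>n. c)"
  "rec_nat1 f \<Longrightarrow> rec_nat1 (\<lambda>n. Suc (f n))"
  "rec_nat1 f \<Longrightarrow> rec_nat1 g \<Longrightarrow> rec_nat1 (\<lambda>n. f n + g n)"
  "rec_nat1 f \<Longrightarrow> rec_nat1 g \<Longrightarrow> rec_nat1 (\<lambda>n. f n * g n)"
  "rec_nat1 f \<Longrightarrow> rec_nat1 g \<Longrightarrow> rec_nat1 (\<lambda>n. f n - g n)"
  "rec_nat1 f \<Longrightarrow> rec_nat1 g \<Longrightarrow> rec_nat1 (\<lambda>n. prod_encode (f n, g n))"
  "rec_nat1 f \<Longrightarrow> rec_nat1 (\<lambda>n. fst (prod_decode (f n)))"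
  "rec_nat1 f \<Longrightarrow> rec_nat1 (\<lambda>n. snd (prod_decode (f n)))"
  "rec_nat1 f \<Longrightarrow> rec_nat1 (\<lambda>n. f n div 2)"
  "rec_nat1 a \<Longrightarrow> rec_nat1 b \<Longrightarrow> rec_nat1 f \<Longrightarrow> rec_nat1 g \<Longrightarrow> rec_nat1 (\<lambda>n. if a n \<le> b n then f n else g n)"
  unfolding rec_nat1_def by (rule rec_fun_intros; assumption)+

text \<open>
  Pairing \<open>n\<close> with the iterated value lets the step function depend on parameters.
\<close>

lemma rec_nat1_iterate:
  assumes "rec_nat1 g" "rec_nat1 c" "rec_nat1 i"
  shows "rec_nat1 (\<lambda>n. ((\<lambda>r. g (prod_encode (n, r))) ^^ c n) (i n))"
proof -
  have x: "rec_fun 1 (\<lambda>xs. xs ! 0)"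
    by (rule rec_fun_proj) simp
  have n: "rec_fun (Suc (Suc 1)) (\<lambda>xs. tl (tl xs) ! 0)"
    by (rule rec_fun_tl[OF rec_fun_tl[OF x]])
  have r: "rec_fun (Suc (Suc 1)) (\<lambda>xs. xs ! 1)"
    by (rule rec_fun_proj) simp
  have "rec_fun (Suc (Suc 1)) (\<lambda>xs. g (prod_encode (tl (tl xs) ! 0, xs ! 1)))"
    by (rule rec_fun_apply1[OF assms(1)[unfolded rec_nat1_def] rec_fun_prod_encode[OF n r]])
  then have "rec_fun 1 (\<lambda>xs. rec_nat (i (xs ! 0)) (\<lambda>y r. g (prod_encode (xs ! 0, r))) (c (xs ! 0)))"
    using assms unfolding rec_nat1_def by (intro rec_fun_primrec)
  moreover have "rec_nat a (\<lambda>y r. h r) m = (h ^^ m) a" for a m and h :: "nat \<Rightarrow> nat"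
    by (induction m) auto
  ultimately show ?thesis unfolding rec_nat1_def by simp
qed

lemma rec_nat1_Least:
  assumes "rec_nat1 f" "\<And>n. \<exists>y. f (prod_encode (n, y)) \<noteq> 0"
  shows "rec_nat1 (\<lambda>n. LEAST y. f (prod_encode (n, y)) \<noteq> 0)"
proof -
  have x: "rec_fun 1 (\<lambda>xs. xs ! 0)"
    by (rule rec_fun_proj) simp
  have n: "rec_fun (Suc 1) (\<lambda>xs. tl xs ! 0)"
    by (rule rec_fun_tl[OF x])
  have "rec_fun (Suc 1) (\<lambda>xs. f (prod_encode (tl xs ! 0, hd xs)))"
    by (rule rec_fun_apply1[OF assms(1)[unfolded rec_nat1_def] rec_fun_prod_encode[OF n rec_fun_hd]])
  then have "rec_fun 1 (\<lambda>xs. LEAST y. 1 \<le> f (prod_encode (xs ! 0, y)))"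
    by (rule rec_fun_Least_le[OF rec_fun_const]) (use assms(2) in \<open>auto simp: Suc_le_eq\<close>)
  moreover have "1 \<le> m \<longleftrightarrow> m \<noteq> 0" for m :: nat by auto
  ultimately show ?thesis unfolding rec_nat1_def by simp
qed

text \<open>
  A numbering of a type. Elements may have several codes, so that fractions need not be
  reduced, and every number is a code, so that an unbounded search on codes terminates as
  soon as it terminates for all elements.
\<close>

class numbered =
  fixes dec :: "nat \<Rightarrow> 'a"
  assumes surj_dec: "surj dec"

instantiation nat :: numbered
begin
definition dec_nat :: "nat \<Rightarrow> nat" where "dec_nat n = n"
instance by standard (auto simp: dec_nat_def surj_def)
end

instantiation bool :: numbered
begin
definition dec_bool :: "nat \<Rightarrow> bool" where "dec_bool n = (n \<noteq> 0)"
instance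
proof (standard, rule surjI)
  show "dec (if b then 1 else 0) = b" for b :: bool by (simp add: dec_bool_def)
qed
end

instantiation int :: numbered
begin
definition dec_int :: "nat \<Rightarrow> int" where "dec_int = int_decode"
instance by standard (simp add: dec_int_def surj_int_decode)
end

instantiation prod :: (numbered, numbered) numbered
begin
definition dec_prod :: "nat \<Rightarrow> 'a \<times> 'b"
  where "dec_prod n = (dec (fst (prod_decode n)), dec (snd (prod_decode n)))"
instance
proof (standard, unfold surj_def, intro allI)
  fix p :: "'a \<times> 'b"
  obtain a b where "fst p = dec a" "snd p = dec b"
    using surj_dec unfolding surj_def by metis
  then have "p = dec (prod_encode (a, b))" by (simp add: dec_prod_def prod_eq_iff)
  then show "\<exists>n. p = dec n" ..
qed
end

lemma dec_prod_encode: "dec (prod_encode (a, b)) = (dec a, dec b)"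
  by (simp add: dec_prod_def)

instantiation list :: (numbered) numbered
begin
definition dec_list :: "nat \<Rightarrow> 'a list"
  where "dec_list n = map dec (list_decode n)"
instance
proof (standard, unfold surj_def, intro allI)
  fix xs :: "'a list"
  have "xs = dec (list_encode (map (inv dec) xs))"
    by (simp add: dec_list_def comp_def surj_f_inv_f[OF surj_dec])
  then show "\<exists>n. xs = dec n" ..
qed
end

text \<open>
  Fractions with a positive denominator by construction, so that every pair denotes a rational.
\<close>

definition fraction :: "int \<times> nat \<Rightarrow> rat"
  where "fraction p = of_int (fst p) / of_nat (Suc (snd p))"

instantiation rat :: numbered
begin
definition dec_rat :: "nat \<Rightarrow> rat"
  where "dec_rat n = fraction (dec n)"
instance
proof (standard, unfold surj_def, intro allI)
  fix q :: rat
  obtain a b where ab: "quotient_of q = (a, b)" by force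
  then have "b > 0" "q = of_int a / of_int b"
    by (simp_all add: quotient_of_denom_pos quotient_of_div)
  then have "q = fraction (a, nat (b - 1))"
    by (simp add: fraction_def)
  moreover obtain n :: nat where "(a, nat (b - 1)) = dec n"
    using surj_dec[where 'a="int \<times> nat"] unfolding surj_def by metis
  ultimately show "\<exists>n. q = dec n" unfolding dec_rat_def by metis
qed
end

definition computable :: "('a::numbered \<Rightarrow> 'b::numbered) \<Rightarrow> bool"
  where "computable f \<longleftrightarrow> (\<exists>g. rec_nat1 g \<and> (\<forall>n. f (dec n) = dec (g n)))"

lemma computableI:
  assumes "rec_nat1 g" "\<And>n. f (dec n) = dec (g n)"
  shows "computable f"
  using assms unfolding computable_def by blast

lemma computableE:
  assumes "computable f"
  obtains g where "rec_nat1 g" "\<And>n. f (dec n) = dec (g n)"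
  using assms unfolding computable_def by blast

lemma computable_id: "computable (\<lambda>x. x)"
  by (rule computableI[OF rec_nat1_id]) simp

text \<open>
  Supplies a computable sequence that runs through all frequencies.
\<close>

lemma computable_dec: "computable (dec :: nat \<Rightarrow> 'a::numbered)"
  by (rule computableI[OF rec_nat1_id]) (simp add: dec_nat_def)

lemma computable_const: "computable (\<lambda>x. c)"
proof -
  obtain n where "c = dec n" using surj_dec unfolding surj_def by metis
  then show ?thesis by (intro computableI[of "\<lambda>_. n"] rec_nat1_intros)
qed

lemma computable_comp:
  assumes "computable f" "computable g"
  shows "computable (\<lambda>x. f (g x))"
proof -
  obtain f' where f': "rec_nat1 f'" "\<And>n. f (dec n) = dec (f' n)"
    by (rule computableE[OF assms(1)]) (rule that)
  obtain g' where g': "rec_nat1 g'" "\<And>n. g (dec n) = dec (g' n)"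
    by (rule computableE[OF assms(2)]) (rule that)
  show ?thesis
    by (rule computableI[of "\<lambda>n. f' (g' n)"], rule rec_nat1_comp[OF f'(1) g'(1)], simp add: f' g')
qed

lemma computable_Pair:
  assumes "computable f" "computable g"
  shows "computable (\<lambda>x. (f x, g x))"
proof -
  obtain f' where f': "rec_nat1 f'" "\<And>n. f (dec n) = dec (f' n)"
    by (rule computableE[OF assms(1)]) (rule that)
  obtain g' where g': "rec_nat1 g'" "\<And>n. g (dec n) = dec (g' n)"
    by (rule computableE[OF assms(2)]) (rule that)
  from f' g' show ?thesis
    by (intro computableI[of "\<lambda>n. prod_encode (f' n, g' n)"] rec_nat1_intros) (auto simp: dec_prod_encode)
qed

lemma computable_fst: "computable f \<Longrightarrow> computable (\<lambda>x. fst (f x))"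
  by (rule computable_comp[of fst], rule computableI[of "\<lambda>n. fst (prod_decode n)"],
      rule rec_nat1_intros(7)[OF rec_nat1_id], simp_all add: dec_prod_def)

lemma computable_snd: "computable f \<Longrightarrow> computable (\<lambda>x. snd (f x))"
  by (rule computable_comp[of snd], rule computableI[of "\<lambda>n. snd (prod_decode n)"],
      rule rec_nat1_intros(8)[OF rec_nat1_id], simp_all add: dec_prod_def)

lemma computable_comp2:
  assumes "computable (\<lambda>p. f (fst p) (snd p))" "computable g" "computable h"
  shows "computable (\<lambda>x. f (g x) (h x))"
  using computable_comp[OF assms(1) computable_Pair[OF assms(2,3)]] by simp

lemma computable_funpow:
  fixes h :: "'a::numbered \<Rightarrow> 'b::numbered \<Rightarrow> 'b"
  assumes h: "computable (\<lambda>p. h (fst p) (snd p))" and c: "computable c" and i: "computable i"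
  shows "computable (\<lambda>x. (h x ^^ c x) (i x))"
proof -
  obtain h' where h': "rec_nat1 h'" "\<And>n. (\<lambda>p. h (fst p) (snd p)) (dec n) = dec (h' n)"
    by (rule computableE[OF h]) (rule that)
  obtain c' where c': "rec_nat1 c'" "\<And>n. c (dec n) = dec (c' n)"
    by (rule computableE[OF c]) (rule that)
  obtain i' where i': "rec_nat1 i'" "\<And>n. i (dec n) = dec (i' n)"
    by (rule computableE[OF i]) (rule that)
  have step: "h (dec n) (dec r) = dec (h' (prod_encode (n, r)))" for n r
    using h'(2)[of "prod_encode (n, r)"] by (simp add: dec_prod_encode)
  have "(h (dec n) ^^ m) (dec r) = dec (((\<lambda>r. h' (prod_encode (n, r))) ^^ m) r)" for n m r
    by (induction m) (auto simp: step)
  then show ?thesis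
    by (intro computableI[OF rec_nat1_iterate[OF h'(1) c'(1) i'(1)]]) (simp add: c' i' dec_nat_def)
qed

lemma computable_Least:
  assumes P: "computable (\<lambda>p. P (fst p) (snd p))" and ex: "\<And>x. \<exists>y. P x y"
  shows "computable (\<lambda>x. LEAST y::nat. P x y)"
proof -
  obtain g where g: "rec_nat1 g" "\<And>n. (\<lambda>p. P (fst p) (snd p)) (dec n) = dec (g n)"
    by (rule computableE[OF P]) (rule that)
  have eq: "P (dec n) y \<longleftrightarrow> g (prod_encode (n, y)) \<noteq> 0" for n y
    using g(2)[of "prod_encode (n, y)"] by (simp add: dec_prod_encode dec_bool_def dec_nat_def)
  have "\<exists>y. g (prod_encode (n, y)) \<noteq> 0" for n
    using ex[of "dec n"] eq by auto
  from rec_nat1_Least[OF g(1) this] show ?thesis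
    by (rule computableI) (simp add: eq dec_nat_def)
qed

lemma computable_nat1:
  assumes "rec_nat1 f"
  shows "computable (f :: nat \<Rightarrow> nat)"
  using assms by (rule computableI) (simp add: dec_nat_def)

lemma computable_nat2:
  fixes f :: "nat \<Rightarrow> nat \<Rightarrow> 'a::numbered"
  assumes "rec_nat1 (\<lambda>n. f' (fst (prod_decode n)) (snd (prod_decode n)))" "\<And>a b. f a b = dec (f' a b)"
    "computable g" "computable h"
  shows "computable (\<lambda>x. f (g x) (h x))"
  by (rule computable_comp2[OF _ assms(3,4)], rule computableI[OF assms(1)])
     (simp add: dec_prod_def dec_nat_def assms)

lemma computable_Suc: "computable f \<Longrightarrow> computable (\<lambda>x. Suc (f x))"
  by (rule computable_comp[of Suc], rule computable_nat1, rule rec_nat1_intros(2)[OF rec_nat1_id], assumption)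

lemma computable_nat_arith:
  fixes f g :: "'a::numbered \<Rightarrow> nat"
  assumes "computable f" "computable g"
  shows "computable (\<lambda>x. f x + g x)" "computable (\<lambda>x. f x * g x)" "computable (\<lambda>x. f x - g x)"
    "computable (\<lambda>x. f x \<le> g x)"
proof -
  note 2 = computable_nat2[OF _ _ assms]
  show "computable (\<lambda>x. f x + g x)" and "computable (\<lambda>x. f x * g x)" "computable (\<lambda>x. f x - g x)"
    by (rule 2[of "(+)"] 2[of "(*)"] 2[of "(-)"], intro rec_nat1_intros rec_nat1_id, simp add: dec_nat_def)+
  show "computable (\<lambda>x. f x \<le> g x)"
    by (rule 2[of "\<lambda>a b. if a \<le> b then 1 else 0"], intro rec_nat1_intros rec_nat1_id, simp add: dec_bool_def)
qed

lemma computable_If: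
  assumes "computable b" "computable f" "computable g"
  shows "computable (\<lambda>x. if b x then f x else g x)"
proof -
  obtain b' where b': "rec_nat1 b'" "\<And>n. b (dec n) = dec (b' n)"
    by (rule computableE[OF assms(1)]) (rule that)
  obtain f' where f': "rec_nat1 f'" "\<And>n. f (dec n) = dec (f' n)"
    by (rule computableE[OF assms(2)]) (rule that)
  obtain g' where g': "rec_nat1 g'" "\<And>n. g (dec n) = dec (g' n)"
    by (rule computableE[OF assms(3)]) (rule that)
  show ?thesis
    by (rule computableI[of "\<lambda>n. if b' n \<le> 0 then g' n else f' n"], intro rec_nat1_intros b' f' g')
       (simp add: b' f' g' dec_bool_def)
qed

lemma computable_eqI:
  assumes "computable g" "\<And>x. f x = g x"
  shows "computable f"
proof -
  have "f = g" using assms(2) by auto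
  then show ?thesis using assms(1) by simp
qed

lemma computable_not:
  assumes "computable P"
  shows "computable (\<lambda>x. \<not> P x)"
  by (rule computable_eqI[of "\<lambda>x. if P x then False else True"])
     (intro computable_If computable_const assms, simp)

lemma computable_conj_disj:
  assumes "computable P" "computable Q"
  shows "computable (\<lambda>x. P x \<and> Q x)" "computable (\<lambda>x. P x \<or> Q x)"
proof -
  show "computable (\<lambda>x. P x \<and> Q x)"
    by (rule computable_eqI[of "\<lambda>x. if P x then Q x else False"])
       (intro computable_If computable_const assms, simp)
  show "computable (\<lambda>x. P x \<or> Q x)"
    by (rule computable_eqI[of "\<lambda>x. if P x then True else Q x"])
       (intro computable_If computable_const assms, simp)
qed

lemmas computable_bool = computable_conj_disj computable_not

section \<open>Computable operations on numbers and lists\<close>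

lemma computable_less_eq_nat:
  fixes f g :: "'a::numbered \<Rightarrow> nat"
  assumes "computable f" "computable g"
  shows "computable (\<lambda>x. f x < g x)" "computable (\<lambda>x. f x = g x)"
proof -
  have "(\<lambda>x. f x < g x) = (\<lambda>x. \<not> g x \<le> f x)" "(\<lambda>x. f x = g x) = (\<lambda>x. f x \<le> g x \<and> g x \<le> f x)"
    by (auto simp: fun_eq_iff)
  moreover have "computable (\<lambda>x. \<not> g x \<le> f x)" "computable (\<lambda>x. f x \<le> g x \<and> g x \<le> f x)"
    by (intro computable_bool computable_nat_arith assms)+
  ultimately show "computable (\<lambda>x. f x < g x)" "computable (\<lambda>x. f x = g x)" by simp_all
qed

text \<open>
  Even codes stand for non-negative integers and odd ones for negative integers.
\<close>

lemma rec_nat1_nat_int_decode: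
  assumes "rec_nat1 f"
  shows "rec_nat1 (\<lambda>n. nat (int_decode (f n)))" "rec_nat1 (\<lambda>n. nat (- int_decode (f n)))"
proof -
  have "(\<lambda>n. nat (int_decode (f n))) = (\<lambda>n. if f n \<le> 2 * (f n div 2) then f n div 2 else 0)"
    "(\<lambda>n. nat (- int_decode (f n))) = (\<lambda>n. if f n \<le> 2 * (f n div 2) then 0 else Suc (f n div 2))"
    by (auto simp: fun_eq_iff int_decode_def sum_decode_def elim: oddE)
  then show "rec_nat1 (\<lambda>n. nat (int_decode (f n)))" "rec_nat1 (\<lambda>n. nat (- int_decode (f n)))"
    using assms by (simp_all only:) (intro rec_nat1_intros; assumption)+
qed

lemma computable_nat:
  assumes "computable f"
  shows "computable (\<lambda>x. nat (f x))" "computable (\<lambda>x. nat (- f x))"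
  by (rule computable_comp[OF computableI assms, OF rec_nat1_nat_int_decode(1)[OF rec_nat1_id]]
     computable_comp[OF computableI assms, OF rec_nat1_nat_int_decode(2)[OF rec_nat1_id]];
     simp add: dec_nat_def dec_int_def)+

lemma computable_int_diff:
  assumes "computable f" "computable g"
  shows "computable (\<lambda>x. int (f x) - int (g x))"
proof (rule computable_nat2[OF _ _ assms])
  let ?h = "\<lambda>a b. if b \<le> a then 2 * (a - b) else Suc (2 * (b - a - 1))"
  show "rec_nat1 (\<lambda>n. ?h (fst (prod_decode n)) (snd (prod_decode n)))"
    by (intro rec_nat1_intros rec_nat1_id)
  show "int a - int b = dec (?h a b)" for a b
    by (auto simp: dec_int_def int_decode_def sum_decode_def)
qed

lemma computable_int:
  assumes "computable f"
  shows "computable (\<lambda>x. int (f x))"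
  using computable_int_diff[OF assms computable_const[of 0]] by simp

lemma computable_uminus_int:
  assumes "computable f"
  shows "computable (\<lambda>x. - f x :: int)"
proof -
  have eq: "- f x = int (nat (- f x)) - int (nat (f x))" for x
    by simp
  show ?thesis by (rule computable_eqI[OF _ eq]) (intro computable_int_diff computable_nat assms)
qed

lemma computable_add_mult_int:
  fixes f g :: "'a::numbered \<Rightarrow> int"
  assumes f: "computable f" and g: "computable g"
  shows "computable (\<lambda>x. f x + g x)" "computable (\<lambda>x. f x * g x)"
proof -
  have add: "f x + g x = int (nat (f x) + nat (g x)) - int (nat (- f x) + nat (- g x))" for x
    by simp
  show "computable (\<lambda>x. f x + g x)"
    by (rule computable_eqI[OF _ add]) (intro f g computable_int_diff computable_nat_arith computable_nat)
  have mult: "f x * g x = int (nat (f x) * nat (g x) + nat (- f x) * nat (- g x)) -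
      int (nat (f x) * nat (- g x) + nat (- f x) * nat (g x))" for x
    by (cases "f x \<ge> 0"; cases "g x \<ge> 0") (simp_all add: algebra_simps)
  show "computable (\<lambda>x. f x * g x)"
    by (rule computable_eqI[OF _ mult]) (intro f g computable_int_diff computable_nat_arith computable_nat)
qed

lemma computable_le_eq_int:
  fixes f g :: "'a::numbered \<Rightarrow> int"
  assumes f: "computable f" and g: "computable g"
  shows "computable (\<lambda>x. f x \<le> g x)" "computable (\<lambda>x. f x = g x)"
proof -
  have le: "f x \<le> g x \<longleftrightarrow> nat (f x + (- g x)) \<le> 0" for x
    by auto
  show "computable (\<lambda>x. f x \<le> g x)"
    by (rule computable_eqI[OF _ le])
       (intro computable_nat_arith computable_nat computable_add_mult_int computable_uminus_int f g computable_const)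
  have eq: "f x = g x \<longleftrightarrow> nat (f x + (- g x)) \<le> 0 \<and> nat (g x + (- f x)) \<le> 0" for x
    by auto
  show "computable (\<lambda>x. f x = g x)"
    by (rule computable_eqI[OF _ eq])
       (intro computable_bool computable_nat_arith computable_nat computable_add_mult_int computable_uminus_int
         f g computable_const)
qed

lemmas computable_int_arith = computable_uminus_int computable_add_mult_int computable_le_eq_int

lemma computable_fraction:
  assumes "computable f" shows "computable (\<lambda>x. fraction (f x))"
  by (rule computable_comp[OF computableI[OF rec_nat1_id] assms]) (simp add: dec_rat_def)

text \<open>
  A rational and its unreduced fraction have the same codes. Hence an operation on rationals is
  computed by any formula for it in terms of numerators and denominators.
\<close>

lemma computable_rat_lift:
  assumes "computable g" "\<And>p. f (fraction p) = g p"
  shows "computable f"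
proof -
  obtain g' where "rec_nat1 g'" "\<And>n. g (dec n) = dec (g' n)"
    by (rule computableE[OF assms(1)]) (rule that)
  then show ?thesis by (intro computableI[of g']) (auto simp: dec_rat_def assms(2))
qed

lemma computable_rat_lift2:
  assumes "computable (\<lambda>p. g (fst p) (snd p))" "\<And>p q. f (fraction p) (fraction q) = g p q"
    and "computable h" "computable k"
  shows "computable (\<lambda>x. f (h x) (k x))"
proof (rule computable_comp2[OF _ assms(3,4)])
  obtain g' where "rec_nat1 g'" "\<And>n. (\<lambda>p. g (fst p) (snd p)) (dec n) = dec (g' n)"
    by (rule computableE[OF assms(1)]) (rule that)
  then show "computable (\<lambda>p. f (fst p) (snd p))"
    by (intro computableI[of g']) (auto simp: dec_prod_def dec_rat_def assms(2))
qed

lemma computable_rat: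
  fixes f g :: "'a::numbered \<Rightarrow> rat"
  assumes f: "computable f" and g: "computable g"
  shows "computable (\<lambda>x. f x + g x)" "computable (\<lambda>x. f x * g x)" "computable (\<lambda>x. f x \<le> g x)"
proof -
  note rules = computable_bool computable_nat_arith computable_int_arith computable_nat computable_int computable_Pair
    computable_fst computable_snd computable_id computable_const computable_fraction computable_Suc computable_If
  show "computable (\<lambda>x. f x + g x)"
  proof (rule computable_rat_lift2[OF _ _ f g])
    let ?g = "\<lambda>p q. fraction (fst p * int (Suc (snd q)) + fst q * int (Suc (snd p)), Suc (snd p) * Suc (snd q) - 1)"
    show "computable (\<lambda>p. ?g (fst p) (snd p))" by (intro rules)
    have "Suc (Suc a * Suc b - 1) = Suc a * Suc b" for a b by simp
    then show "fraction p + fraction q = ?g p q" for p q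
      unfolding fraction_def fst_conv snd_conv by (simp only: of_nat_mult of_int_add of_int_mult of_int_of_nat_eq) (simp add: field_simps)
  qed
  show "computable (\<lambda>x. f x * g x)"
  proof (rule computable_rat_lift2[OF _ _ f g])
    let ?g = "\<lambda>p q. fraction (fst p * fst q, Suc (snd p) * Suc (snd q) - 1)"
    show "computable (\<lambda>p. ?g (fst p) (snd p))" by (intro rules)
    have "Suc (Suc a * Suc b - 1) = Suc a * Suc b" for a b by simp
    then show "fraction p * fraction q = ?g p q" for p q
      unfolding fraction_def fst_conv snd_conv by (simp only: of_nat_mult of_int_mult) (simp add: field_simps)
  qed
  show "computable (\<lambda>x. f x \<le> g x)"
  proof (rule computable_rat_lift2[OF _ _ f g, of "\<lambda>p q. fst p * int (Suc (snd q)) \<le> fst q * int (Suc (snd p))"])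
    let ?g = "\<lambda>p q. fst p * int (Suc (snd q)) \<le> fst q * int (Suc (snd p))"
    show "computable (\<lambda>p. ?g (fst p) (snd p))" by (intro rules)
    show "fraction p \<le> fraction q \<longleftrightarrow> ?g p q" for p q
    proof -
      have "fraction p \<le> fraction q \<longleftrightarrow> of_int (fst p) * of_nat (Suc (snd q)) \<le> of_int (fst q) * (of_nat (Suc (snd p)) :: rat)"
        unfolding fraction_def by (simp add: divide_simps del: of_nat_Suc)
      also have "\<dots> \<longleftrightarrow> (of_int (fst p * int (Suc (snd q))) :: rat) \<le> of_int (fst q * int (Suc (snd p)))"
        by simp
      finally show ?thesis unfolding of_int_le_iff .
    qed
  qed
qed

lemma computable_abs_rat:
  assumes "computable f"
  shows "computable (\<lambda>x. \<bar>f x\<bar> :: rat)"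
proof -
  note rules = computable_int_arith computable_Pair computable_fst computable_snd computable_id
    computable_const computable_fraction computable_If
  have "computable (\<lambda>q::rat. \<bar>q\<bar>)"
  proof (rule computable_rat_lift)
    show "computable (\<lambda>p. fraction (if 0 \<le> fst p then fst p else - fst p, snd p))" by (intro rules)
    show "\<bar>fraction p\<bar> = fraction (if 0 \<le> fst p then fst p else - fst p, snd p)" for p
      by (auto simp: fraction_def abs_divide)
  qed
  from computable_comp[OF this assms] show ?thesis .
qed

lemma computable_of_nat_rat:
  assumes "computable f"
  shows "computable (\<lambda>x. of_nat (f x) :: rat)" "computable (\<lambda>x. inverse (of_nat (f x)) :: rat)"
proof -
  note rules = computable_bool computable_nat_arith computable_int_arith computable_nat computable_int computable_Pair
    computable_fst computable_snd computable_id computable_const computable_fraction computable_Suc computable_If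
  have "computable (\<lambda>x. fraction (int (f x), 0))"
    "computable (\<lambda>x. fraction (if f x \<le> 0 then 0 else 1, f x - 1))"
    using assms by (intro rules; assumption)+
  moreover have "fraction (int n, 0) = of_nat n" "fraction (if n \<le> 0 then 0 else 1, n - 1) = inverse (of_nat n)" for n
    by (auto simp: fraction_def field_simps)
  ultimately show "computable (\<lambda>x. of_nat (f x) :: rat)" "computable (\<lambda>x. inverse (of_nat (f x)) :: rat)" by simp_all
qed

lemma computable_Cons:
  assumes "computable f" "computable g"
  shows "computable (\<lambda>x. f x # g x)"
proof -
  obtain f' where f': "rec_nat1 f'" "\<And>n. f (dec n) = dec (f' n)"
    by (rule computableE[OF assms(1)]) (rule that)
  obtain g' where g': "rec_nat1 g'" "\<And>n. g (dec n) = dec (g' n)"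
    by (rule computableE[OF assms(2)]) (rule that)
  show ?thesis
    by (rule computableI[of "\<lambda>n. Suc (prod_encode (f' n, g' n))"], intro rec_nat1_intros f' g')
       (simp add: f' g' dec_list_def)
qed

lemma funpow_fixpoint: "f x = x \<Longrightarrow> (f ^^ n) x = x"
  by (induction n) auto

text \<open>
  Folding over a coded list is iteration of a step that splits off the head. The code of a list
  bounds its length, and the step does nothing on the empty list, so every number of iterations
  from the code upwards gives the result.
\<close>

lemma fold_as_funpow:
  defines "st \<equiv> \<lambda>h p. if fst p = 0 then p
    else (snd (prod_decode (fst p - 1)), h (fst (prod_decode (fst p - 1))) (snd p))"
  assumes "list_decode n = xs" "n \<le> m"
  shows "snd ((st h ^^ m) (n, s)) = fold h xs s"
  using assms(2,3)
proof (induction xs arbitrary: n m s)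
  case Nil
  then have "n = 0" by (metis list_decode_inverse list_encode.simps(1))
  then show ?case by (subst funpow_fixpoint) (auto simp: st_def)
next
  case (Cons x xs)
  then have n: "n = Suc (prod_encode (x, list_encode xs))"
    by (metis list_decode_inverse list_encode.simps(2))
  then obtain m' where m: "m = Suc m'" using Cons.prems by (cases m) auto
  have "list_encode xs \<le> m'"
    using le_prod_encode_2[of "list_encode xs" x] Cons.prems(2) n m by linarith
  then have "snd ((st h ^^ m') (list_encode xs, h x s)) = fold h xs (h x s)"
    by (intro Cons.IH) simp
  moreover have "st h (n, s) = (list_encode xs, h x s)"
    by (simp add: st_def n)
  ultimately show ?case by (simp add: m funpow_swap1[symmetric] funpow_Suc_right del: funpow.simps)
qed

lemma computable_fold:
  assumes h: "computable (\<lambda>p. h (fst p) (fst (snd p)) (snd (snd p)))"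
    and l: "computable l" and i: "computable i"
  shows "computable (\<lambda>x. fold (h x) (l x) (i x))"
proof -
  obtain h' where h': "rec_nat1 h'"
    "\<And>n. (\<lambda>p. h (fst p) (fst (snd p)) (snd (snd p))) (dec n) = dec (h' n)"
    by (rule computableE[OF h]) (rule that)
  obtain l' where l': "rec_nat1 l'" "\<And>n. l (dec n) = dec (l' n)"
    by (rule computableE[OF l]) (rule that)
  obtain i' where i': "rec_nat1 i'" "\<And>n. i (dec n) = dec (i' n)"
    by (rule computableE[OF i]) (rule that)
  define st where "st h p = (if fst p = 0 then p
    else (snd (prod_decode (fst p - 1)), h (fst (prod_decode (fst p - 1))) (snd p)))"
    for h :: "nat \<Rightarrow> nat \<Rightarrow> nat" and p
  define hh where "hh n a s = h' (prod_encode (n, prod_encode (a, s)))" for n a s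
  define g where "g q = (let n = fst (prod_decode q); c = fst (prod_decode (snd (prod_decode q)));
     s = snd (prod_decode (snd (prod_decode q))) in
     if c \<le> 0 then snd (prod_decode q) else prod_encode (snd (prod_decode (c - 1)), hh n (fst (prod_decode (c - 1))) s))" for q
  have "rec_nat1 g"
    unfolding g_def Let_def hh_def
    by (intro rec_nat1_intros rec_nat1_comp[OF h'(1)] rec_nat1_id)
  moreover have step: "g (prod_encode (n, prod_encode p)) = prod_encode (st (hh n) p)" for n p
    by (cases p) (simp add: g_def st_def)
  then have "((\<lambda>r. g (prod_encode (n, r))) ^^ m) (prod_encode p) = prod_encode ((st (hh n) ^^ m) p)" for n m p
    by (induction m) auto
  then have it: "snd (prod_decode (((\<lambda>r. g (prod_encode (n, r))) ^^ l' n) (prod_encode (l' n, i' n)))) =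
     fold (hh n) (list_decode (l' n)) (i' n)" for n
    using fold_as_funpow[of "l' n" _ "l' n" "hh n", OF refl order_refl] unfolding st_def by simp
  have "dec (fold (hh n) xs s) = fold (h (dec n)) (map dec xs) (dec s)" for n xs s
    by (induction xs arbitrary: s)
       (use h'(2)[of "prod_encode (n, prod_encode (_, _))"] in \<open>auto simp: hh_def dec_prod_encode\<close>)
  then have "dec (fold (hh n) (list_decode (l' n)) (i' n)) = fold (h (dec n)) (l (dec n)) (i (dec n))" for n
    by (simp add: l' i' dec_list_def)
  with it show ?thesis
    by (intro computableI[of "\<lambda>n. snd (prod_decode (((\<lambda>r. g (prod_encode (n, r))) ^^ l' n) (prod_encode (l' n, i' n))))"]
      rec_nat1_intros rec_nat1_iterate \<open>rec_nat1 g\<close> l'(1) i'(1)) simp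
qed

lemma computable_rev:
  assumes "computable f"
  shows "computable (\<lambda>x. rev (f x))"
proof -
  have eq: "rev xs = fold (\<lambda>a s. a # s) xs []" for xs :: "'z list"
    by (simp add: fold_Cons_rev)
  show ?thesis
    unfolding eq by (intro assms computable_fold computable_Cons computable_fst computable_snd computable_const computable_id)
qed

lemma computable_foldr:
  assumes "computable (\<lambda>p. h (fst p) (fst (snd p)) (snd (snd p)))" "computable l" "computable i"
  shows "computable (\<lambda>x. foldr (h x) (l x) (i x))"
  unfolding foldr_conv_fold using assms by (intro computable_fold computable_rev)

lemma computable_append:
  assumes "computable f" "computable g"
  shows "computable (\<lambda>x. f x @ g x)"
proof -
  have eq: "xs @ ys = foldr (\<lambda>a s. a # s) xs ys" for xs ys :: "'z list"
    by (induction xs) auto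
  show ?thesis
    unfolding eq by (intro assms computable_foldr computable_Cons computable_fst computable_snd computable_const computable_id)
qed

lemma computable_map:
  assumes "computable (\<lambda>p. h (fst p) (snd p))" "computable l"
  shows "computable (\<lambda>x. map (h x) (l x))"
proof -
  have eq: "map f xs = foldr (\<lambda>a s. f a # s) xs []" for xs and f :: "'z \<Rightarrow> 'y"
    by (induction xs) auto
  show ?thesis
    unfolding eq by (intro assms computable_foldr computable_Cons computable_fst computable_snd computable_const computable_id
      computable_comp2[OF assms(1)])
qed

lemma computable_filter:
  assumes "computable (\<lambda>p. h (fst p) (snd p))" "computable l"
  shows "computable (\<lambda>x. filter (h x) (l x))"
proof -
  have eq: "filter f xs = foldr (\<lambda>a s. if f a then a # s else s) xs []" for xs and f :: "'z \<Rightarrow> bool"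
    by (induction xs) auto
  show ?thesis
    unfolding eq by (intro assms computable_foldr computable_If computable_Cons computable_fst computable_snd computable_const computable_id
      computable_comp2[OF assms(1)])
qed

lemma computable_concat:
  assumes "computable f"
  shows "computable (\<lambda>x. concat (f x))"
proof -
  have eq: "concat xs = foldr (\<lambda>a s. a @ s) xs []" for xs :: "'z list list"
    by (induction xs) auto
  show ?thesis
    unfolding eq by (intro assms computable_foldr computable_append computable_fst computable_snd computable_const computable_id)
qed

lemma computable_list_all:
  assumes "computable (\<lambda>p. h (fst p) (snd p))" "computable l"
  shows "computable (\<lambda>x. list_all (h x) (l x))"
proof -
  have eq: "list_all f xs = foldr (\<lambda>a s. f a \<and> s) xs True" for xs and f :: "'z \<Rightarrow> bool"
    by (induction xs) auto
  show ?thesis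
    unfolding eq by (intro assms computable_foldr computable_bool computable_fst computable_snd computable_const computable_id
      computable_comp2[OF assms(1)])
qed

lemma computable_sum_list_rat:
  assumes "computable f"
  shows "computable (\<lambda>x. sum_list (f x) :: rat)"
  unfolding sum_list.eq_foldr
  using assms by (intro computable_foldr computable_rat computable_fst computable_snd computable_const computable_id)

lemma computable_sum_list_nat:
  assumes "computable f"
  shows "computable (\<lambda>x. sum_list (f x) :: nat)"
  unfolding sum_list.eq_foldr
  using assms by (intro computable_foldr computable_nat_arith computable_fst computable_snd computable_const computable_id)

lemma computable_upt:
  assumes "computable f"
  shows "computable (\<lambda>x. [0..<f x])"
proof -
  have eq: "[0..<n] = rev (snd (((\<lambda>p. (Suc (fst p), fst p # snd p)) ^^ n) (0, [])))" for n
  proof -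
    have "((\<lambda>p. (Suc (fst p), fst p # snd p)) ^^ n) (0, []) = (n, rev [0..<n])"
      by (induction n) auto
    then show ?thesis by simp
  qed
  show ?thesis unfolding eq
    by (intro assms computable_rev computable_snd computable_fst computable_funpow computable_Pair
      computable_Suc computable_Cons computable_const computable_id)
qed

section \<open>Computable operations on integer vectors\<close>

text \<open>
  An arbitrary numbering of the coordinates; its values need not be consecutive.
\<close>

definition idx :: "'n::finite \<Rightarrow> nat"
  where "idx = (SOME p. inj p)"

lemma inj_idx: "inj (idx :: 'n::finite \<Rightarrow> nat)"
proof -
  have "\<exists>p :: 'n \<Rightarrow> nat. inj p"
    using finite_imp_inj_to_nat_seg[of "UNIV :: 'n set"] by auto
  then show ?thesis unfolding idx_def by (rule someI_ex)
qed

text \<open>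
  Tuples are coded as right-nested pairs. Unlike list codes, every number has components at all
  positions, which makes the numbering of vectors total.
\<close>

definition tuple_comp :: "nat \<Rightarrow> nat \<Rightarrow> nat"
  where "tuple_comp j n = fst (prod_decode (((\<lambda>m. snd (prod_decode m)) ^^ j) n))"

fun tuple_encode :: "nat list \<Rightarrow> nat" where
  "tuple_encode [] = 0"
| "tuple_encode (x # xs) = prod_encode (x, tuple_encode xs)"

lemma tuple_comp_encode: "j < length xs \<Longrightarrow> tuple_comp j (tuple_encode xs) = xs ! j"
proof (induction xs arbitrary: j)
  case (Cons x xs)
  then show ?case
    by (cases j) (auto simp: tuple_comp_def funpow_Suc_right simp del: funpow.simps(2))
qed simp

lemma rec_fun_tuple_encode:
  assumes "\<And>h. h \<in> set hs \<Longrightarrow> rec_fun n h"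
  shows "rec_fun n (\<lambda>x. tuple_encode (map (\<lambda>h. h x) hs))"
  using assms by (induction hs) (auto intro!: rec_fun_const rec_fun_prod_encode)

lemma rec_nat1_tuple_comp: "rec_nat1 (tuple_comp j)"
proof -
  have "rec_nat1 (\<lambda>n. ((\<lambda>m. snd (prod_decode m)) ^^ j) n)"
    by (induction j) (auto intro: rec_nat1_id rec_nat1_intros)
  then show ?thesis unfolding tuple_comp_def[abs_def] by (rule rec_nat1_intros)
qed

definition family_encode :: "('n::finite \<Rightarrow> nat) \<Rightarrow> nat"
  where "family_encode h = tuple_encode (map (\<lambda>j. h (inv idx j)) [0..<Suc (Max (range (idx :: 'n \<Rightarrow> nat)))])"

lemma tuple_comp_family_encode:
  fixes h :: "'n::finite \<Rightarrow> nat"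
  shows "tuple_comp (idx i) (family_encode h) = h i"
proof -
  have "idx i < Suc (Max (range (idx :: 'n \<Rightarrow> nat)))"
    by (simp add: less_Suc_eq_le)
  then show ?thesis
    unfolding family_encode_def
    by (subst tuple_comp_encode) (auto simp del: upt_Suc simp: inv_f_f[OF inj_idx])
qed

lemma rec_fun_family_encode:
  fixes h :: "'n::finite \<Rightarrow> nat list \<Rightarrow> nat"
  assumes "\<And>i. rec_fun n (h i)"
  shows "rec_fun n (\<lambda>x. family_encode (\<lambda>i. h i x))"
  unfolding family_encode_def
  using rec_fun_tuple_encode[of "map (\<lambda>j. h (inv idx j)) [0..<Suc (Max (range (idx :: 'n \<Rightarrow> nat)))]" n] assms
  by (auto simp: comp_def simp del: upt_Suc)

instantiation vec :: (numbered, finite) numbered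
begin
definition dec_vec :: "nat \<Rightarrow> ('a, 'b) vec"
  where "dec_vec n = (\<chi> i. dec (tuple_comp (idx i) n))"
instance
proof (standard, unfold surj_def, intro allI)
  fix v :: "('a, 'b) vec"
  have "v = dec (family_encode (\<lambda>i. inv dec (v $ i)))"
    by (simp add: dec_vec_def tuple_comp_family_encode surj_f_inv_f[OF surj_dec] vec_eq_iff)
  then show "\<exists>n. v = dec n" ..
qed
end

lemma computable_vec_nth:
  fixes f :: "'a::numbered \<Rightarrow> ('b::numbered)^('n::finite)"
  assumes "computable f"
  shows "computable (\<lambda>x. f x $ i)"
  by (rule computable_comp[OF computableI[OF rec_nat1_tuple_comp] assms]) (simp add: dec_vec_def)

lemma computable_vec_lambda:
  fixes f :: "'n::finite \<Rightarrow> 'a::numbered \<Rightarrow> 'b::numbered"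
  assumes "\<And>i. computable (f i)"
  shows "computable (\<lambda>x. \<chi> i. f i x)"
proof -
  have "\<forall>i. \<exists>g. rec_nat1 g \<and> (\<forall>n. f i (dec n) = dec (g n))"
    using assms unfolding computable_def by auto
  then obtain g where g: "\<And>i. rec_nat1 (g i)" "\<And>i n. f i (dec n) = dec (g i n)"
    by metis
  have "rec_nat1 (\<lambda>n. family_encode (\<lambda>i. g i n))"
    unfolding rec_nat1_def by (rule rec_fun_family_encode) (use g(1) in \<open>simp add: rec_nat1_def\<close>)
  then show ?thesis
    by (rule computableI) (simp add: dec_vec_def tuple_comp_family_encode g(2))
qed

lemma computable_sum_int:
  assumes "finite S" "\<And>i. computable (f i)"
  shows "computable (\<lambda>x. \<Sum>i\<in>S. f i x :: int)"
  using assms(1)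
proof induction
  case (insert i S)
  then show ?case
    using computable_add_mult_int(1)[OF assms(2)[of i] insert.IH] by simp
qed (simp add: computable_const)

lemma computable_All_finite:
  fixes P :: "'n::finite \<Rightarrow> 'a::numbered \<Rightarrow> bool"
  assumes "\<And>i. computable (P i)"
  shows "computable (\<lambda>x. \<forall>i. P i x)"
proof -
  have "computable (\<lambda>x. \<forall>i\<in>S. P i x)" if "finite S" for S
    using that
  proof induction
    case (insert i S)
    then show ?case
      using computable_conj_disj(1)[OF assms[of i] insert.IH] by simp
  qed (simp add: computable_const)
  from this[of UNIV] show ?thesis by simp
qed

lemma computable_vec_arith:
  fixes f g :: "'a::numbered \<Rightarrow> int^('n::finite)"
  assumes "computable f" "computable g"
  shows "computable (\<lambda>x. f x + g x)" "computable (\<lambda>x. f x = g x)"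
proof -
  have add: "f x + g x = (\<chi> i. f x $ i + g x $ i)" and eq: "f x = g x \<longleftrightarrow> (\<forall>i. f x $ i = g x $ i)" for x
    by (simp_all add: vec_eq_iff)
  show "computable (\<lambda>x. f x + g x)"
    unfolding add by (intro computable_vec_lambda computable_int_arith computable_vec_nth assms)
  show "computable (\<lambda>x. f x = g x)"
    unfolding eq by (intro computable_All_finite computable_int_arith computable_vec_nth assms)
qed

lemma computable_uminus_vec:
  fixes f :: "'a::numbered \<Rightarrow> int^('n::finite)"
  assumes "computable f"
  shows "computable (\<lambda>x. - f x)"
proof -
  have eq: "- f x = (\<chi> i. - (f x $ i))" for x
    by (simp add: vec_eq_iff)
  show ?thesis
    unfolding eq by (intro computable_vec_lambda computable_int_arith computable_vec_nth assms)
qed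

lemma computable_matrix_vector_mult:
  fixes f :: "'a::numbered \<Rightarrow> int^('n::finite)" and A :: "int^'n^('m::finite)"
  assumes "computable f"
  shows "computable (\<lambda>x. A *v f x)"
  unfolding matrix_vector_mult_def
  by (intro computable_vec_lambda computable_sum_int computable_int_arith computable_vec_nth assms computable_const) simp

text \<open>The least upper bound formulation makes the maximum norm visibly computable.\<close>

text \<open>
  The maximum norm as a least bound, a form in which it is computed by a search.
\<close>

definition max_norm :: "int^('n::finite) \<Rightarrow> nat"
  where "max_norm k = (LEAST n. \<forall>i. k $ i \<le> int n \<and> - (k $ i) \<le> int n)"

lemma max_norm_le_iff: "max_norm k \<le> n \<longleftrightarrow> (\<forall>i. \<bar>k $ i\<bar> \<le> int n)"
proof -
  let ?P = "\<lambda>n. \<forall>i. k $ i \<le> int n \<and> - (k $ i) \<le> int n"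
  have "?P (Max (range (\<lambda>i. nat \<bar>k $ i\<bar>)))"
  proof
    fix i
    have "nat \<bar>k $ i\<bar> \<le> Max (range (\<lambda>i. nat \<bar>k $ i\<bar>))" by simp
    then show "k $ i \<le> int (Max (range (\<lambda>i. nat \<bar>k $ i\<bar>))) \<and> - (k $ i) \<le> int (Max (range (\<lambda>i. nat \<bar>k $ i\<bar>)))"
      by linarith
  qed
  then have "?P (max_norm k)" unfolding max_norm_def by (rule LeastI)
  moreover have "max_norm k \<le> n" if "?P n"
    unfolding max_norm_def using that by (rule Least_le)
  moreover have "?P n \<longleftrightarrow> (\<forall>i. \<bar>k $ i\<bar> \<le> int n)" for n
    by (auto simp: abs_le_iff)
  ultimately show ?thesis
    by (meson dual_order.trans of_nat_mono)
qed

lemma computable_max_norm: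
  fixes f :: "'a::numbered \<Rightarrow> int^('n::finite)"
  assumes "computable f"
  shows "computable (\<lambda>x. max_norm (f x))"
proof (rule computable_comp[OF _ assms], unfold max_norm_def[abs_def], rule computable_Least)
  show "computable (\<lambda>p::(int^'n) \<times> nat. \<forall>i. fst p $ i \<le> int (snd p) \<and> - (fst p $ i) \<le> int (snd p))"
    by (intro computable_All_finite computable_bool computable_int_arith computable_int computable_vec_nth
        computable_fst computable_snd computable_id)
  show "\<exists>n. \<forall>i. k $ i \<le> int n \<and> - (k $ i) \<le> int n" for k :: "int^'n"
    using max_norm_le_iff[of k "max_norm k"] by (intro exI[of _ "max_norm k"]) (simp add: abs_le_iff)
qed

text \<open>
  An arbitrary enumeration of the coordinates is converted to the nested-pair code of the vector
  by rearranging the arguments. The numerator and the denominator are then read off the code of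
  the value.
\<close>

theorem computable_imp_computable_on:
  fixes c :: "int^('n::finite) \<Rightarrow> rat"
  assumes "computable c"
  shows "computable_on S c"
  unfolding computable_on_def
proof (intro allI impI)
  fix xs :: "'n list"
  assume xs: "distinct xs \<and> set xs = UNIV"
  then have len: "length xs = CARD('n)" using distinct_card by fastforce
  have "\<forall>i. \<exists>p<CARD('n). xs ! p = i"
    using xs len by (metis UNIV_I in_set_conv_nth)
  then obtain pos where pos: "\<And>i. pos i < CARD('n)" "\<And>i. xs ! pos i = i"
    by metis
  obtain g where g: "rec_nat1 g" "\<And>n. c (dec n) = dec (g n)"
    using assms unfolding computable_def by blast
  define h where "h ys = g (family_encode (\<lambda>i::'n. ys ! pos i))" for ys
  have h: "rec_fun CARD('n) h"
    unfolding h_def using g(1) unfolding rec_nat1_def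
    by (rule rec_fun_apply1) (intro rec_fun_family_encode rec_fun_proj pos)
  obtain p where p: "recursive CARD('n) p" "\<And>ys. length ys = CARD('n) \<Longrightarrow> p ys = fst (prod_decode (h ys))"
    using rec_fun_prod_decode(1)[OF h] unfolding rec_fun_def by blast
  obtain q where q: "recursive CARD('n) q" "\<And>ys. length ys = CARD('n) \<Longrightarrow> q ys = Suc (snd (prod_decode (h ys)))"
    using rec_fun_Suc[OF rec_fun_prod_decode(2)[OF h]] unfolding rec_fun_def by blast
  have "q ys \<noteq> 0 \<and> c k = of_int (int_decode (p ys)) / of_nat (q ys)"
    if ys: "ys = map (\<lambda>i. int_encode (k $ i)) xs" for k ys
  proof -
    have "ys ! pos i = int_encode (k $ i)" for i
      using ys pos len by simp
    then have "dec (family_encode (\<lambda>i::'n. ys ! pos i)) = k"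
      by (simp add: dec_vec_def tuple_comp_family_encode dec_int_def vec_eq_iff)
    then have "c k = dec (h ys)"
      using g(2) unfolding h_def by metis
    then show ?thesis
      using p(2)[of ys] q(2)[of ys] ys len
      by (simp add: dec_rat_def fraction_def dec_prod_def dec_int_def dec_nat_def)
  qed
  then show "\<exists>p q. recursive CARD('n) p \<and> recursive CARD('n) q \<and>
      (\<forall>k\<in>S. let xs = map (\<lambda>i. int_encode (k $ i)) xs in
        q xs \<noteq> 0 \<and> c k = of_int (int_decode (p xs)) / of_nat (q xs))"
    using p(1) q(1) unfolding Let_def by blast
qed

lemmas computable_intros =
  computable_bool computable_nat_arith computable_less_eq_nat computable_int_arith computable_nat computable_int
  computable_rat computable_abs_rat computable_of_nat_rat computable_vec_arith computable_uminus_vec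
  computable_matrix_vector_mult computable_vec_nth computable_max_norm
  computable_Pair computable_fst computable_snd computable_id computable_const computable_Suc computable_If
  computable_Cons computable_append computable_map computable_filter computable_concat computable_list_all
  computable_sum_list_rat computable_sum_list_nat computable_upt computable_rev computable_fold

section \<open>Characters of the torus\<close>

lemma torus_char_proj:
  "torus_char k (torus_proj x) = exp (2 * of_real pi * \<i> * of_real (vec_of_int k \<bullet> x))"
  by (rule torus_char.abs_eq)

lemma torus_proj_cases: obtains y where "x = torus_proj y"
  by (rule that[of "torus_rep x"]) (simp add: Quotient3_abs_rep[OF Quotient3_torus])

text \<open>
  The universal property of the quotient topology.
\<close>

lemma continuous_on_torusI:
  fixes f :: "'n::finite torus \<Rightarrow> 'b::topological_space"
  assumes "continuous_on UNIV (\<lambda>y. f (torus_proj y))"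
  shows "continuous_on UNIV f"
proof -
  have "open (f -` B)" if "open B" for B
  proof -
    have "open ((\<lambda>y. f (torus_proj y)) -` B)"
      using assms that by (simp add: continuous_on_open_vimage)
    moreover have "torus_proj -` (f -` B) = (\<lambda>y. f (torus_proj y)) -` B" by auto
    ultimately show ?thesis by (simp add: open_torus_def)
  qed
  then show ?thesis by (simp add: continuous_on_open_vimage)
qed

lemma continuous_on_torus_char: "continuous_on UNIV (torus_char k)"
  by (rule continuous_on_torusI) (auto simp: torus_char_proj intro!: continuous_intros)

lemma torus_char_0 [simp]: "torus_char 0 x = 1"
  by (rule torus_proj_cases[of x]) (simp add: torus_char_proj vec_of_int_def inner_vec_def)

lemma torus_char_add: "torus_char (k + l) x = torus_char k x * torus_char l x"
proof (rule torus_proj_cases[of x])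
  fix y assume x: "x = torus_proj y"
  have "vec_of_int (k + l) = vec_of_int k + vec_of_int l"
    by (simp add: vec_of_int_def vec_eq_iff)
  then show ?thesis
    unfolding x torus_char_proj by (simp add: inner_add_left distrib_left exp_add)
qed

lemma torus_char_minus: "torus_char (- k) x = cnj (torus_char k x)"
proof (rule torus_proj_cases[of x])
  fix y assume x: "x = torus_proj y"
  have "vec_of_int (- k) = - vec_of_int k"
    by (simp add: vec_of_int_def vec_eq_iff)
  then show ?thesis
    unfolding x torus_char_proj by (simp add: exp_cnj)
qed

lemma norm_torus_char [simp]: "norm (torus_char k x) = 1"
  by (rule torus_proj_cases[of x]) (simp add: torus_char_proj)

lemma torus_char_toral_map:
  "torus_char k (toral_map B x) = torus_char (transpose B *v k) x"
proof (rule torus_proj_cases[of x])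
  fix y assume x: "x = torus_proj y"
  have "vec_of_int k \<bullet> (map_matrix real_of_int B *v y) = (\<Sum>i\<in>UNIV. \<Sum>j\<in>UNIV. k $ i * (B $ i $ j * y $ j))"
    by (simp add: vec_of_int_def inner_vec_def matrix_vector_mult_def sum_distrib_left)
  also have "\<dots> = (\<Sum>j\<in>UNIV. \<Sum>i\<in>UNIV. k $ i * (B $ i $ j * y $ j))"
    by (rule sum.swap)
  also have "\<dots> = vec_of_int (transpose B *v k) \<bullet> y"
    by (simp add: vec_of_int_def inner_vec_def matrix_vector_mult_def transpose_def sum_distrib_left sum_distrib_right mult_ac)
  finally show ?thesis
    unfolding x toral_map.abs_eq torus_char_proj by simp
qed

lemma integrable_continuous_torus:
  fixes f :: "'n::finite torus \<Rightarrow> 'b::{banach, second_countable_topology}"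
  assumes "finite_measure M" "sets M = sets borel" "continuous_on UNIV f" "\<And>x. norm (f x) \<le> C"
  shows "integrable M f"
proof (rule finite_measure.integrable_const_bound[OF assms(1)])
  show "AE x in M. norm (f x) \<le> C" using assms(4) by simp
  have "f \<in> borel_measurable borel"
    using assms(3) by (rule borel_measurable_continuous_onI)
  then show "f \<in> borel_measurable M"
    using measurable_cong_sets[OF assms(2) refl] by blast
qed

section \<open>Lebesgue measure\<close>

lemma sets_torus_lebesgue: "sets torus_lebesgue = sets borel"
  by (simp add: torus_lebesgue_def)

text \<open>
  Fubini's theorem for a product of functions of the single coordinates.
\<close>

lemma integral_lborel_prod_cart:
  fixes f :: "'n::finite \<Rightarrow> real \<Rightarrow> complex"
  assumes "\<And>i. integrable lborel (f i)"
  shows "(LINT x|lborel. (\<Prod>i\<in>UNIV. f i (x $ i))) = (\<Prod>i\<in>UNIV. integral\<^sup>L lborel (f i))"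
proof -
  interpret product_sigma_finite "\<lambda>b::real^'n. lborel :: real measure"
    by standard
  define e where "e i = (axis i 1 :: real^'n)" for i
  have e: "inj e" "(Basis :: (real^'n) set) = range e"
    by (auto simp: e_def Basis_vec_def inj_def axis_eq_axis)
  have [measurable]: "f i \<in> borel_measurable borel" for i
    using borel_measurable_integrable[OF assms[of i]] by simp
  have [measurable]: "(\<lambda>x. x $ i) \<in> borel_measurable (borel :: (real^'n) measure)" for i
    by (intro borel_measurable_continuous_onI continuous_intros)
  have "(LINT x|lborel. (\<Prod>i\<in>UNIV. f i (x $ i))) =
      (LINT g|(\<Pi>\<^sub>M b\<in>(Basis :: (real^'n) set). lborel). (\<Prod>i\<in>UNIV. f i ((\<Sum>b\<in>Basis. g b *\<^sub>R b) $ i)))"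
    by (subst lborel_eq, rule integral_distr) measurable
  also have "\<dots> = (LINT g|(\<Pi>\<^sub>M b\<in>(Basis :: (real^'n) set). lborel). (\<Prod>b\<in>Basis. f (inv e b) (g b)))"
  proof (rule Bochner_Integration.integral_cong[OF refl])
    fix g :: "real^'n \<Rightarrow> real"
    have comp: "(\<Sum>b\<in>Basis. g b *\<^sub>R b) $ i = g (e i)" for i
    proof -
      have "(\<Sum>b\<in>Basis. g b *\<^sub>R b) \<bullet> e i = g (e i)"
        by (rule inner_sum_left_Basis) (simp add: e)
      then show ?thesis by (simp add: e_def inner_axis)
    qed
    show "(\<Prod>i\<in>UNIV. f i ((\<Sum>b\<in>Basis. g b *\<^sub>R b) $ i)) = (\<Prod>b\<in>Basis. f (inv e b) (g b))"
      unfolding comp unfolding e(2) by (subst prod.reindex[OF e(1)]) (simp add: inv_f_f[OF e(1)])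
  qed
  also have "\<dots> = (\<Prod>b\<in>(Basis :: (real^'n) set). integral\<^sup>L lborel (f (inv e b)))"
    by (rule product_integral_prod) (auto intro: assms)
  also have "\<dots> = (\<Prod>i\<in>UNIV. integral\<^sup>L lborel (f i))"
    unfolding e(2) by (subst prod.reindex[OF e(1)]) (simp add: inv_f_f[OF e(1)])
  finally show ?thesis .
qed

lemma integral_exp_unit_interval:
  "integrable lborel (\<lambda>t. indicator {0..<1} t *\<^sub>R exp (2 * of_real pi * \<i> * of_real (of_int m * t)))"
  "(LINT t|lborel. indicator {0..<1} t *\<^sub>R exp (2 * of_real pi * \<i> * of_real (of_int m * t))) = (if m = 0 then 1 else 0)"
proof -
  let ?g = "\<lambda>t. exp (2 * of_real pi * \<i> * of_real (of_int m * t))"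
  have cong: "AE t in lborel. indicator {0..<1} t *\<^sub>R ?g t = indicator {0..1} t *\<^sub>R ?g t"
  proof -
    have "AE t in lborel. t \<noteq> (1::real)" by (rule AE_lborel_singleton)
    then show ?thesis by eventually_elim (auto simp: indicator_def)
  qed
  have meas: "(\<lambda>t. indicator {0..<1} t *\<^sub>R ?g t) \<in> borel_measurable borel"
    "(\<lambda>t. indicator {0..1} t *\<^sub>R ?g t) \<in> borel_measurable borel"
    by measurable
  have int: "integrable lborel (\<lambda>t. indicator {0..1} t *\<^sub>R ?g t)"
  proof -
    have "continuous_on {0..1} ?g" by (intro continuous_intros)
    then have "set_integrable lborel {0..1} ?g" by (rule borel_integrable_atLeastAtMost')
    then show ?thesis by (simp add: set_integrable_def)
  qed
  then show "integrable lborel (\<lambda>t. indicator {0..<1} t *\<^sub>R ?g t)"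
    using integrable_cong_AE[of _ lborel, OF _ _ cong] meas by simp
  have "(LINT t|lborel. indicator {0..<1} t *\<^sub>R ?g t) = (LINT t|lborel. indicator {0..1} t *\<^sub>R ?g t)"
    by (rule integral_cong_AE) (use meas cong in auto)
  also have "\<dots> = (if m = 0 then 1 else 0)"
  proof (cases "m = 0")
    case True
    then show ?thesis by simp
  next
    case False
    define w where "w = 2 * of_real pi * \<i> * of_int m"
    have w: "w \<noteq> 0" using False by (simp add: w_def)
    have g: "?g t = exp (of_real t * w)" for t by (simp add: w_def mult_ac)
    have "((\<lambda>t. exp (of_real t * w) / w) has_vector_derivative ?g t) (at t within {0..1})" for t
      unfolding g by (rule has_vector_derivative_real_field) (auto intro!: derivative_eq_intros simp: w)
    then have "integral\<^sup>L lborel (\<lambda>t. indicator {0..1} t *\<^sub>R ?g t) = exp (of_real 1 * w) / w - exp (of_real 0 * w) / w"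
      by (intro integral_FTC_Icc) (auto intro!: continuous_intros)
    also have "exp w = 1"
      unfolding exp_eq_1 by (simp add: w_def)
    then have "exp (of_real 1 * w) / w - exp (of_real 0 * w) / w = 0" by simp
    finally show ?thesis using False by simp
  qed
  finally show "(LINT t|lborel. indicator {0..<1} t *\<^sub>R ?g t) = (if m = 0 then 1 else 0)" .
qed

lemma integral_torus_char:
  fixes k :: "int^'n::finite"
  shows "(LINT x|torus_lebesgue. torus_char k x) = (if k = 0 then 1 else 0)"
proof -
  let ?g = "\<lambda>m t. indicator {0..<1} t *\<^sub>R exp (2 * of_real pi * \<i> * of_real (of_int m * t))"
  have cube: "(torus_cube :: (real^'n) set) \<in> sets lborel"
    unfolding torus_cube_def by measurable
  have meas: "torus_char k \<in> borel_measurable borel"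
    by (rule borel_measurable_continuous_onI[OF continuous_on_torus_char])
  have "(LINT x|torus_lebesgue. torus_char k x) =
      (LINT x|restrict_space lborel torus_cube. torus_char k (torus_proj x))"
    unfolding torus_lebesgue_def
    by (rule integral_distr[OF measurable_restrict_space1 meas]) (use torus_proj_measurable in simp)
  also have "\<dots> = (LINT x|lborel. indicator torus_cube x *\<^sub>R torus_char k (torus_proj x))"
    by (rule integral_restrict_space) (use cube in simp)
  also have "\<dots> = (LINT x|lborel. (\<Prod>i\<in>UNIV. ?g (k $ i) (x $ i)))"
  proof (rule Bochner_Integration.integral_cong[OF refl])
    fix x :: "real^'n"
    have "exp (2 * of_real pi * \<i> * of_real (vec_of_int k \<bullet> x)) =
        (\<Prod>i\<in>UNIV. exp (2 * of_real pi * \<i> * of_real (of_int (k $ i) * x $ i)))"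
      by (simp add: vec_of_int_def inner_vec_def exp_sum[symmetric] sum_distrib_left)
    moreover have "indicator torus_cube x = (\<Prod>i\<in>UNIV. indicator {0..<1} (x $ i) :: real)"
    proof (cases "x \<in> torus_cube")
      case True
      then show ?thesis by (auto simp: torus_cube_def)
    next
      case False
      then obtain i where "x $ i \<notin> {0..<1}" by (auto simp: torus_cube_def)
      then have "(\<Prod>i\<in>UNIV. indicator {0..<1} (x $ i) :: real) = 0"
        by (intro prod_zero) (auto intro!: exI[of _ i])
      then show ?thesis using False by simp
    qed
    ultimately show "indicator torus_cube x *\<^sub>R torus_char k (torus_proj x) = (\<Prod>i\<in>UNIV. ?g (k $ i) (x $ i))"
      by (simp add: torus_char_proj scaleR_conv_of_real prod.distrib)
  qed
  also have "\<dots> = (\<Prod>i\<in>UNIV. integral\<^sup>L lborel (?g (k $ i)))"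
    by (rule integral_lborel_prod_cart) (rule integral_exp_unit_interval)
  also have "\<dots> = (\<Prod>i\<in>UNIV. if k $ i = 0 then 1 else 0)"
    by (simp only: integral_exp_unit_interval)
  also have "\<dots> = (if k = 0 then 1 else 0)"
    by (auto simp: vec_eq_iff)
  finally show ?thesis .
qed

section \<open>Measures on the torus are determined by their Fourier coefficients\<close>

lemma compact_torus: "compact (UNIV :: 'n::finite torus set)"
proof -
  have "x \<in> torus_proj ` cbox 0 1" for x :: "'n torus"
  proof (rule torus_proj_cases[of x])
    fix y assume x: "x = torus_proj y"
    have "torus_proj y = torus_proj (\<chi> i. frac (y $ i))"
      unfolding torus.abs_eq_iff by (simp add: frac_def)
    moreover have "(\<chi> i. frac (y $ i)) \<in> cbox 0 1"
      by (auto simp: mem_box_cart frac_lt_1 less_imp_le)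
    ultimately show ?thesis unfolding x by blast
  qed
  then have "(UNIV :: 'n torus set) = torus_proj ` cbox 0 1" by auto
  moreover have "compact (torus_proj ` cbox 0 1 :: 'n torus set)"
    by (rule compact_continuous_image[OF continuous_on_torus_proj compact_cbox])
  ultimately show ?thesis by simp
qed

text \<open>
  The torus as a product of unit circles in a Euclidean space, where the Weierstrass
  approximation theorem and distance functions are available.
\<close>

definition torus_embed :: "'n::finite torus \<Rightarrow> complex^'n"
  where "torus_embed x = (\<chi> i. torus_char (axis i 1) x)"

lemma continuous_on_torus_embed: "continuous_on UNIV torus_embed"
  unfolding torus_embed_def by (intro continuous_on_vec_lambda continuous_on_torus_char)

lemma inj_torus_embed: "inj torus_embed"
proof (rule injI)
  fix x y :: "'n::finite torus"
  assume eq: "torus_embed x = torus_embed y"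
  obtain a b where ab: "x = torus_proj a" "y = torus_proj b"
    using torus_proj_cases by metis
  have "a $ i - b $ i \<in> \<int>" for i
  proof -
    have [simp]: "vec_of_int (axis i 1) = axis i 1"
      by (auto simp: vec_of_int_def axis_def vec_eq_iff)
    have "torus_char (axis i 1) x = torus_char (axis i 1) y"
      using eq by (simp add: torus_embed_def vec_eq_iff)
    then obtain n :: int where "2 * of_real pi * \<i> * of_real (a $ i) = 2 * of_real pi * \<i> * of_real (b $ i) + of_int (2 * n) * of_real pi * \<i>"
      unfolding ab torus_char_proj exp_eq by (auto simp: inner_axis' )
    then have "Im (2 * of_real pi * \<i> * of_real (a $ i)) = Im (2 * of_real pi * \<i> * of_real (b $ i) + of_int (2 * n) * of_real pi * \<i>)"
      by simp
    then have "pi * (a $ i - b $ i) = pi * of_int n"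
      by (simp add: algebra_simps)
    then show ?thesis by simp
  qed
  then show "x = y" unfolding ab torus.abs_eq_iff by simp
qed

inductive trig_span :: "('n::finite torus \<Rightarrow> complex) \<Rightarrow> bool" where
  char: "trig_span (torus_char k)"
| add: "trig_span f \<Longrightarrow> trig_span g \<Longrightarrow> trig_span (\<lambda>x. f x + g x)"
| scale: "trig_span f \<Longrightarrow> trig_span (\<lambda>x. c * f x)"

lemma trig_span_const: "trig_span (\<lambda>x. c)"
  using trig_span.scale[OF trig_span.char[of 0], of c] by simp

lemma trig_span_sum: "finite S \<Longrightarrow> (\<And>i. i \<in> S \<Longrightarrow> trig_span (f i)) \<Longrightarrow> trig_span (\<lambda>x. \<Sum>i\<in>S. f i x)"
  by (induction S rule: finite_induct) (auto intro: trig_span_const trig_span.add)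

lemma trig_span_mult:
  assumes "trig_span f" "trig_span g"
  shows "trig_span (\<lambda>x. f x * g x)"
  using assms
proof (induction arbitrary: g)
  case (char k)
  then show ?case
  proof induction
    case (char l)
    then show ?case using trig_span.char[of "k + l"] by (simp add: torus_char_add[abs_def])
  next
    case (add f g)
    then show ?case by (simp add: distrib_left trig_span.add)
  next
    case (scale f c)
    then show ?case using trig_span.scale[of "\<lambda>x. torus_char k x * f x" c] by (simp add: mult_ac)
  qed
next
  case (add f h)
  then show ?case by (simp add: distrib_right trig_span.add)
next
  case (scale f c)
  then have "trig_span (\<lambda>x. c * (f x * g x))" by (intro trig_span.scale) auto
  then show ?case by (simp add: mult.assoc)
qed

text \<open>
  On the product of circles, the coordinates \<open>Re z\<close> and \<open>Im z\<close> are combinations of characters,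
  and products of characters are characters.
\<close>

lemma trig_span_polynomial:
  fixes p :: "complex^('n::finite) \<Rightarrow> real"
  assumes "real_polynomial_function p"
  shows "trig_span (\<lambda>x. complex_of_real (p (torus_embed x)))"
  using assms
proof induction
  case (linear p)
  have coord: "trig_span (\<lambda>x. complex_of_real (torus_embed x \<bullet> b))" if bB: "b \<in> Basis" for b :: "complex^'n"
  proof -
    obtain i and u :: complex where b: "b = axis i u" "u = 1 \<or> u = \<i>"
      using bB unfolding Basis_vec_def Basis_complex_def by blast
    let ?e = "torus_char (axis i 1)"
    have "trig_span (\<lambda>x. (1/2) * ?e x + (1/2) * torus_char (- axis i 1) x)"
      by (intro trig_span.intros)
    moreover have "(1/2) * ?e x + (1/2) * torus_char (- axis i 1) x = complex_of_real (Re (?e x))" for x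
      by (simp add: torus_char_minus complex_eq_iff)
    ultimately have "trig_span (\<lambda>x. complex_of_real (Re (?e x)))" by simp
    moreover have "trig_span (\<lambda>x. (- \<i>/2) * ?e x + (\<i>/2) * torus_char (- axis i 1) x)"
      by (intro trig_span.intros)
    moreover have "(- \<i>/2) * ?e x + (\<i>/2) * torus_char (- axis i 1) x = complex_of_real (Im (?e x))" for x
      by (simp add: torus_char_minus complex_eq_iff)
    ultimately show ?thesis
      using b by (auto simp: inner_axis torus_embed_def inner_complex_def)
  qed
  have "p (torus_embed x) = (\<Sum>b\<in>Basis. (torus_embed x \<bullet> b) * p b)" for x
  proof -
    have lin: "linear p" using linear by (rule bounded_linear.linear)
    have "p (torus_embed x) = p (\<Sum>b\<in>Basis. (torus_embed x \<bullet> b) *\<^sub>R b)"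
      by (simp only: euclidean_representation)
    then show ?thesis by (simp add: linear_sum[OF lin] linear_cmul[OF lin])
  qed
  moreover have "trig_span (\<lambda>x. \<Sum>b\<in>Basis. complex_of_real (p b) * complex_of_real (torus_embed x \<bullet> b))"
    by (intro trig_span_sum trig_span.scale coord) auto
  ultimately show ?case by (simp add: mult_ac)
next
  case (const c)
  then show ?case by (rule trig_span_const)
next
  case (add f g)
  then show ?case by (simp add: trig_span.add)
next
  case (mult f g)
  then show ?case by (simp add: trig_span_mult)
qed

text \<open>
  Equal integrals of characters give equal integrals of polynomials in the embedding, hence of
  continuous functions by Weierstrass approximation on the compact image, hence equal
  measures of closed sets, whose indicators are limits of continuous functions of the distance.
\<close>

theorem torus_measure_eqI:
  fixes M N :: "'n::finite torus measure"
  assumes M: "prob_space M" "sets M = sets borel" and N: "prob_space N" "sets N = sets borel"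
    and eq: "\<And>k. (LINT x|M. torus_char k x) = (LINT x|N. torus_char k x)"
  shows "M = N"
proof -
  interpret M: prob_space M by (rule M)
  interpret N: prob_space N by (rule N)
  have fin: "finite_measure M" "finite_measure N" by unfold_locales
  have trig: "integrable M f \<and> integrable N f \<and> integral\<^sup>L M f = integral\<^sup>L N f"
    if "trig_span f" for f
    using that
  proof induction
    case (char k)
    then show ?case using eq
      by (auto intro!: integrable_continuous_torus[of _ _ 1] continuous_on_torus_char fin M N)
  qed auto
  have cont: "integral\<^sup>L M (\<lambda>x. f (torus_embed x)) = integral\<^sup>L N (\<lambda>x. f (torus_embed x))"
    if f: "continuous_on UNIV f" "\<And>z. \<bar>f z\<bar> \<le> 1" for f :: "complex^'n \<Rightarrow> real"
  proof (rule ccontr)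
    assume ne: "\<not> ?thesis"
    have fe: "continuous_on UNIV (\<lambda>x. f (torus_embed x))"
      using continuous_on_compose2[OF f(1) continuous_on_torus_embed] by auto
    have intf: "integrable M (\<lambda>x. f (torus_embed x))" "integrable N (\<lambda>x. f (torus_embed x))"
      by (auto intro!: integrable_continuous_torus[of _ _ 1] fin M N fe f(2))
    define d where "d = \<bar>integral\<^sup>L M (\<lambda>x. f (torus_embed x)) - integral\<^sup>L N (\<lambda>x. f (torus_embed x))\<bar>"
    have "compact (range (torus_embed :: 'n torus \<Rightarrow> _))"
      by (rule compact_continuous_image[OF continuous_on_torus_embed compact_torus])
    moreover have "d / 3 > 0" using ne by (simp add: d_def)
    ultimately obtain p where p: "real_polynomial_function p"
      "\<And>z. z \<in> range (torus_embed :: 'n torus \<Rightarrow> _) \<Longrightarrow> \<bar>f z - p z\<bar> < d / 3"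
      using Stone_Weierstrass_real_polynomial_function[of "range (torus_embed :: 'n torus \<Rightarrow> _)" f "d / 3"]
        continuous_on_subset[OF f(1)] by blast
    from trig[OF trig_span_polynomial[OF p(1)]]
    have intp: "integrable M (\<lambda>x. p (torus_embed x))" "integrable N (\<lambda>x. p (torus_embed x))"
      "integral\<^sup>L M (\<lambda>x. p (torus_embed x)) = integral\<^sup>L N (\<lambda>x. p (torus_embed x))"
      by (auto simp: complex_of_real_integrable_eq)
    have close: "\<bar>integral\<^sup>L Q (\<lambda>x. f (torus_embed x)) - integral\<^sup>L Q (\<lambda>x. p (torus_embed x))\<bar> \<le> d / 3"
      if Q: "prob_space Q" "integrable Q (\<lambda>x. f (torus_embed x))" "integrable Q (\<lambda>x. p (torus_embed x))" for Q
    proof -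
      interpret Q: prob_space Q by (rule Q)
      have "\<bar>integral\<^sup>L Q (\<lambda>x. f (torus_embed x) - p (torus_embed x))\<bar> \<le> integral\<^sup>L Q (\<lambda>x. \<bar>f (torus_embed x) - p (torus_embed x)\<bar>)"
        by (rule integral_abs_bound)
      also have "\<dots> \<le> integral\<^sup>L Q (\<lambda>x. d / 3)"
        using p(2) Q by (intro integral_mono) (auto intro: less_imp_le)
      also have "\<dots> = d / 3" by (simp add: Q.prob_space)
      finally show ?thesis using Q by simp
    qed
    have "d \<le> d / 3 + d / 3"
      unfolding d_def using close[OF M(1) intf(1) intp(1)] close[OF N(1) intf(2) intp(2)] intp(3)
      unfolding d_def by linarith
    then show False using \<open>d / 3 > 0\<close> by simp
  qed
  have closed_eq: "measure M C = measure N C" if C: "closed C" for C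
  proof (cases "C = {}")
    case False
    \<comment> \<open>Continuous functions decreasing to the indicator of the image of \<open>C\<close>.\<close>
    define f where "f n z = max 0 (1 - real n * infdist z (torus_embed ` C))" for n z
    have "compact C" using compact_Int_closed[OF compact_torus C] by simp
    then have cl: "closed (torus_embed ` C)"
      by (intro compact_imp_closed compact_continuous_image continuous_on_subset[OF continuous_on_torus_embed]) auto
    have fc: "continuous_on UNIV (f n)" for n
      unfolding f_def by (intro continuous_intros)
    have fb: "\<bar>f n z\<bar> \<le> 1" for n z
      using infdist_nonneg[of z "torus_embed ` C"] by (auto simp: f_def)
    have lim: "(\<lambda>n. f n (torus_embed x)) \<longlonglongrightarrow> indicator C x" for x
    proof (cases "x \<in> C")
      case True
      then show ?thesis by (simp add: f_def)
    next
      case False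
      then have "torus_embed x \<notin> torus_embed ` C"
        using inj_torus_embed by (auto dest: injD)
      then have pos: "infdist (torus_embed x) (torus_embed ` C) > 0"
        using infdist_pos_not_in_closed[OF cl] \<open>C \<noteq> {}\<close> by auto
      then obtain n0 :: nat where n0: "1 < real n0 * infdist (torus_embed x) (torus_embed ` C)"
        using reals_Archimedean3 by blast
      then have "f n (torus_embed x) = 0" if "n \<ge> n0" for n
      proof -
        have "real n0 * infdist (torus_embed x) (torus_embed ` C) \<le> real n * infdist (torus_embed x) (torus_embed ` C)"
          using that pos by (intro mult_right_mono) auto
        then have "1 - real n * infdist (torus_embed x) (torus_embed ` C) \<le> 0"
          using n0 by linarith
        then show ?thesis by (simp add: f_def)
      qed
      then have "eventually (\<lambda>n. f n (torus_embed x) = 0) sequentially"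
        unfolding eventually_sequentially by blast
      then show ?thesis using False by (simp add: tendsto_eventually)
    qed
    have conv: "(\<lambda>n. integral\<^sup>L Q (\<lambda>x. f n (torus_embed x))) \<longlonglongrightarrow> measure Q C"
      if Q: "prob_space Q" "sets Q = sets borel" for Q
    proof -
      interpret Q: prob_space Q by (rule Q)
      have CQ: "C \<in> sets Q" using C Q by simp
      have "(\<lambda>n. integral\<^sup>L Q (\<lambda>x. f n (torus_embed x))) \<longlonglongrightarrow> integral\<^sup>L Q (indicator C)"
      proof (rule integral_dominated_convergence[where w="\<lambda>_. 1"])
        show "(\<lambda>x. f n (torus_embed x)) \<in> borel_measurable Q" for n
          using borel_measurable_continuous_onI[OF continuous_on_compose2[OF fc continuous_on_torus_embed]]
            measurable_cong_sets[OF Q(2) refl] by blast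
      qed (use CQ lim fb in auto)
      then show ?thesis using CQ by simp
    qed
    show ?thesis
      using LIMSEQ_unique[OF conv[OF M] ] conv[OF N] cont[OF fc fb] by simp
  qed simp
  have borel: "sets (borel :: 'n torus measure) = sigma_sets UNIV (Collect closed)"
    by (subst borel_eq_closed) simp
  show ?thesis
  proof (rule measure_eqI_generator_eq[where E="Collect closed" and \<Omega>=UNIV and A="\<lambda>_. UNIV"])
    show "Int_stable (Collect closed :: 'n torus set set)"
      by (auto simp: Int_stable_def)
    show "emeasure M C = emeasure N C" if "C \<in> Collect closed" for C
      using closed_eq[of C] that by (simp add: M.emeasure_eq_measure N.emeasure_eq_measure)
  qed (use M N borel in auto)
qed

section \<open>Trigonometric polynomials as lists of terms\<close>

text \<open>
  A list of pairs (coefficient, frequency). Frequencies may repeat: addition is then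
  concatenation and no collection of terms is needed.
\<close>

type_synonym 'n trig = "(rat \<times> (int^'n)) list"

definition peval :: "('n::finite) trig \<Rightarrow> 'n torus \<Rightarrow> complex"
  where "peval P x = (\<Sum>t\<leftarrow>P. of_rat (fst t) * torus_char (snd t) x)"

definition pscale :: "rat \<Rightarrow> ('n::finite) trig \<Rightarrow> 'n trig"
  where "pscale r P = map (\<lambda>t. (r * fst t, snd t)) P"

definition pmult :: "('n::finite) trig \<Rightarrow> 'n trig \<Rightarrow> 'n trig"
  where "pmult P Q = concat (map (\<lambda>s. map (\<lambda>t. (fst s * fst t, snd s + snd t)) Q) P)"

definition pshift :: "int^'n^'n \<Rightarrow> ('n::finite) trig \<Rightarrow> 'n trig"
  where "pshift A P = map (\<lambda>t. (fst t, A *v snd t)) P"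

definition pavg :: "int^'n^'n \<Rightarrow> nat \<Rightarrow> ('n::finite) trig \<Rightarrow> 'n trig"
  where "pavg A N P = pscale (inverse (of_nat N)) (concat (map (\<lambda>n. (pshift A ^^ n) P) [0..<N]))"

text \<open>
  Dropping the terms of frequency zero subtracts the Lebesgue mean.
\<close>

definition nonconst :: "('n::finite) trig \<Rightarrow> 'n trig"
  where "nonconst P = filter (\<lambda>t. snd t \<noteq> 0) P"

definition coeff :: "('n::finite) trig \<Rightarrow> int^'n \<Rightarrow> rat"
  where "coeff P k = (\<Sum>t\<leftarrow>filter (\<lambda>t. snd t = k) P. fst t)"

definition l1 :: "('n::finite) trig \<Rightarrow> rat"
  where "l1 P = (\<Sum>t\<leftarrow>P. \<bar>fst t\<bar>)"

definition preal :: "('n::finite) trig \<Rightarrow> bool"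
  where "preal P \<longleftrightarrow> (\<forall>x. peval P x \<in> \<real>)"

definition rval :: "('n::finite) trig \<Rightarrow> 'n torus \<Rightarrow> real"
  where "rval P x = Re (peval P x)"

lemma of_rat_complex: "(of_rat a :: complex) = of_real (of_rat a)"
  by (cases a) (simp add: of_rat_rat)

lemma norm_of_rat_complex: "norm (of_rat a :: complex) = of_rat \<bar>a\<bar>"
  by (simp add: of_rat_complex abs_if of_rat_minus)

lemma peval_Nil [simp]: "peval [] x = 0"
  and peval_Cons [simp]: "peval (t # P) x = of_rat (fst t) * torus_char (snd t) x + peval P x"
  and peval_append [simp]: "peval (P @ Q) x = peval P x + peval Q x"
  by (simp_all add: peval_def)

lemma peval_pscale [simp]: "peval (pscale r P) x = of_rat r * peval P x"
  by (induction P) (simp_all add: pscale_def of_rat_mult algebra_simps)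

lemma peval_pmult [simp]: "peval (pmult P Q) x = peval P x * peval Q x"
proof (induction P)
  case (Cons s P)
  have "peval (map (\<lambda>t. (fst s * fst t, snd s + snd t)) Q) x = of_rat (fst s) * torus_char (snd s) x * peval Q x"
    by (induction Q) (simp_all add: of_rat_mult torus_char_add algebra_simps)
  then show ?case using Cons by (simp add: pmult_def algebra_simps)
qed (simp add: pmult_def)

lemma peval_concat: "peval (concat Ps) x = (\<Sum>P\<leftarrow>Ps. peval P x)"
  by (induction Ps) auto

lemma peval_nonconst: "peval (nonconst P) x = peval P x - of_rat (coeff P 0)"
  by (induction P) (auto simp: nonconst_def coeff_def of_rat_add)

lemma l1_simps [simp]: "l1 [] = 0" "l1 (t # P) = \<bar>fst t\<bar> + l1 P" "l1 (P @ Q) = l1 P + l1 Q"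
  by (simp_all add: l1_def)

lemma l1_nonneg: "0 \<le> l1 P"
  by (induction P) auto

lemma l1_filter: "l1 (filter p P) \<le> l1 P"
  by (induction P) (auto intro: add_increasing)

lemma norm_peval_le: "norm (peval P x) \<le> of_rat (l1 P)"
proof (induction P)
  case (Cons t P)
  have "norm (peval (t # P) x) \<le> norm (of_rat (fst t) * torus_char (snd t) x) + norm (peval P x)"
    by (simp add: norm_triangle_ineq)
  also have "\<dots> \<le> of_rat \<bar>fst t\<bar> + of_rat (l1 P)"
    using Cons by (simp add: norm_mult norm_of_rat_complex)
  finally show ?case by (simp add: of_rat_add)
qed simp

lemma abs_rval_le: "\<bar>rval P x\<bar> \<le> of_rat (l1 P)"
  unfolding rval_def using abs_Re_le_cmod norm_peval_le by (rule order_trans)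

lemma continuous_on_peval: "continuous_on UNIV (peval P)"
proof (induction P)
  case (Cons t P)
  then show ?case
    unfolding peval_Cons[abs_def] by (intro continuous_intros continuous_on_torus_char)
qed simp

lemma continuous_on_rval: "continuous_on UNIV (rval P)"
  unfolding rval_def[abs_def] by (intro continuous_intros continuous_on_peval)

lemma rval_simps [simp]:
  "rval [] x = 0" "rval (P @ Q) x = rval P x + rval Q x"
  "rval (pscale r P) x = of_rat r * rval P x"
  by (simp_all add: rval_def of_rat_complex)

lemma peval_eq_rval: "preal P \<Longrightarrow> peval P x = complex_of_real (rval P x)"
  by (simp add: preal_def rval_def)

lemma preal_simps [simp]:
  "preal []" "preal P \<Longrightarrow> preal Q \<Longrightarrow> preal (P @ Q)" "preal P \<Longrightarrow> preal (pscale r P)"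
  "preal P \<Longrightarrow> preal Q \<Longrightarrow> preal (pmult P Q)" "preal P \<Longrightarrow> preal (nonconst P)"
  by (auto simp: preal_def peval_nonconst of_rat_complex)

lemma rval_pmult: "preal P \<Longrightarrow> preal Q \<Longrightarrow> rval (pmult P Q) x = rval P x * rval Q x"
  by (simp add: rval_def) (simp add: preal_def complex_is_Real_iff)

lemma rval_nonconst: "rval (nonconst P) x = rval P x - of_rat (coeff P 0)"
  by (simp add: rval_def peval_nonconst of_rat_complex)

lemma integral_peval_torus_char:
  "(LINT x|torus_lebesgue. peval P x * torus_char (- k) x) = of_rat (coeff P k)"
proof (induction P)
  case Nil
  then show ?case by (simp add: coeff_def)
next
  case (Cons t P)
  interpret prob_space torus_lebesgue by (rule prob_space_torus_lebesgue)
  have fin: "finite_measure torus_lebesgue" by unfold_locales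
  have int: "integrable torus_lebesgue (torus_char l)" for l :: "int^'a"
    by (rule integrable_continuous_torus[of _ _ 1]) (simp_all add: fin sets_torus_lebesgue continuous_on_torus_char)
  have intP: "integrable torus_lebesgue (\<lambda>x. peval P x * torus_char (- k) x)"
    by (rule integrable_continuous_torus[of _ _ "of_rat (l1 P)"])
       (auto intro!: fin sets_torus_lebesgue continuous_intros continuous_on_torus_char continuous_on_peval
         norm_peval_le simp: norm_mult)
  have "(LINT x|torus_lebesgue. peval (t # P) x * torus_char (- k) x) =
      (LINT x|torus_lebesgue. of_rat (fst t) * torus_char (snd t - k) x + peval P x * torus_char (- k) x)"
    by (simp add: algebra_simps torus_char_add[of "snd t" "- k", simplified])
  also have "\<dots> = of_rat (fst t) * (if snd t = k then 1 else 0) + of_rat (coeff P k)"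
    using int intP by (simp add: Cons integral_torus_char)
  also have "\<dots> = of_rat (coeff (t # P) k)"
    by (simp add: coeff_def of_rat_add)
  finally show ?case .
qed

lemma integral_rval_lebesgue: "(LINT x|torus_lebesgue. rval P x) = of_rat (coeff P 0)"
proof -
  interpret prob_space torus_lebesgue by (rule prob_space_torus_lebesgue)
  have fin: "finite_measure torus_lebesgue" by unfold_locales
  have "integrable torus_lebesgue (peval P)"
    by (rule integrable_continuous_torus[of _ _ "of_rat (l1 P)"])
       (auto intro!: fin sets_torus_lebesgue continuous_on_peval norm_peval_le)
  then have "(LINT x|torus_lebesgue. rval P x) = Re (LINT x|torus_lebesgue. peval P x)"
    unfolding rval_def by (rule integral_Re)
  also have "\<dots> = of_rat (coeff P 0)"
    using integral_peval_torus_char[of P 0] by (simp add: of_rat_complex)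
  finally show ?thesis .
qed

lemma integrable_rval:
  assumes "prob_space M" "sets M = sets borel"
  shows "integrable M (rval P)"
proof -
  interpret prob_space M by (rule assms)
  show ?thesis
    by (rule integrable_continuous_torus[of _ _ "of_rat (l1 P)"])
       (auto intro!: assms continuous_on_rval abs_rval_le finite_measure_axioms)
qed

section \<open>Polynomial approximation of the negative part\<close>

text \<open>
  The iteration \<open>q + (y\<^sup>2 - q\<^sup>2) / 2\<close> of polynomials in \<open>y\<close> increases to \<open>\<bar>y\<bar>\<close> on \<open>[-1, 1]\<close>. The point of
  this choice is that it only uses ring operations and division by two.
\<close>

definition absq :: "nat \<Rightarrow> real \<Rightarrow> real"
  where "absq n y = ((\<lambda>q. q + (y^2 - q^2) / 2) ^^ n) 0"

text \<open>
  One step multiplies the error \<open>\<bar>y\<bar> - q\<close> by \<open>1 - (\<bar>y\<bar> + q) / 2\<close>, which is at most \<open>1 - \<bar>y\<bar> / 2\<close>.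
\<close>

lemma absq_bounds:
  assumes "\<bar>y\<bar> \<le> 1"
  shows "0 \<le> absq n y \<and> absq n y \<le> \<bar>y\<bar> \<and> \<bar>y\<bar> - absq n y \<le> \<bar>y\<bar> * (1 - \<bar>y\<bar> / 2) ^ n"
proof (induction n)
  case (Suc n)
  define a q where "a = \<bar>y\<bar>" and "q = absq n y"
  have a: "0 \<le> a" "a \<le> 1" "y^2 = a^2" using assms by (auto simp: a_def)
  have IH: "0 \<le> q" "q \<le> a" "a - q \<le> a * (1 - a / 2) ^ n"
    using Suc by (auto simp: a_def q_def)
  have q': "absq (Suc n) y = q + (a^2 - q^2) / 2"
    using a by (simp add: absq_def q_def)
  have e: "a - absq (Suc n) y = (a - q) * (1 - (a + q) / 2)"
    unfolding q' by (simp add: power2_eq_square field_simps)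
  have "0 \<le> (a - q) * (1 - (a + q) / 2)"
    using a IH by (intro mult_nonneg_nonneg) auto
  then have up: "absq (Suc n) y \<le> a" using e by simp
  have "q^2 \<le> a^2" using IH by (intro power_mono) auto
  then have lo: "0 \<le> absq (Suc n) y" unfolding q' using IH by simp
  have "(a - q) * (1 - (a + q) / 2) \<le> (a * (1 - a / 2) ^ n) * (1 - a / 2)"
    using a IH by (intro mult_mono) auto
  then have "a - absq (Suc n) y \<le> a * (1 - a / 2) ^ Suc n"
    using e by (simp add: mult_ac)
  then show ?case using lo up by (simp add: a_def)
qed (simp add: absq_def)

text \<open>
  Bernoulli's inequality bounds \<open>t (1 - t)\<^sup>n\<close> by \<open>1 / n\<close>; apply it to \<open>t = \<bar>y\<bar> / 2\<close>.
\<close>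

lemma absq_error:
  assumes "\<bar>y\<bar> \<le> 1" "n \<ge> 1"
  shows "\<bar>y\<bar> - absq n y \<le> 2 / n"
proof -
  define t where "t = \<bar>y\<bar> / 2"
  have t: "0 \<le> t" "t \<le> 1" using assms by (auto simp: t_def)
  have "(1 - t) ^ n * (1 + real n * t) \<le> (1 - t) ^ n * (1 + t) ^ n"
    using Bernoulli_inequality[of t n] t by (intro mult_left_mono) auto
  also have "\<dots> = (1 - t^2) ^ n"
    by (simp add: power_mult_distrib[symmetric] power2_eq_square algebra_simps)
  also have "\<dots> \<le> 1"
    using t by (intro power_le_one) (auto simp: power_le_one)
  finally have "(1 - t) ^ n * (1 + real n * t) \<le> 1" .
  moreover have "0 \<le> (1 - t) ^ n" using t by simp
  ultimately have "(1 - t) ^ n * (n * t) \<le> 1"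
    by (simp add: algebra_simps)
  then have "2 * t * (1 - t) ^ n \<le> 2 / n"
    using assms(2) by (simp add: field_simps)
  then show ?thesis
    using absq_bounds[OF assms(1), of n] by (simp add: t_def)
qed

definition pabs :: "nat \<Rightarrow> ('n::finite) trig \<Rightarrow> 'n trig"
  where "pabs n X = ((\<lambda>q. q @ pscale (1/2) (pmult X X @ pscale (-1) (pmult q q))) ^^ n) []"

text \<open>
  An approximation of \<open>min X 0 = (X - \<bar>X\<bar>) / 2\<close>.
\<close>

definition pneg :: "nat \<Rightarrow> ('n::finite) trig \<Rightarrow> 'n trig"
  where "pneg n X = pscale (1/2) (X @ pscale (-1) (pabs n X))"

lemma rval_pabs:
  assumes "preal X"
  shows "preal (pabs n X) \<and> rval (pabs n X) x = absq n (rval X x)"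
proof (induction n)
  case (Suc n)
  then show ?case using assms
    by (auto simp: pabs_def absq_def rval_pmult of_rat_divide power2_eq_square of_rat_minus field_simps)
qed (simp add: pabs_def absq_def)

lemma preal_pneg: "preal X \<Longrightarrow> preal (pneg n X)"
  by (simp add: pneg_def rval_pabs[THEN conjunct1])

lemma rval_pneg:
  assumes "preal X" "\<bar>rval X x\<bar> \<le> 1" "n \<ge> 1"
  shows "min (rval X x) 0 \<le> rval (pneg n X) x" "rval (pneg n X) x \<le> min (rval X x) 0 + 1 / n"
proof -
  have "rval (pneg n X) x = (rval X x - absq n (rval X x)) / 2"
    using rval_pabs[OF assms(1)] by (simp add: pneg_def of_rat_divide of_rat_minus)
  then show "min (rval X x) 0 \<le> rval (pneg n X) x" "rval (pneg n X) x \<le> min (rval X x) 0 + 1 / n"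
    using absq_bounds[OF assms(2), of n] absq_error[OF assms(2,3)] by auto
qed

section \<open>Birkhoff averages of characters\<close>

lemma (in prob_space) square_expectation_le:
  fixes f :: "'a \<Rightarrow> real"
  assumes "integrable M f" "integrable M (\<lambda>x. (f x)\<^sup>2)"
  shows "(expectation f)\<^sup>2 \<le> expectation (\<lambda>x. (f x)\<^sup>2)"
  using variance_eq[OF assms] variance_positive[of f] by simp

text \<open>
  The squared modulus of the Birkhoff average of a character, as a trigonometric polynomial.
\<close>

definition penergy :: "int^'n^'n \<Rightarrow> nat \<Rightarrow> int^('n::finite) \<Rightarrow> 'n trig"
  where "penergy A N k = pmult (pavg A N [(1, k)]) (pavg A N [(1, - k)])"

lemma invariant_prob_measuresD:
  assumes "M \<in> invariant_prob_measures T"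
  shows "prob_space M" "sets M = sets borel" "T \<in> measurable M M" "distr M M T = M"
  using assms by (auto simp: invariant_prob_measures_def)

lemma integral_funpow_invariant:
  fixes f :: "'a::topological_space \<Rightarrow> 'b::{banach, second_countable_topology}"
  assumes M: "M \<in> invariant_prob_measures T" and f: "f \<in> borel_measurable M"
  shows "(\<lambda>x. f ((T ^^ n) x)) \<in> borel_measurable M \<and> (LINT x|M. f ((T ^^ n) x)) = (LINT x|M. f x)"
proof (induction n)
  case (Suc n)
  note inv = invariant_prob_measuresD[OF M]
  have "(LINT x|M. f ((T ^^ Suc n) x)) = (LINT x|M. f ((T ^^ n) (T x)))"
    by (simp add: funpow_swap1)
  also have "\<dots> = (LINT x|distr M M T. f ((T ^^ n) x))"
    by (rule integral_distr[symmetric, OF inv(3)]) (use Suc in auto)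
  finally show ?case
    using Suc inv measurable_compose[OF inv(3), of "\<lambda>x. f ((T ^^ n) x)" borel]
    by (simp add: funpow_swap1)
qed (use f in simp)

text \<open>
  What the construction needs to know about the automorphism: how it moves characters, that it
  preserves Lebesgue measure, and that it has no periodic frequency except zero.
\<close>

locale toral_dynamics =
  fixes A :: "int^'n^('n::finite)" and T :: "'n torus \<Rightarrow> 'n torus"
  assumes torus_char_T: "torus_char k (T x) = torus_char (A *v k) x"
    and lebesgue_invariant: "torus_lebesgue \<in> invariant_prob_measures T"
    and free_orbits: "k \<noteq> 0 \<Longrightarrow> inj (\<lambda>n. (((*v) A) ^^ n) k)"
begin

abbreviation invariant :: "'n torus measure set" where "invariant \<equiv> invariant_prob_measures T"

definition orb :: "nat \<Rightarrow> int^'n \<Rightarrow> int^'n"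
  where "orb n k = (((*v) A) ^^ n) k"

lemma orb_simps [simp]: "orb 0 k = k" "orb (Suc n) k = A *v orb n k"
  by (simp_all add: orb_def)

lemma inj_orb: "k \<noteq> 0 \<Longrightarrow> inj (\<lambda>n. orb n k)"
  using free_orbits by (simp add: orb_def)

lemma orb_nonzero:
  assumes "k \<noteq> 0"
  shows "orb n k \<noteq> 0"
proof
  assume "orb n k = 0"
  then have "orb (Suc n) k = orb n k" by simp
  then show False using injD[OF inj_orb[OF assms], of "Suc n" n] by simp
qed

lemma torus_char_orb: "torus_char (orb n k) x = torus_char k ((T ^^ n) x)"
proof (induction n arbitrary: x)
  case (Suc n)
  then show ?case by (simp add: torus_char_T[symmetric] funpow_swap1)
qed simp

lemma orb_minus: "orb n (- k) = - orb n k"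
proof (induction n)
  case (Suc n)
  have "A *v (- v) = - (A *v v)" for v
    by (simp add: matrix_vector_mult_def vec_eq_iff sum_negf)
  then show ?case using Suc by simp
qed simp

lemma funpow_pshift: "(pshift A ^^ n) P = map (\<lambda>t. (fst t, orb n (snd t))) P"
  by (induction n) (simp_all add: pshift_def comp_def)

lemma peval_funpow_pshift: "peval ((pshift A ^^ n) P) x = peval P ((T ^^ n) x)"
  unfolding funpow_pshift by (induction P) (simp_all add: torus_char_orb)

lemma rval_funpow_pshift: "rval ((pshift A ^^ n) P) x = rval P ((T ^^ n) x)"
  by (simp add: rval_def peval_funpow_pshift)

lemma peval_pavg: "peval (pavg A N P) x = (\<Sum>n<N. peval P ((T ^^ n) x)) / of_nat N"
  by (simp add: pavg_def peval_concat comp_def peval_funpow_pshift interv_sum_list_conv_sum_set_nat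
      of_rat_inverse divide_inverse mult.commute atLeast0LessThan)

lemma rval_pavg: "rval (pavg A N P) x = (\<Sum>n<N. rval P ((T ^^ n) x)) / real N"
  unfolding rval_def peval_pavg by (simp add: Re_divide_of_nat)

lemma preal_pavg: "preal P \<Longrightarrow> preal (pavg A N P)"
  by (auto simp: preal_def peval_pavg intro!: Reals_divide sum_in_Reals)

lemma integral_pavg:
  assumes M: "M \<in> invariant" and N: "N \<ge> 1"
  shows "(LINT x|M. rval (pavg A N P) x) = (LINT x|M. rval P x)"
    and "(LINT x|M. peval (pavg A N P) x) = (LINT x|M. peval P x)"
proof -
  note inv = invariant_prob_measuresD[OF M]
  interpret prob_space M by (rule inv)
  have int: "integrable M (\<lambda>x. f ((T ^^ n) x)) \<and> (LINT x|M. f ((T ^^ n) x)) = (LINT x|M. f x)"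
    if f: "continuous_on UNIV f" "\<And>x. norm (f x) \<le> C" for f :: "'n torus \<Rightarrow> 'b::{banach, second_countable_topology}" and C n
  proof -
    have "integrable M f"
      by (rule integrable_continuous_torus[OF finite_measure_axioms inv(2) f])
    then have *: "(\<lambda>x. f ((T ^^ n) x)) \<in> borel_measurable M \<and> (LINT x|M. f ((T ^^ n) x)) = (LINT x|M. f x)"
      by (intro integral_funpow_invariant[OF M]) auto
    then have "integrable M (\<lambda>x. f ((T ^^ n) x))"
      by (intro integrable_const_bound[of _ C]) (auto intro: f(2))
    with * show ?thesis by blast
  qed
  have r: "integrable M (\<lambda>x. rval P ((T ^^ n) x)) \<and> (LINT x|M. rval P ((T ^^ n) x)) = (LINT x|M. rval P x)" for n
    by (rule int[OF continuous_on_rval, of _ "of_rat (l1 P)"]) (simp add: abs_rval_le)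
  have c: "integrable M (\<lambda>x. peval P ((T ^^ n) x)) \<and> (LINT x|M. peval P ((T ^^ n) x)) = (LINT x|M. peval P x)" for n
    by (rule int[OF continuous_on_peval norm_peval_le])
  show "(LINT x|M. rval (pavg A N P) x) = (LINT x|M. rval P x)"
    unfolding rval_pavg using r N by simp
  show "(LINT x|M. peval (pavg A N P) x) = (LINT x|M. peval P x)"
    unfolding peval_pavg using c N by simp
qed

definition birk :: "nat \<Rightarrow> int^'n \<Rightarrow> 'n torus \<Rightarrow> complex"
  where "birk N k x = (\<Sum>n<N. torus_char k ((T ^^ n) x)) / of_nat N"

lemma peval_pavg_single: "peval (pavg A N [(1, k)]) x = birk N k x"
  by (simp add: peval_pavg birk_def)

lemma birk_minus: "birk N (- k) x = cnj (birk N k x)"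
  by (simp add: birk_def torus_char_minus)

lemma norm_birk: "norm (birk N k x) \<le> 1"
proof -
  have "norm (\<Sum>n<N. torus_char k ((T ^^ n) x)) \<le> (\<Sum>n<N. 1)"
    by (rule sum_norm_le) simp
  then show ?thesis by (cases "N = 0") (simp_all add: birk_def norm_divide)
qed

lemma continuous_on_birk: "continuous_on UNIV (birk N k)"
  using continuous_on_peval[of "pavg A N [(1, k)]"] by (simp add: peval_pavg_single[abs_def])

lemma peval_penergy: "peval (penergy A N k) x = complex_of_real ((norm (birk N k x))\<^sup>2)"
  by (simp add: penergy_def peval_pavg_single birk_minus complex_norm_square del: of_real_power)

lemma preal_penergy: "preal (penergy A N k)"
  and rval_penergy: "rval (penergy A N k) x = (norm (birk N k x))\<^sup>2"
  by (simp_all add: preal_def rval_def peval_penergy del: of_real_power)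

text \<open>
  Expand the square: the product of the characters of frequencies \<open>A\<^sup>i k\<close> and \<open>- A\<^sup>j k\<close> has mean zero unless
  \<open>i = j\<close>, because the orbit of \<open>k\<close> is infinite.
\<close>

lemma coeff_penergy:
  assumes N: "N \<ge> 1"
  shows "of_rat (coeff (penergy A N k) 0) = (if k = 0 then 1 else 1 / real N)"
proof -
  interpret prob_space torus_lebesgue by (rule prob_space_torus_lebesgue)
  have fin: "finite_measure torus_lebesgue" by unfold_locales
  have int: "integrable torus_lebesgue (torus_char l)" for l :: "int^'n"
    by (rule integrable_continuous_torus[of _ _ 1]) (simp_all add: fin sets_torus_lebesgue continuous_on_torus_char)
  have "complex_of_rat (coeff (penergy A N k) 0) = (LINT x|torus_lebesgue. peval (penergy A N k) x)"
    using integral_peval_torus_char[of "penergy A N k" 0] by simp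
  also have "\<dots> = (LINT x|torus_lebesgue. (\<Sum>i<N. \<Sum>j<N. torus_char (orb i k - orb j k) x) / (of_nat N * of_nat N))"
  proof (rule Bochner_Integration.integral_cong[OF refl])
    fix x
    have "peval (penergy A N k) x = birk N k x * birk N (- k) x"
      by (simp add: penergy_def peval_pavg_single)
    also have "\<dots> = (\<Sum>i<N. \<Sum>j<N. torus_char (orb i k) x * torus_char (orb j (- k)) x) / (of_nat N * of_nat N)"
      by (simp add: birk_def torus_char_orb sum_product)
    finally show "peval (penergy A N k) x = (\<Sum>i<N. \<Sum>j<N. torus_char (orb i k - orb j k) x) / (of_nat N * of_nat N)"
      by (simp add: torus_char_add[symmetric] orb_minus)
  qed
  also have "\<dots> = (\<Sum>i<N. \<Sum>j<N. if orb i k = orb j k then 1 else 0) / (of_nat N * of_nat N)"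
    using int by (simp add: integral_torus_char)
  also have "\<dots> = (if k = 0 then 1 else 1 / of_nat N)"
  proof (cases "k = 0")
    case True
    have "orb i 0 = 0" for i by (induction i) auto
    then show ?thesis using True N by simp
  next
    case False
    have "orb i k = orb j k \<longleftrightarrow> i = j" for i j
      using inj_orb[OF False] by (auto dest: injD)
    then show ?thesis using False N by (simp add: divide_simps)
  qed
  finally have "complex_of_real (of_rat (coeff (penergy A N k) 0)) = complex_of_real (if k = 0 then 1 else 1 / real N)"
    by (simp add: of_rat_complex)
  then show ?thesis unfolding of_real_eq_iff .
qed

text \<open>
  For \<open>k = 0\<close> the energy is identically one and so is its mean; the bounds therefore hold for all
  \<open>k\<close>.
\<close>

lemma energy_bounds:
  assumes N: "N \<ge> 1"
  shows "\<bar>rval (nonconst (penergy A N k)) x\<bar> \<le> 1" "- (1 / N) \<le> rval (nonconst (penergy A N k)) x"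
proof -
  have b: "0 \<le> (norm (birk N k x))\<^sup>2" "(norm (birk N k x))\<^sup>2 \<le> 1"
    using norm_birk[of N k x] by (auto simp: power_le_one)
  have "0 \<le> 1 / real N" "1 / real N \<le> 1" using N by auto
  then have "\<bar>(norm (birk N k x))\<^sup>2 - 1 / real N\<bar> \<le> 1" "\<bar>(norm (birk N k x))\<^sup>2 - 1\<bar> \<le> 1"
    using b by linarith+
  then show "\<bar>rval (nonconst (penergy A N k)) x\<bar> \<le> 1"
    unfolding rval_nonconst rval_penergy coeff_penergy[OF N] by auto
  have "birk N 0 x = 1" using N by (simp add: birk_def)
  then show "- (1 / N) \<le> rval (nonconst (penergy A N k)) x"
    using b unfolding rval_nonconst rval_penergy coeff_penergy[OF N] by auto
qed

text \<open>
  The energy detects the Fourier coefficient of an invariant measure, by Cauchy-Schwarz.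
\<close>

lemma integral_energy:
  assumes M: "M \<in> invariant" and N: "N \<ge> 1" and k: "k \<noteq> 0"
  shows "(norm (LINT x|M. torus_char k x))\<^sup>2 - 1 / N \<le> (LINT x|M. rval (nonconst (penergy A N k)) x)"
proof -
  note inv = invariant_prob_measuresD[OF M]
  interpret prob_space M by (rule inv)
  have int: "integrable M (birk N k)" "integrable M (\<lambda>x. norm (birk N k x))" "integrable M (\<lambda>x. (norm (birk N k x))\<^sup>2)"
    by (rule integrable_continuous_torus[OF finite_measure_axioms inv(2), of _ 1];
        auto intro!: continuous_intros continuous_on_birk norm_birk simp: power_le_one norm_birk)+
  have "(LINT x|M. torus_char k x) = (LINT x|M. birk N k x)"
    using integral_pavg(2)[OF M N, of "[(1, k)]"] by (simp add: peval_pavg_single)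
  then have "(norm (LINT x|M. torus_char k x))\<^sup>2 \<le> (LINT x|M. norm (birk N k x))\<^sup>2"
    by (simp add: integral_norm_bound power_mono)
  also have "\<dots> \<le> (LINT x|M. (norm (birk N k x))\<^sup>2)"
    by (rule square_expectation_le[OF int(2,3)])
  finally show ?thesis
    unfolding rval_nonconst rval_penergy coeff_penergy[OF N] using k int(3) by (simp add: prob_space)
qed

lemma integral_norm_birk_lebesgue:
  assumes k: "k \<noteq> 0" and m: "m \<ge> 1"
  shows "(LINT x|torus_lebesgue. norm (birk (m^2) k x)) \<le> 1 / m"
proof -
  interpret prob_space torus_lebesgue by (rule prob_space_torus_lebesgue)
  have N: "m^2 \<ge> 1" using m by simp
  have int: "integrable torus_lebesgue (\<lambda>x. norm (birk (m^2) k x))" "integrable torus_lebesgue (\<lambda>x. (norm (birk (m^2) k x))\<^sup>2)"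
    by (rule integrable_continuous_torus[OF finite_measure_axioms sets_torus_lebesgue, of _ 1];
        auto intro!: continuous_intros continuous_on_birk norm_birk simp: power_le_one norm_birk)+
  have "(LINT x|torus_lebesgue. norm (birk (m^2) k x))\<^sup>2 \<le> (LINT x|torus_lebesgue. (norm (birk (m^2) k x))\<^sup>2)"
    by (rule square_expectation_le[OF int])
  also have "\<dots> = of_rat (coeff (penergy A (m^2) k) 0)"
    using integral_rval_lebesgue[of "penergy A (m^2) k"] by (simp add: rval_penergy)
  also have "\<dots> = (1 / m)\<^sup>2"
    unfolding coeff_penergy[OF N] using k by (simp add: power_divide)
  finally show ?thesis by (rule power2_le_imp_le) simp
qed

text \<open>
  A quantitative mean ergodic theorem: the average of a polynomial without constant term is
  small in \<open>L\<^sup>1\<close>, with a bound that depends on the sum of the moduli of the coefficients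
  only. The explicit rate allows the algorithm to compute a sufficient length of the average.
\<close>

lemma integral_abs_pavg_lebesgue:
  assumes P: "\<forall>t\<in>set P. snd t \<noteq> 0" and m: "m \<ge> 1"
  shows "(LINT x|torus_lebesgue. \<bar>rval (pavg A (m^2) P) x\<bar>) \<le> of_rat (l1 P) / m"
proof -
  interpret prob_space torus_lebesgue by (rule prob_space_torus_lebesgue)
  let ?N = "m^2"
  have int: "integrable torus_lebesgue (\<lambda>x. norm (peval P x))" for P :: "'n trig"
    by (rule integrable_continuous_torus[OF finite_measure_axioms sets_torus_lebesgue, of _ "of_rat (l1 P)"];
        auto intro!: continuous_intros continuous_on_peval norm_peval_le)
  have int_birk: "integrable torus_lebesgue (\<lambda>x. norm (birk ?N k x))" for k
    by (rule integrable_continuous_torus[OF finite_measure_axioms sets_torus_lebesgue, of _ 1];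
        auto intro!: continuous_intros continuous_on_birk norm_birk)
  have "(LINT x|torus_lebesgue. norm (peval (pavg A ?N P) x)) \<le> of_rat (l1 P) / m"
    using P
  proof (induction P)
    case Nil
    then show ?case by (simp add: peval_pavg)
  next
    case (Cons t P)
    have split: "peval (pavg A ?N (t # P)) x = of_rat (fst t) * birk ?N (snd t) x + peval (pavg A ?N P) x" for x
      unfolding peval_pavg birk_def peval_Cons sum.distrib sum_distrib_left[symmetric] by (simp add: add_divide_distrib)
    have "(LINT x|torus_lebesgue. norm (peval (pavg A ?N (t # P)) x))
        \<le> (LINT x|torus_lebesgue. of_rat \<bar>fst t\<bar> * norm (birk ?N (snd t) x) + norm (peval (pavg A ?N P) x))"
    proof (rule integral_mono)
      show "norm (peval (pavg A ?N (t # P)) x) \<le> of_rat \<bar>fst t\<bar> * norm (birk ?N (snd t) x) + norm (peval (pavg A ?N P) x)" for x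
        unfolding split by (rule order_trans[OF norm_triangle_ineq]) (simp add: norm_mult norm_of_rat_complex)
    qed (use int int_birk in auto)
    also have "\<dots> = of_rat \<bar>fst t\<bar> * (LINT x|torus_lebesgue. norm (birk ?N (snd t) x)) + (LINT x|torus_lebesgue. norm (peval (pavg A ?N P) x))"
      using int int_birk by simp
    also have "\<dots> \<le> of_rat \<bar>fst t\<bar> * (1 / m) + of_rat (l1 P) / m"
      using Cons integral_norm_birk_lebesgue[OF _ m, of "snd t"]
      by (intro add_mono mult_left_mono) auto
    finally show ?case by (simp add: of_rat_add add_divide_distrib)
  qed
  moreover have "(LINT x|torus_lebesgue. \<bar>rval (pavg A ?N P) x\<bar>) \<le> (LINT x|torus_lebesgue. norm (peval (pavg A ?N P) x))"
  proof (rule integral_mono)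
    show "integrable torus_lebesgue (\<lambda>x. \<bar>rval (pavg A ?N P) x\<bar>)"
      by (intro integrable_abs integrable_rval prob_space_torus_lebesgue sets_torus_lebesgue)
    show "\<bar>rval (pavg A ?N P) x\<bar> \<le> norm (peval (pavg A ?N P) x)" for x
      unfolding rval_def by (rule abs_Re_le_cmod)
  qed (rule int)
  ultimately show ?thesis by linarith
qed

end

section \<open>Truncation along Birkhoff averages\<close>

text \<open>
  The frequency tested at stage \<open>s\<close>. Each frequency recurs infinitely often, since the second
  component of the pair coded by \<open>s\<close> is free.
\<close>

definition target :: "nat \<Rightarrow> int^('n::finite)"
  where "target s = dec (fst (prod_decode s))"

text \<open>
  The length of the Birkhoff average at stage \<open>s\<close> is the square of this number, which makes both
  the \<open>L\<^sup>1\<close> norm of the average and the mean energy of a non-zero frequency at most \<open>4\<^sup>-\<^sup>s / 16\<close>.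
\<close>

definition avg_root :: "nat \<Rightarrow> ('n::finite) trig \<Rightarrow> nat"
  where "avg_root s H = (LEAST m. of_nat (16 * 4 ^ s) * (1 + l1 H) \<le> of_nat m)"

text \<open>
  The recursion \<open>H' = min (S H) 0 - a (\<bar>S e\<^sub>k\<bar>\<^sup>2 - 1/N)\<close> with \<open>a = 2\<^sup>-\<^sup>s / 4\<close>. The weights \<open>a\<close> are summable, so
  the values stay above \<open>-1\<close>, but they are large compared with the errors \<open>4\<^sup>-\<^sup>s / 16\<close> of the truncation
  and of its mean.
\<close>

definition next_poly :: "int^'n^'n \<Rightarrow> nat \<Rightarrow> ('n::finite) trig \<Rightarrow> 'n trig"
  where "next_poly A s H = (let N = (avg_root s H)\<^sup>2 in
    nonconst (pneg (16 * 4 ^ s) (pavg A N H)) @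
    pscale (- inverse (of_nat (4 * 2 ^ s))) (nonconst (penergy A N (target s))))"

definition increment :: "int^'n^'n \<Rightarrow> nat \<Rightarrow> ('n::finite) trig \<Rightarrow> 'n trig"
  where "increment A s H = next_poly A s H @ pscale (-1) (pavg A ((avg_root s H)\<^sup>2) H)"

definition nonconstant :: "('n::finite) trig \<Rightarrow> bool"
  where "nonconstant P \<longleftrightarrow> (\<forall>t\<in>set P. snd t \<noteq> 0)"

lemma nonconstant_simps [simp]:
  "nonconstant []" "nonconstant (P @ Q) \<longleftrightarrow> nonconstant P \<and> nonconstant Q" "nonconstant (nonconst P)"
  "nonconstant (pscale r P) \<longleftrightarrow> nonconstant P"
  by (auto simp: nonconstant_def nonconst_def pscale_def)

lemma Least_rat_le: "q \<le> of_nat (LEAST n. q \<le> (of_nat n :: rat))"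
  by (rule LeastI_ex) (rule real_arch_simple)

context toral_dynamics
begin

lemma nonconstant_funpow_pshift: "nonconstant P \<Longrightarrow> nonconstant ((pshift A ^^ n) P)"
  by (auto simp: nonconstant_def funpow_pshift orb_nonzero)

lemma nonconstant_pavg: "nonconstant P \<Longrightarrow> nonconstant (pavg A N P)"
  using nonconstant_funpow_pshift unfolding pavg_def nonconstant_simps by (auto simp: nonconstant_def)

lemma avg_root_ge:
  shows "real (16 * 4 ^ s) * (1 + of_rat (l1 H)) \<le> real (avg_root s H)" "1 \<le> avg_root s H"
    "of_rat (l1 H) / real (avg_root s H) \<le> 1 / real (16 * 4 ^ s)"
    "1 / real ((avg_root s H)\<^sup>2) \<le> 1 / real (16 * 4 ^ s)"
proof -
  define K m where "K = real (16 * 4 ^ s)" and "m = real (avg_root s H)"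
  have "(1::real) \<le> 4 ^ s" by simp
  moreover have "K = 16 * 4 ^ s" by (simp add: K_def)
  ultimately have K: "K \<ge> 1" by linarith
  have l1: "(0::real) \<le> of_rat (l1 H)"
    using l1_nonneg[of H] by simp
  have "of_nat (16 * 4 ^ s) * (1 + l1 H) \<le> of_nat (avg_root s H)"
    unfolding avg_root_def by (rule Least_rat_le)
  then have "(of_rat (of_nat (16 * 4 ^ s) * (1 + l1 H)) :: real) \<le> of_rat (of_nat (avg_root s H))"
    unfolding of_rat_less_eq .
  then have le: "K * (1 + of_rat (l1 H)) \<le> m"
    by (simp add: of_rat_mult of_rat_add of_rat_power K_def m_def)
  then show "real (16 * 4 ^ s) * (1 + of_rat (l1 H)) \<le> real (avg_root s H)"
    by (simp add: K_def m_def)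
  have "K * 1 \<le> K * (1 + of_rat (l1 H))" "K * of_rat (l1 H) \<le> K * (1 + of_rat (l1 H))"
    using K l1 by (intro mult_left_mono; simp)+
  then have Km: "K \<le> m" "K * of_rat (l1 H) \<le> m" using le by linarith+
  then have m: "1 \<le> m" using K by simp
  then show "1 \<le> avg_root s H" by (simp add: m_def)
  show "of_rat (l1 H) / real (avg_root s H) \<le> 1 / real (16 * 4 ^ s)"
    unfolding K_def[symmetric] m_def[symmetric] using Km m K by (simp add: field_simps)
  have "m \<le> m\<^sup>2" using m by (simp add: power2_eq_square)
  then have "1 / m\<^sup>2 \<le> 1 / K" using Km m K by (intro divide_left_mono) auto
  then show "1 / real ((avg_root s H)\<^sup>2) \<le> 1 / real (16 * 4 ^ s)"
    by (simp add: K_def m_def)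
qed

text \<open>
  The invariant of the recursion. The lower bound keeps the polynomials in the range where the
  approximation of the absolute value is valid; the upper bound makes the effect of the truncation
  summable.
\<close>

definition good :: "nat \<Rightarrow> 'n trig \<Rightarrow> bool"
  where "good s H \<longleftrightarrow> preal H \<and> nonconstant H \<and> (\<forall>x. - (1 - (1/2) ^ s) \<le> rval H x \<and> rval H x \<le> (1/4) ^ s)"

lemma good_Nil: "good 0 []"
  by (simp add: good_def)

text \<open>
  With \<open>u = 2\<^sup>-\<^sup>s\<close>, each of the truncation error, the modulus of the mean \<open>c\<close> of the truncated average
  and the negative part of \<open>e\<close> is at most \<open>u\<^sup>2 / 16\<close>. All claims follow from the resulting pointwise
  bounds for \<open>min X 0 - c - (u / 4) e\<close>, where \<open>X\<close> is the average and \<open>e\<close> the energy minus its mean. The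
  integral bounds use that \<open>\<integral>min X 0 d\<mu>\<close> is at most both \<open>\<integral>X d\<mu>\<close> and \<open>0\<close>.
\<close>

lemma next_poly_properties:
  assumes H: "good s H"
  shows "good (Suc s) (next_poly A s H)"
    and "preal (increment A s H)" "nonconstant (increment A s H)"
    and "norm (peval (increment A s H) x) \<le> 2 * (1/2) ^ s"
    and "M \<in> invariant \<Longrightarrow> (LINT x|M. rval (increment A s H) x) = (LINT x|M. rval (next_poly A s H) x) - (LINT x|M. rval H x)"
    and "M \<in> invariant \<Longrightarrow> (LINT x|M. rval (next_poly A s H) x) \<le> min (LINT x|M. rval H x) 0 + (1/4) ^ s / 4"
    and "M \<in> invariant \<Longrightarrow> target s \<noteq> (0::int^'n) \<Longrightarrow> (LINT x|M. rval (next_poly A s H) x) \<le>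
       (1/4) ^ s / 4 - (1/2) ^ s / 4 * (norm (LINT x|M. torus_char (target s) x))\<^sup>2"
proof -
  define m N X n where "m = avg_root s H" and "N = m\<^sup>2" and "X = pavg A N H" and "n = (16 * 4 ^ s :: nat)"
  define u :: real where "u = (1/2) ^ s"
  define p e where "p = pneg n X" and "e = nonconst (penergy A N (target s))"
  define c where "c = (of_rat (coeff p 0) :: real)"
  have u: "0 < u" "u \<le> 1" by (auto simp: u_def power_le_one)
  have u2: "(1/4) ^ s = u\<^sup>2" by (simp add: u_def power2_eq_square power_mult_distrib[symmetric])
  have u2u: "0 < u\<^sup>2" "u\<^sup>2 \<le> u" using u by (auto simp: power2_eq_square mult_left_le)
  have n: "n \<ge> 1" "1 / real n = u\<^sup>2 / 16"
    by (simp_all add: n_def u2[symmetric] power_divide)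
  have m: "m \<ge> 1" "of_rat (l1 H) / m \<le> u\<^sup>2 / 16" "1 / real N \<le> u\<^sup>2 / 16"
    using avg_root_ge[where s=s and H=H] unfolding n(2)[unfolded n_def] m_def N_def by simp_all
  have N: "N \<ge> 1" using m by (simp add: N_def)
  have h: "preal H" "nonconstant H" "\<And>x. - (1 - u) \<le> rval H x" "\<And>x. rval H x \<le> u\<^sup>2"
    using H by (auto simp: good_def u_def[symmetric] u2)
  have X: "preal X" "nonconstant X"
    unfolding X_def by (auto intro: preal_pavg nonconstant_pavg h)
  have Xb: "- (1 - u) \<le> rval X x" "rval X x \<le> u\<^sup>2" for x
  proof -
    have "(\<Sum>i<N. - (1 - u)) \<le> (\<Sum>i<N. rval H ((T ^^ i) x))" "(\<Sum>i<N. rval H ((T ^^ i) x)) \<le> (\<Sum>i<N. u\<^sup>2)"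
      by (rule sum_mono, rule h)+
    then show "- (1 - u) \<le> rval X x" "rval X x \<le> u\<^sup>2"
      using N unfolding X_def rval_pavg by (simp_all add: field_simps)
  qed
  have X1: "\<bar>rval X x\<bar> \<le> 1" for x
    using u u2u Xb[of x] by linarith
  have p: "preal p" "\<And>x. min (rval X x) 0 \<le> rval p x" "\<And>x. rval p x \<le> min (rval X x) 0 + u\<^sup>2 / 16"
    using rval_pneg[OF X(1) X1 n(1)] preal_pneg[OF X(1)] n(2) by (auto simp: p_def)
  have e: "preal e" "nonconstant e" "\<And>x. \<bar>rval e x\<bar> \<le> 1" "\<And>x. - (u\<^sup>2 / 16) \<le> rval e x"
  proof -
    show "preal e" "nonconstant e" by (simp_all add: e_def preal_penergy)
    show "\<bar>rval e x\<bar> \<le> 1" for x unfolding e_def by (rule energy_bounds(1)[OF N])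
    show "- (u\<^sup>2 / 16) \<le> rval e x" for x
      using energy_bounds(2)[OF N, of "target s" x] m(3) unfolding e_def by linarith
  qed
  have npX: "next_poly A s H = nonconst p @ pscale (- inverse (of_nat (4 * 2 ^ s))) e"
    by (simp add: next_poly_def Let_def m_def N_def X_def n_def p_def e_def)
  have incX: "increment A s H = next_poly A s H @ pscale (-1) X"
    by (simp add: increment_def m_def N_def X_def)
  have rnp: "rval (next_poly A s H) x = rval p x - c - u / 4 * rval e x" for x
  proof -
    have "(of_rat (- inverse (of_nat (4 * 2 ^ s))) :: real) = - (u / 4)"
    proof -
      have "(of_rat (- inverse (of_nat (4 * 2 ^ s))) :: real) = - inverse (real (4 * 2 ^ s))"
        by (simp only: of_rat_minus of_rat_inverse of_rat_of_nat_eq)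
      also have "\<dots> = - (u / 4)" by (simp add: u_def power_one_over inverse_eq_divide)
      finally show ?thesis .
    qed
    then show ?thesis unfolding npX by (simp add: rval_nonconst c_def)
  qed
  note leb = prob_space_torus_lebesgue sets_torus_lebesgue
  interpret L: prob_space "torus_lebesgue :: 'n torus measure" by (rule leb)
  have c: "- (u\<^sup>2 / 16) \<le> c" "c \<le> u\<^sup>2 / 16"
  proof -
    have cint: "c = (LINT x|torus_lebesgue. rval p x)"
      by (simp add: c_def integral_rval_lebesgue)
    have "c \<le> (LINT x|(torus_lebesgue :: 'n torus measure). u\<^sup>2 / 16)"
      unfolding cint
    proof (rule integral_mono)
      show "rval p x \<le> u\<^sup>2 / 16" for x using p(3)[of x] by linarith
    qed (use integrable_rval[OF leb] in auto)
    then show "c \<le> u\<^sup>2 / 16" by (simp add: L.prob_space)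
    have "(LINT x|torus_lebesgue. - \<bar>rval X x\<bar>) \<le> c"
      unfolding cint
    proof (rule integral_mono)
      show "- \<bar>rval X x\<bar> \<le> rval p x" for x using p(2)[of x] by linarith
    qed (intro integrable_minus integrable_abs integrable_rval leb)+
    moreover have "(LINT x|torus_lebesgue. \<bar>rval X x\<bar>) \<le> u\<^sup>2 / 16"
      using integral_abs_pavg_lebesgue[OF h(2)[unfolded nonconstant_def] m(1)] m(2)
      unfolding X_def N_def by linarith
    ultimately show "- (u\<^sup>2 / 16) \<le> c" by simp
  qed
  have ue: "- (u / 4) \<le> u / 4 * rval e x" "u / 4 * rval e x \<le> u / 4" "- (u\<^sup>2 / 16) \<le> u / 4 * rval e x" for x
  proof -
    have "u / 4 * (-1) \<le> u / 4 * rval e x" "u / 4 * rval e x \<le> u / 4 * 1"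
      using e(3)[of x] u by (intro mult_left_mono; simp add: abs_le_iff)+
    then show "- (u / 4) \<le> u / 4 * rval e x" "u / 4 * rval e x \<le> u / 4" by simp_all
    have "u / 4 * (- (u\<^sup>2 / 16)) \<le> u / 4 * rval e x"
      using e(4)[of x] u by (intro mult_left_mono) auto
    moreover have "u / 4 * (u\<^sup>2 / 16) \<le> 1 * (u\<^sup>2 / 16)"
      using u by (intro mult_right_mono) auto
    ultimately show "- (u\<^sup>2 / 16) \<le> u / 4 * rval e x" by simp
  qed
  show "good (Suc s) (next_poly A s H)"
    unfolding good_def
  proof (intro conjI allI)
    show "preal (next_poly A s H)" "nonconstant (next_poly A s H)"
      unfolding npX using p e by auto
    fix x
    show "- (1 - (1/2) ^ Suc s) \<le> rval (next_poly A s H) x"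
      using p(2)[of x] Xb[of x] c ue[of x] u u2u unfolding rnp power_Suc u_def[symmetric] by linarith
    show "rval (next_poly A s H) x \<le> (1/4) ^ Suc s"
      using p(3)[of x] Xb[of x] c ue[of x] u u2u unfolding rnp power_Suc u2 by linarith
  qed
  then have np: "preal (next_poly A s H)" "nonconstant (next_poly A s H)" by (auto simp: good_def)
  then show inc: "preal (increment A s H)" "nonconstant (increment A s H)"
    unfolding incX using X by auto
  have rinc: "rval (increment A s H) x = rval (next_poly A s H) x - rval X x" for x
    unfolding incX by (simp add: of_rat_minus)
  have "\<bar>rval (increment A s H) x\<bar> \<le> 2 * u"
    using p(2,3)[of x] Xb[of x] c ue[of x] u u2u unfolding rinc rnp by linarith
  then show "norm (peval (increment A s H) x) \<le> 2 * (1/2) ^ s"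
    unfolding peval_eq_rval[OF inc(1)] by (simp add: u_def)
  assume M: "M \<in> invariant"
  note inv = invariant_prob_measuresD[OF M]
  interpret M: prob_space M by (rule inv)
  note int = integrable_rval[OF inv(1,2)]
  have iX: "(LINT x|M. rval X x) = (LINT x|M. rval H x)"
    unfolding X_def by (rule integral_pavg[OF M N])
  show "(LINT x|M. rval (increment A s H) x) = (LINT x|M. rval (next_poly A s H) x) - (LINT x|M. rval H x)"
    unfolding rinc using int iX by simp
  have ip: "(LINT x|M. rval p x) \<le> min (LINT x|M. rval H x) 0 + u\<^sup>2 / 16"
  proof -
    have "(LINT x|M. rval p x) \<le> (LINT x|M. rval X x + u\<^sup>2 / 16)"
    proof (rule integral_mono)
      show "rval p x \<le> rval X x + u\<^sup>2 / 16" for x using p(3)[of x] by linarith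
    qed (use int in auto)
    moreover have "(LINT x|M. rval p x) \<le> (LINT x|M. u\<^sup>2 / 16)"
    proof (rule integral_mono)
      show "rval p x \<le> u\<^sup>2 / 16" for x using p(3)[of x] by linarith
    qed (use int in auto)
    ultimately show ?thesis using int iX by (simp add: M.prob_space)
  qed
  have inp: "(LINT x|M. rval (next_poly A s H) x) = (LINT x|M. rval p x) - c - u / 4 * (LINT x|M. rval e x)"
    unfolding rnp using int by (simp add: M.prob_space)
  have "(LINT x|M. rval (next_poly A s H) x) \<le> (LINT x|M. rval p x - c + u\<^sup>2 / 16)"
  proof (rule integral_mono)
    show "rval (next_poly A s H) x \<le> rval p x - c + u\<^sup>2 / 16" for x using ue[of x] unfolding rnp by linarith
  qed (use int in auto)
  then have "(LINT x|M. rval (next_poly A s H) x) \<le> (LINT x|M. rval p x) - c + u\<^sup>2 / 16"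
    using int by (simp add: M.prob_space)
  then show "(LINT x|M. rval (next_poly A s H) x) \<le> min (LINT x|M. rval H x) 0 + (1/4) ^ s / 4"
    using ip c u2u unfolding u2 by linarith
  assume k: "target s \<noteq> (0::int^'n)"
  define v where "v = (norm (LINT x|M. torus_char (target s :: int^'n) x))\<^sup>2"
  have "v - 1 / N \<le> (LINT x|M. rval e x)"
    unfolding v_def e_def by (rule integral_energy[OF M N k])
  then have "u / 4 * (v - u\<^sup>2 / 16) \<le> u / 4 * (LINT x|M. rval e x)"
    using m(3) u by (intro mult_left_mono) auto
  moreover have "u / 4 * (u\<^sup>2 / 16) \<le> 1 * (u\<^sup>2 / 16)"
    using u by (intro mult_right_mono) auto
  ultimately have "u / 4 * v - u\<^sup>2 / 16 \<le> u / 4 * (LINT x|M. rval e x)"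
    by (simp add: right_diff_distrib)
  then show "(LINT x|M. rval (next_poly A s H) x) \<le>
       (1/4) ^ s / 4 - (1/2) ^ s / 4 * (norm (LINT x|M. torus_char (target s) x))\<^sup>2"
    using ip c u2u unfolding inp u2 u_def[symmetric] v_def[symmetric] by linarith
qed

end

section \<open>Moving the increments into shells of frequencies\<close>

lemma infnorm_vec_of_int_le_iff:
  fixes k :: "int^('n::finite)"
  shows "infnorm (vec_of_int k) \<le> r \<longleftrightarrow> (\<forall>i. \<bar>real_of_int (k $ i)\<bar> \<le> r)"
proof -
  have B: "(Basis :: (real^'n) set) = range (\<lambda>i. axis i 1)"
    by (auto simp: Basis_vec_def)
  have "infnorm (vec_of_int k) = Max (range (\<lambda>i. \<bar>real_of_int (k $ i)\<bar>))"
    unfolding infnorm_Max B by (simp add: image_image inner_axis vec_of_int_def)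
  then show ?thesis by simp
qed

lemma infnorm_le_iff_max_norm:
  fixes k :: "int^('n::finite)"
  assumes "r \<ge> 0"
  shows "infnorm (vec_of_int k) \<le> r \<longleftrightarrow> max_norm k \<le> nat \<lfloor>r\<rfloor>"
proof -
  have "\<bar>real_of_int a\<bar> \<le> r \<longleftrightarrow> \<bar>a\<bar> \<le> int (nat \<lfloor>r\<rfloor>)" for a
    using assms by (simp add: le_floor_iff)
  then show ?thesis
    unfolding infnorm_vec_of_int_le_iff max_norm_le_iff by simp
qed

lemma finite_max_norm_ball: "finite {k :: int^('n::finite). max_norm k \<le> R}"
proof (rule finite_subset)
  show "finite (insert 0 {k :: int^'n. k \<noteq> 0 \<and> infnorm (vec_of_int k) \<le> real R})"
    using finite_square[of "real R"] by simp
  show "{k :: int^'n. max_norm k \<le> R} \<subseteq> insert 0 {k. k \<noteq> 0 \<and> infnorm (vec_of_int k) \<le> real R}"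
    by (auto simp: infnorm_le_iff_max_norm)
qed

definition trunc :: "nat \<Rightarrow> ('n::finite) trig \<Rightarrow> 'n trig"
  where "trunc r P = filter (\<lambda>t. max_norm (snd t) \<le> r) P"

lemma trunc_append [simp]: "trunc r (P @ Q) = trunc r P @ trunc r Q"
  by (simp add: trunc_def)

lemma trunc_pscale [simp]: "trunc r (pscale q P) = pscale q (trunc r P)"
  by (simp add: trunc_def pscale_def filter_map comp_def)

text \<open>
  The first time at which all frequencies of \<open>d\<close> have left the ball of radius \<open>R\<close>. The zero frequency
  is exempt, so that the search terminates for every argument.
\<close>

definition esc :: "int^'n^'n \<Rightarrow> nat \<Rightarrow> ('n::finite) trig \<Rightarrow> nat"
  where "esc A R d = (LEAST m. list_all (\<lambda>t. snd t = 0 \<or> R < max_norm (snd t)) ((pshift A ^^ m) d))"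

text \<open>
  Appends a copy of \<open>d\<close> whose frequencies lie beyond the current radius, and enlarges the radius beyond
  them. The successor makes the radius grow even if \<open>d\<close> is empty.
\<close>

definition emit_step :: "int^'n^'n \<Rightarrow> ('n::finite) trig \<Rightarrow> nat \<times> 'n trig \<Rightarrow> nat \<times> 'n trig"
  where "emit_step A d p = (let b = (pshift A ^^ esc A (fst p) d) d in
    (Suc (fst p + sum_list (map (\<lambda>t. max_norm (snd t)) b)), snd p @ b))"

text \<open>
  With this number of copies, the absolute coefficient sum of a single copy, divided by the number of
  copies, is at most \<open>2\<^sup>-\<^sup>s\<close>.
\<close>

definition copies :: "nat \<Rightarrow> ('n::finite) trig \<Rightarrow> nat"
  where "copies s d = (LEAST L. 1 + of_nat (2 ^ s) * l1 d \<le> of_nat L)"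

text \<open>
  Stage number, radius of the frequencies used so far, the polynomial \<open>H\<close>, and the part of the
  Fourier series produced so far.
\<close>

type_synonym 'n state = "nat \<times> nat \<times> 'n trig \<times> 'n trig"

definition emission :: "int^'n^'n \<Rightarrow> nat \<Rightarrow> nat \<Rightarrow> ('n::finite) trig \<Rightarrow> nat \<times> 'n trig"
  where "emission A s R d = (let L = copies s d; p = (emit_step A d ^^ L) (R, []) in
    (fst p, pscale (inverse (of_nat L)) (snd p)))"

definition stage :: "int^'n^'n \<Rightarrow> ('n::finite) state \<Rightarrow> 'n state"
  where "stage A \<sigma> = (let s = fst \<sigma>; R = fst (snd \<sigma>); H = fst (snd (snd \<sigma>)); F = snd (snd (snd \<sigma>));
      p = emission A s R (increment A s H) in
    (Suc s, fst p, next_poly A s H, F @ snd p))"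

definition state :: "int^'n^'n \<Rightarrow> nat \<Rightarrow> ('n::finite) state"
  where "state A n = (stage A ^^ n) (0, 0, [], [])"

text \<open>
  The radius after \<open>n\<close> stages is at least \<open>n\<close>, so the coefficient at \<open>k\<close> is final after
  \<open>max_norm k + 1\<close> stages.
\<close>

definition limit_coeff :: "int^'n^'n \<Rightarrow> int^('n::finite) \<Rightarrow> rat"
  where "limit_coeff A k = coeff (snd (snd (snd (state A (Suc (max_norm k)))))) k"

context toral_dynamics
begin

text \<open>
  Each infinite orbit meets a ball finitely often, so all but finitely many times are suitable for the
  finitely many frequencies of \<open>d\<close>.
\<close>

lemma esc_exists: "\<exists>m. list_all (\<lambda>t. snd t = 0 \<or> R < max_norm (snd t)) ((pshift A ^^ m) d)"
proof -
  \<comment> \<open>The times at which the frequency of a term lies in the ball.\<close>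
  let ?bad = "\<lambda>t. {m. orb m (snd t) \<noteq> 0 \<and> max_norm (orb m (snd t)) \<le> R}"
  have "finite (?bad t)" for t :: "rat \<times> (int^'n)"
  proof (cases "snd t = 0")
    case True
    have "orb m 0 = 0" for m by (induction m) auto
    then show ?thesis using True by simp
  next
    case False
    have "finite ((\<lambda>m. orb m (snd t)) -` {k. max_norm k \<le> R})"
      by (rule finite_vimageI[OF finite_max_norm_ball inj_orb[OF False]])
    then show ?thesis by (rule rev_finite_subset) auto
  qed
  then have "finite (\<Union>t\<in>set d. ?bad t)" by blast
  then obtain m where "m \<notin> (\<Union>t\<in>set d. ?bad t)"
    using ex_new_if_finite[OF infinite_UNIV_nat] by blast
  then show ?thesis
    by (intro exI[of _ m]) (auto simp: funpow_pshift list_all_iff not_le)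
qed

lemma max_norm_esc:
  assumes "nonconstant d" "t \<in> set ((pshift A ^^ esc A R d) d)"
  shows "R < max_norm (snd t)"
proof -
  have "list_all (\<lambda>t. snd t = 0 \<or> R < max_norm (snd t)) ((pshift A ^^ esc A R d) d)"
    unfolding esc_def by (rule LeastI_ex[OF esc_exists])
  then show ?thesis
    using nonconstant_funpow_pshift[OF assms(1)] assms(2) unfolding nonconstant_def list_all_iff by blast
qed

lemma l1_funpow_pshift: "l1 ((pshift A ^^ m) d) = l1 d"
  unfolding funpow_pshift by (simp add: l1_def comp_def)

text \<open>
  The shells are disjoint and ordered. Therefore truncation at any radius keeps some copies entirely,
  drops others, and cuts at most one. Complete copies are bounded by the supremum bound \<open>D\<close>, the cut
  one by its absolute coefficient sum.
\<close>

lemma emit_steps: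
  fixes R :: nat
  assumes d: "nonconstant d" "preal d" and D: "\<And>x. norm (peval d x) \<le> D"
  defines "q \<equiv> \<lambda>L::nat. (emit_step A d ^^ L) (R, [])"
  shows "R + L \<le> fst (q L) \<and> nonconstant (snd (q L)) \<and> preal (snd (q L)) \<and>
    (\<forall>t\<in>set (snd (q L)). R < max_norm (snd t) \<and> max_norm (snd t) \<le> fst (q L)) \<and>
    (\<forall>x. norm (peval (snd (q L)) x) \<le> real L * D) \<and>
    (\<forall>r x. norm (peval (trunc r (snd (q L))) x) \<le> real L * D + of_rat (l1 d)) \<and>
    (\<forall>M\<in>invariant. (LINT x|M. rval (snd (q L)) x) = real L * (LINT x|M. rval d x))"
proof (induction L)
  case 0
  have "(0::real) \<le> of_rat (l1 d)" using l1_nonneg[of d] by simp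
  then show ?case by (simp add: q_def trunc_def)
next
  case (Suc L)
  define b where "b = (pshift A ^^ esc A (fst (q L)) d) d"
  define R' where "R' = Suc (fst (q L) + sum_list (map (\<lambda>t. max_norm (snd t)) b))"
  have q: "q (Suc L) = (R', snd (q L) @ b)"
    by (simp add: q_def emit_step_def b_def R'_def Let_def)
  have b: "nonconstant b" "preal b" "\<And>x. norm (peval b x) \<le> D"
    using nonconstant_funpow_pshift[OF d(1)] d(2) D
    unfolding b_def preal_def peval_funpow_pshift by auto
  have bR: "fst (q L) < max_norm (snd t)" "max_norm (snd t) \<le> R'" if "t \<in> set b" for t
  proof -
    show "fst (q L) < max_norm (snd t)" using max_norm_esc[OF d(1)] that unfolding b_def by blast
    have "max_norm (snd t) \<le> sum_list (map (\<lambda>t. max_norm (snd t)) b)"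
      using that by (intro member_le_sum_list) auto
    then show "max_norm (snd t) \<le> R'" unfolding R'_def by simp
  qed
  have D0: "0 \<le> D" using D[of undefined] norm_ge_zero order_trans by blast
  have bi: "(LINT x|M. rval b x) = (LINT x|M. rval d x)" if M: "M \<in> invariant" for M
  proof -
    have "rval d \<in> borel_measurable M"
      using integrable_rval[OF invariant_prob_measuresD(1,2)[OF M]] by (rule borel_measurable_integrable)
    then show ?thesis
      unfolding b_def rval_funpow_pshift using integral_funpow_invariant[OF M] by blast
  qed
  have "norm (peval (snd (q (Suc L))) x) \<le> real (Suc L) * D" for x
    using norm_triangle_ineq[of "peval (snd (q L)) x" "peval b x"] b(3)[of x] Suc
    by (simp add: q algebra_simps) (smt (verit, best))
  moreover have "norm (peval (trunc r (snd (q (Suc L)))) x) \<le> real (Suc L) * D + of_rat (l1 d)" for r x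
  proof (cases "r < fst (q L)")
    case True
    then have "trunc r b = []"
      using bR(1) by (force simp: trunc_def filter_empty_conv)
    then have "norm (peval (trunc r (snd (q (Suc L)))) x) \<le> real L * D + of_rat (l1 d)"
      using Suc by (simp add: q)
    also have "\<dots> \<le> real (Suc L) * D + of_rat (l1 d)" using D0 by (simp add: algebra_simps)
    finally show ?thesis .
  next
    case False
    then have "trunc r (snd (q L)) = snd (q L)"
      using Suc by (force simp: trunc_def filter_id_conv)
    then have "norm (peval (trunc r (snd (q (Suc L)))) x) \<le> norm (peval (snd (q L)) x) + norm (peval (trunc r b) x)"
      by (simp add: q norm_triangle_ineq)
    also have "\<dots> \<le> real L * D + of_rat (l1 (trunc r b))"
      using Suc norm_peval_le by (intro add_mono) auto
    also have "(of_rat (l1 (trunc r b)) :: real) \<le> of_rat (l1 d)"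
      using l1_filter[of _ b] l1_funpow_pshift[of _ d] by (simp add: trunc_def b_def of_rat_less_eq)
    also have "real L * D + of_rat (l1 d) \<le> real (Suc L) * D + of_rat (l1 d)" using D0 by (simp add: algebra_simps)
    finally show ?thesis by simp
  qed
  moreover have "(LINT x|M. rval (snd (q (Suc L))) x) = real (Suc L) * (LINT x|M. rval d x)" if M: "M \<in> invariant" for M
    using Suc M bi[OF M] integrable_rval[OF invariant_prob_measuresD(1,2)[OF M]]
    by (simp add: q algebra_simps)
  moreover have "\<forall>t\<in>set (snd (q (Suc L))). R < max_norm (snd t) \<and> max_norm (snd t) \<le> fst (q (Suc L))"
  proof
    fix t assume t: "t \<in> set (snd (q (Suc L)))"
    have "fst (q L) \<le> R'" "R \<le> fst (q L)" using Suc by (auto simp: R'_def)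
    with t Suc bR[of t] show "R < max_norm (snd t) \<and> max_norm (snd t) \<le> fst (q (Suc L))"
      by (fastforce simp: q)
  qed
  moreover have "R + Suc L \<le> fst (q (Suc L))" using Suc by (simp add: q R'_def)
  ultimately show ?case using Suc b by (simp add: q)
qed

lemma emission_properties:
  fixes s R :: nat
  assumes d: "nonconstant d" "preal d" and D: "\<And>x. norm (peval d x) \<le> D"
  defines "E \<equiv> snd (emission A s R d)" and "R' \<equiv> fst (emission A s R d)"
  shows "R < R'" "nonconstant E" "preal E"
    "\<And>t. t \<in> set E \<Longrightarrow> R < max_norm (snd t) \<and> max_norm (snd t) \<le> R'"
    "norm (peval (trunc r E) x) \<le> D + (1/2) ^ s"
    "M \<in> invariant \<Longrightarrow> (LINT x|M. rval E x) = (LINT x|M. rval d x)"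
proof -
  define L where "L = copies s d"
  define q where "q = (emit_step A d ^^ L) (R, [])"
  have E: "E = pscale (inverse (of_nat L)) (snd q)" "R' = fst q"
    by (simp_all add: E_def R'_def emission_def L_def q_def Let_def)
  have "1 + of_nat (2 ^ s) * l1 d \<le> of_nat L"
    unfolding L_def copies_def by (rule Least_rat_le)
  then have "(of_rat (1 + of_nat (2 ^ s) * l1 d) :: real) \<le> of_rat (of_nat L)"
    unfolding of_rat_less_eq .
  then have le: "1 + 2 ^ s * (of_rat (l1 d) :: real) \<le> L"
    by (simp add: of_rat_mult of_rat_add of_rat_power)
  moreover have l1: "(0::real) \<le> of_rat (l1 d)" using l1_nonneg[of d] by simp
  then have "(0::real) \<le> 2 ^ s * of_rat (l1 d)" by simp
  ultimately have L: "real L \<ge> 1" "2 ^ s * (of_rat (l1 d) :: real) \<le> L" by linarith+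
  note q = emit_steps[OF d D, of R L, folded q_def]
  show "R < R'" using q L by (simp add: E)
  show "nonconstant E" "preal E" using q by (simp_all add: E)
  show "R < max_norm (snd t) \<and> max_norm (snd t) \<le> R'" if "t \<in> set E" for t
    using q that by (auto simp: E pscale_def)
  have "norm (peval (trunc r E) x) = norm (peval (trunc r (snd q)) x) / L"
    by (simp add: E norm_mult norm_of_rat_complex of_rat_inverse norm_inverse divide_inverse mult.commute)
  also have "\<dots> \<le> (L * D + of_rat (l1 d)) / L"
    using q by (intro divide_right_mono) auto
  also have "\<dots> = D + of_rat (l1 d) / L" using L by (simp add: add_divide_distrib)
  also have "of_rat (l1 d) / L \<le> (1/2) ^ s"
    using L by (simp add: field_simps power_one_over)
  finally show "norm (peval (trunc r E) x) \<le> D + (1/2) ^ s" by simp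
  show "(LINT x|M. rval E x) = (LINT x|M. rval d x)" if "M \<in> invariant"
    using q that L integrable_rval[OF invariant_prob_measuresD(1,2)[OF that]] by (simp add: E of_rat_inverse)
qed

definition radius :: "nat \<Rightarrow> nat" where "radius n = fst (snd (state A n))"
definition poly :: "nat \<Rightarrow> 'n trig" where "poly n = fst (snd (snd (state A n)))"
definition partial :: "nat \<Rightarrow> 'n trig" where "partial n = snd (snd (snd (state A n)))"
definition block :: "nat \<Rightarrow> 'n trig" where "block n = snd (emission A n (radius n) (increment A n (poly n)))"

lemma fst_state: "fst (state A n) = n"
  by (induction n) (simp_all add: state_def stage_def Let_def)

lemma state_0: "radius 0 = 0" "poly 0 = []" "partial 0 = []"
  by (simp_all add: radius_def poly_def partial_def state_def)

lemma state_Suc: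
  "radius (Suc n) = fst (emission A n (radius n) (increment A n (poly n)))"
  "poly (Suc n) = next_poly A n (poly n)"
  "partial (Suc n) = partial n @ block n"
proof -
  have "state A (Suc n) = stage A (state A n)" by (simp add: state_def)
  then show "radius (Suc n) = fst (emission A n (radius n) (increment A n (poly n)))"
    "poly (Suc n) = next_poly A n (poly n)" "partial (Suc n) = partial n @ block n"
    by (simp_all add: stage_def Let_def radius_def poly_def partial_def block_def fst_state)
qed

lemma good_poly: "good n (poly n)"
proof (induction n)
  case (Suc n)
  then show ?case using next_poly_properties(1) by (simp add: state_Suc)
qed (simp add: state_0 good_Nil)

lemma block_properties:
  shows "radius n < radius (Suc n)" "nonconstant (block n)" "preal (block n)"
    "\<And>t. t \<in> set (block n) \<Longrightarrow> radius n < max_norm (snd t) \<and> max_norm (snd t) \<le> radius (Suc n)"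
    "norm (peval (trunc r (block n)) x) \<le> 3 * (1/2) ^ n"
    "M \<in> invariant \<Longrightarrow> (LINT x|M. rval (block n) x) = (LINT x|M. rval (poly (Suc n)) x) - (LINT x|M. rval (poly n) x)"
proof -
  note next_p = next_poly_properties[OF good_poly[of n]]
  note em = emission_properties[OF next_p(3,2,4), where s=n and R="radius n", folded block_def state_Suc(1)]
  show "radius n < radius (Suc n)" "nonconstant (block n)" "preal (block n)" by (fact em)+
  show "radius n < max_norm (snd t) \<and> max_norm (snd t) \<le> radius (Suc n)" if "t \<in> set (block n)" for t
    using that by (rule em(4))
  show "norm (peval (trunc r (block n)) x) \<le> 3 * (1/2) ^ n" using em(5)[of r x] by simp
  show "(LINT x|M. rval (block n) x) = (LINT x|M. rval (poly (Suc n)) x) - (LINT x|M. rval (poly n) x)"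
    if "M \<in> invariant" using em(6)[OF that] next_p(5)[OF that] by (simp add: state_Suc)
qed

lemma radius_ge: "n \<le> radius n"
proof (induction n)
  case (Suc n)
  then show ?case using block_properties(1)[of n] by simp
qed simp

lemma partial_properties:
  "nonconstant (partial n)" "preal (partial n)" "\<And>t. t \<in> set (partial n) \<Longrightarrow> max_norm (snd t) \<le> radius n"
proof -
  have "nonconstant (partial n) \<and> preal (partial n) \<and> (\<forall>t\<in>set (partial n). max_norm (snd t) \<le> radius n)"
  proof (induction n)
    case (Suc n)
    then show ?case using block_properties(1,2,3)[of n] block_properties(4)[of _ n] by (fastforce simp: state_Suc(3))
  qed (simp add: state_0)
  then show "nonconstant (partial n)" "preal (partial n)" "\<And>t. t \<in> set (partial n) \<Longrightarrow> max_norm (snd t) \<le> radius n"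
    by auto
qed

lemma coeff_append: "coeff (P @ Q) k = coeff P k + coeff Q k"
  by (simp add: coeff_def)

lemma coeff_eq_0: "(\<And>t. t \<in> set P \<Longrightarrow> snd t \<noteq> k) \<Longrightarrow> coeff P k = 0"
  by (auto simp: coeff_def filter_empty_conv)

lemma coeff_partial:
  assumes "max_norm k < n"
  shows "coeff (partial n) k = limit_coeff A k"
proof -
  have "coeff (partial (Suc (max_norm k) + j)) k = limit_coeff A k" for j
  proof (induction j)
    case (Suc j)
    have "coeff (block (Suc (max_norm k) + j)) k = 0"
      using block_properties(4)[of _ "Suc (max_norm k) + j"] radius_ge[of "Suc (max_norm k) + j"]
      by (intro coeff_eq_0) fastforce
    then show ?case using Suc by (simp add: state_Suc(3) coeff_append)
  qed (simp add: limit_coeff_def partial_def)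
  from this[of "n - Suc (max_norm k)"] show ?thesis using assms by simp
qed

text \<open>
  Truncation does not affect the first \<open>n\<close> stages once the radius exceeds theirs, and each later stage
  contributes a geometrically small amount whether truncated or not.
\<close>

lemma norm_trunc_partial_diff:
  assumes "n \<le> m" "radius n \<le> r"
  shows "norm (peval (trunc r (partial m)) x - peval (partial n) x) \<le> 6 * (1/2) ^ n - 6 * (1/2) ^ m"
  using assms(1)
proof (induction m rule: dec_induct)
  case base
  have "trunc r (partial n) = partial n"
    using partial_properties(3)[of _ n] assms(2) by (force simp: trunc_def filter_id_conv)
  then show ?case by simp
next
  case (step m)
  have "norm (peval (trunc r (partial (Suc m))) x - peval (partial n) x) =
      norm ((peval (trunc r (partial m)) x - peval (partial n) x) + peval (trunc r (block m)) x)"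
    by (simp add: state_Suc(3) algebra_simps)
  also have "\<dots> \<le> (6 * (1/2) ^ n - 6 * (1/2) ^ m) + 3 * (1/2) ^ m"
    by (rule norm_triangle_mono[OF step.IH block_properties(5)])
  finally show ?case by simp
qed

lemma rval_partial_diff:
  assumes "n \<le> m"
  shows "\<bar>rval (partial m) x - rval (partial n) x\<bar> \<le> 6 * (1/2) ^ n"
proof -
  let ?r = "max (radius m) (radius n)"
  have "trunc ?r (partial m) = partial m"
    using partial_properties(3)[of _ m] by (force simp: trunc_def filter_id_conv)
  then have "norm (peval (partial m) x - peval (partial n) x) \<le> 6 * (1/2) ^ n - 6 * (1/2) ^ m"
    using norm_trunc_partial_diff[OF assms, of ?r x] by simp
  moreover have "\<bar>rval (partial m) x - rval (partial n) x\<bar> \<le> norm (peval (partial m) x - peval (partial n) x)"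
    unfolding rval_def using abs_Re_le_cmod[of "peval (partial m) x - peval (partial n) x"] by simp
  moreover have "(0::real) \<le> 6 * (1/2) ^ m" by simp
  ultimately show ?thesis by linarith
qed

definition limit :: "'n torus \<Rightarrow> real"
  where "limit x = lim (\<lambda>n. rval (partial n) x)"

lemma limit_close: "\<bar>limit x - rval (partial n) x\<bar> \<le> 6 * (1/2) ^ n"
proof -
  have "Cauchy (\<lambda>n. rval (partial n) x)"
  proof (rule metric_CauchyI)
    fix e :: real assume "e > 0"
    then obtain N where N: "(1/2) ^ N < e / 6" using real_arch_pow_inv[of "e / 6" "1/2"] by auto
    have "dist (rval (partial m) x) (rval (partial n) x) < e" if "m \<ge> N" "n \<ge> N" for m n
    proof (cases "n \<le> m")
      case True
      have "(1/2) ^ n \<le> ((1/2) ^ N :: real)" using that by (intro power_decreasing) auto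
      then show ?thesis using rval_partial_diff[OF True, of x] N unfolding dist_real_def by linarith
    next
      case False
      have "(1/2) ^ m \<le> ((1/2) ^ N :: real)" using that by (intro power_decreasing) auto
      moreover have "m \<le> n" using False by simp
      ultimately show ?thesis using rval_partial_diff[of m n x] N unfolding dist_real_def by linarith
    qed
    then show "\<exists>N. \<forall>m\<ge>N. \<forall>n\<ge>N. dist (rval (partial m) x) (rval (partial n) x) < e" by blast
  qed
  then have "(\<lambda>m. rval (partial m) x) \<longlonglongrightarrow> limit x"
    unfolding limit_def by (simp add: Cauchy_convergent_iff convergent_LIMSEQ_iff)
  then have "(\<lambda>m. \<bar>rval (partial m) x - rval (partial n) x\<bar>) \<longlonglongrightarrow> \<bar>limit x - rval (partial n) x\<bar>"
    by (intro tendsto_intros)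
  moreover have "eventually (\<lambda>m. \<bar>rval (partial m) x - rval (partial n) x\<bar> \<le> 6 * (1/2) ^ n) sequentially"
    using rval_partial_diff unfolding eventually_sequentially by blast
  ultimately show ?thesis by (intro tendsto_upperbound) auto
qed

lemma half_pow_tendsto: "(\<lambda>n. 6 * (1/2) ^ n :: real) \<longlonglongrightarrow> 0"
  by (intro tendsto_mult_right_zero LIMSEQ_power_zero) simp

lemma uniform_limit_partial: "uniform_limit UNIV (\<lambda>n. rval (partial n)) limit sequentially"
proof (rule uniform_limitI)
  fix e :: real assume "e > 0"
  then have "eventually (\<lambda>n. 6 * (1/2) ^ n < e) sequentially"
    using half_pow_tendsto by (intro order_tendstoD) auto
  then show "\<forall>\<^sub>F n in sequentially. \<forall>x\<in>UNIV. dist (rval (partial n) x) (limit x) < e"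
  proof eventually_elim
    case (elim n)
    then show ?case using limit_close[of _ n] by (auto simp: dist_real_def abs_minus_commute intro: le_less_trans)
  qed
qed

lemma continuous_on_limit: "continuous_on UNIV limit"
  by (rule uniform_limit_theorem[OF _ uniform_limit_partial]) (simp_all add: continuous_on_rval)

lemma bounded_limit: "\<bar>limit x\<bar> \<le> 6"
  using limit_close[of x 0] by (simp add: state_0)

lemma integral_limit:
  fixes g :: "'n torus \<Rightarrow> complex"
  assumes M: "prob_space M" "sets M = sets borel" and g: "continuous_on UNIV g" "\<And>x. norm (g x) \<le> 1"
  shows "(\<lambda>n. LINT x|M. peval (partial n) x * g x) \<longlonglongrightarrow> (LINT x|M. complex_of_real (limit x) * g x)"
proof (rule LIM_zero_cancel, rule Lim_null_comparison[OF always_eventually half_pow_tendsto], rule allI)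
  fix n
  interpret prob_space M by (rule M)
  note intI = integrable_continuous_torus[OF finite_measure_axioms M(2)]
  have g': "norm a * norm (g x) \<le> C" if "norm a \<le> C" for a :: complex and C x
    using mult_mono[OF that g(2)[of x]] that norm_ge_zero[of a] by (smt (verit) mult.right_neutral norm_ge_zero)
  have i: "integrable M (\<lambda>x. peval (partial n) x * g x)" "integrable M (\<lambda>x. complex_of_real (limit x) * g x)"
    by (rule intI[of _ "of_rat (l1 (partial n))"], auto intro!: continuous_intros continuous_on_peval g(1) g' norm_peval_le simp: norm_mult)
       (rule intI[of _ 6], auto intro!: continuous_intros continuous_on_limit g(1) simp: norm_mult intro: g'[of "complex_of_real (limit _)", simplified] bounded_limit)
  have "norm ((LINT x|M. peval (partial n) x * g x) - (LINT x|M. complex_of_real (limit x) * g x)) =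
      norm (LINT x|M. peval (partial n) x * g x - complex_of_real (limit x) * g x)"
    using i by simp
  also have "\<dots> \<le> (LINT x|M. norm (peval (partial n) x * g x - complex_of_real (limit x) * g x))"
    by (rule integral_norm_bound)
  also have "\<dots> \<le> (LINT x|M. 6 * (1/2) ^ n)"
  proof (rule integral_mono)
    show "norm (peval (partial n) x * g x - complex_of_real (limit x) * g x) \<le> 6 * (1/2) ^ n" for x
    proof -
      have "peval (partial n) x * g x - complex_of_real (limit x) * g x = complex_of_real (rval (partial n) x - limit x) * g x"
        by (simp add: peval_eq_rval[OF partial_properties(2)] algebra_simps)
      then show ?thesis
        using g'[of "complex_of_real (rval (partial n) x - limit x)" "6 * (1/2) ^ n" x] limit_close[of x n]
        by (simp add: norm_mult abs_minus_commute del: of_real_diff)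
    qed
  qed (use i in auto)
  finally show "norm ((LINT x|M. peval (partial n) x * g x) - (LINT x|M. complex_of_real (limit x) * g x)) \<le> 6 * (1/2) ^ n"
    by (simp add: prob_space)
qed

end

section \<open>Fourier series and maximizing measures of the limit\<close>

context toral_dynamics
begin

lemma coeff_0: "nonconstant P \<Longrightarrow> coeff P 0 = 0"
  by (rule coeff_eq_0) (auto simp: nonconstant_def)

lemma fourier_coeff_limit: "fourier_coeff limit k = (if k = 0 then 0 else of_rat (limit_coeff A k))"
proof -
  have "(\<lambda>n. LINT x|torus_lebesgue. peval (partial n) x * torus_char (- k) x) \<longlonglongrightarrow> fourier_coeff limit k"
    unfolding fourier_coeff_def
    by (rule integral_limit[OF prob_space_torus_lebesgue sets_torus_lebesgue continuous_on_torus_char]) simp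
  then have lim: "(\<lambda>n. of_rat (coeff (partial n) k)) \<longlonglongrightarrow> fourier_coeff limit k"
    by (simp add: integral_peval_torus_char)
  have "eventually (\<lambda>n. of_rat (coeff (partial n) k) = (if k = 0 then 0 else of_rat (limit_coeff A k) :: complex)) sequentially"
    using eventually_gt_at_top[of "max_norm k"]
    by eventually_elim (cases "k = 0", simp add: coeff_0 partial_properties(1), simp add: coeff_partial)
  then show ?thesis
    using LIMSEQ_unique[OF lim tendsto_eventually] by blast
qed

text \<open>
  Collecting the terms of equal frequency.
\<close>

lemma sum_coeff:
  assumes "finite S"
  shows "(\<Sum>k\<in>S. of_rat (coeff P k) * torus_char k x) = peval (filter (\<lambda>t. snd t \<in> S) P) x"
proof (induction P)
  case (Cons t P)
  have "(\<Sum>k\<in>S. of_rat (coeff (t # P) k) * torus_char k x) =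
      (\<Sum>k\<in>S. (if k = snd t then of_rat (fst t) * torus_char (snd t) x else 0) + of_rat (coeff P k) * torus_char k x)"
    by (rule sum.cong) (auto simp: coeff_def of_rat_add algebra_simps)
  also have "\<dots> = (if snd t \<in> S then of_rat (fst t) * torus_char (snd t) x else 0) + peval (filter (\<lambda>t. snd t \<in> S) P) x"
    using assms Cons by (simp add: sum.distrib)
  finally show ?case by simp
qed (simp add: coeff_def)

lemma square_partial_sum_eq:
  assumes "r \<ge> 0" "nat \<lfloor>r\<rfloor> < m"
  shows "square_partial_sum (limit_coeff A) r x = peval (trunc (nat \<lfloor>r\<rfloor>) (partial m)) x"
proof -
  let ?S = "{k::int^'n. k \<noteq> 0 \<and> infnorm (vec_of_int k) \<le> r}"
  have "square_partial_sum (limit_coeff A) r x = (\<Sum>k\<in>?S. of_rat (coeff (partial m) k) * torus_char k x)"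
    unfolding square_partial_sum_def
  proof (rule sum.cong[OF refl])
    fix k assume "k \<in> ?S"
    then have "max_norm k < m" using assms by (simp add: infnorm_le_iff_max_norm)
    then show "of_rat (limit_coeff A k) * torus_char k x = of_rat (coeff (partial m) k) * torus_char k x"
      by (simp add: coeff_partial)
  qed
  also have "\<dots> = peval (filter (\<lambda>t. snd t \<in> ?S) (partial m)) x"
    by (rule sum_coeff[OF finite_square])
  also have "filter (\<lambda>t. snd t \<in> ?S) (partial m) = trunc (nat \<lfloor>r\<rfloor>) (partial m)"
    unfolding trunc_def using partial_properties(1)[of m] assms
    by (intro filter_cong) (auto simp: infnorm_le_iff_max_norm nonconstant_def)
  finally show ?thesis .
qed

lemma square_partial_sums_converge:
  "uniform_limit UNIV (square_partial_sum (limit_coeff A)) (\<lambda>x. complex_of_real (limit x)) at_top"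
proof (rule uniform_limitI)
  fix e :: real assume "e > 0"
  then have "eventually (\<lambda>n. 6 * (1/2) ^ n < e / 2) sequentially"
    using order_tendstoD(2)[OF half_pow_tendsto, of "e / 2"] by simp
  then obtain n where n: "6 * (1/2) ^ n < e / 2"
    unfolding eventually_sequentially by blast
  have "dist (square_partial_sum (limit_coeff A) r x) (complex_of_real (limit x)) < e"
    if r: "r \<ge> real (radius n)" for r x
  proof -
    define m where "m = Suc (max n (nat \<lfloor>r\<rfloor>))"
    have r0: "r \<ge> 0" using r by (rule order_trans[rotated]) simp
    have "radius n \<le> nat \<lfloor>r\<rfloor>" using r by (simp add: le_nat_floor)
    moreover have "n \<le> m" by (simp add: m_def)
    ultimately have "norm (peval (trunc (nat \<lfloor>r\<rfloor>) (partial m)) x - peval (partial n) x) \<le> 6 * (1/2) ^ n - 6 * (1/2) ^ m"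
      by (intro norm_trunc_partial_diff)
    also have "\<dots> \<le> 6 * (1/2) ^ n" by simp
    finally have "norm (square_partial_sum (limit_coeff A) r x - peval (partial n) x) \<le> 6 * (1/2) ^ n"
      using square_partial_sum_eq[OF r0, of m x] by (simp add: m_def)
    moreover have "norm (peval (partial n) x - complex_of_real (limit x)) \<le> 6 * (1/2) ^ n"
      using limit_close[of x n] unfolding peval_eq_rval[OF partial_properties(2)] of_real_diff[symmetric] norm_of_real
      by (simp add: abs_minus_commute)
    ultimately show ?thesis
      using n norm_triangle_ineq[of "square_partial_sum (limit_coeff A) r x - peval (partial n) x" "peval (partial n) x - complex_of_real (limit x)"]
      by (simp add: dist_norm)
  qed
  then show "\<forall>\<^sub>F r in at_top. \<forall>x\<in>UNIV. dist (square_partial_sum (limit_coeff A) r x) (complex_of_real (limit x)) < e"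
    unfolding eventually_at_top_linorder by blast
qed

text \<open>
  The integrals of the increments telescope.
\<close>

lemma integral_partial:
  assumes M: "M \<in> invariant"
  shows "(LINT x|M. rval (partial n) x) = (LINT x|M. rval (poly n) x)"
proof (induction n)
  case (Suc n)
  then show ?case
    using block_properties(6)[OF M, of n] integrable_rval[OF invariant_prob_measuresD(1,2)[OF M]] by (simp add: state_Suc(3))
qed (simp add: state_0)

lemma integral_limit_tendsto:
  assumes M: "M \<in> invariant"
  shows "(\<lambda>n. LINT x|M. rval (poly n) x) \<longlonglongrightarrow> (LINT x|M. limit x)"
proof -
  note inv = invariant_prob_measuresD[OF M]
  have "(\<lambda>n. LINT x|M. peval (partial n) x * 1) \<longlonglongrightarrow> (LINT x|M. complex_of_real (limit x) * 1)"
    by (rule integral_limit[OF inv(1,2)]) auto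
  then have "(\<lambda>n. complex_of_real (LINT x|M. rval (partial n) x)) \<longlonglongrightarrow> complex_of_real (LINT x|M. limit x)"
    by (simp add: peval_eq_rval[OF partial_properties(2)])
  then show ?thesis
    unfolding tendsto_of_real_iff integral_partial[OF M] .
qed

text \<open>
  After stage \<open>n\<close> the integrals increase by at most the sum of \<open>4\<^sup>-\<^sup>m / 4\<close> over \<open>m \<ge> n\<close>.
\<close>

lemma integral_limit_le:
  assumes M: "M \<in> invariant"
  shows "(LINT x|M. limit x) \<le> (LINT x|M. rval (poly n) x) + (1/4) ^ n / 3"
proof (rule tendsto_upperbound[OF integral_limit_tendsto[OF M]])
  have "(LINT x|M. rval (poly m) x) \<le> (LINT x|M. rval (poly n) x) + ((1/4) ^ n - (1/4) ^ m) / 3" if "m \<ge> n" for m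
    using that
  proof (induction m rule: dec_induct)
    case (step m)
    have "(LINT x|M. rval (poly (Suc m)) x) \<le> min (LINT x|M. rval (poly m) x) 0 + (1/4) ^ m / 4"
      using next_poly_properties(6)[OF good_poly M] by (simp add: state_Suc)
    also have "\<dots> \<le> (LINT x|M. rval (poly m) x) + (1/4) ^ m / 4" by simp
    finally have 1: "(LINT x|M. rval (poly (Suc m)) x) \<le> (LINT x|M. rval (poly m) x) + (1/4) ^ m / 4" .
    have 2: "a \<le> y + (p - 1 / 4 * q) / 3" if "a \<le> b + q / 4" "b \<le> y + (p - q) / 3" for a b y p q :: real
      using that by (simp add: field_simps)
    show ?case unfolding power_Suc by (rule 2[OF 1 step.IH])
  qed simp
  moreover have "((1/4) ^ n - (1/4) ^ m) / 3 \<le> ((1/4) ^ n :: real) / 3" for m by simp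
  ultimately have "\<forall>m\<ge>n. (LINT x|M. rval (poly m) x) \<le> (LINT x|M. rval (poly n) x) + (1/4) ^ n / 3"
    by (meson add_left_mono order_trans)
  then show "\<forall>\<^sub>F m in sequentially. (LINT x|M. rval (poly m) x) \<le> (LINT x|M. rval (poly n) x) + (1/4) ^ n / 3"
    unfolding eventually_sequentially by blast
qed simp

lemma integral_limit_nonpos:
  assumes M: "M \<in> invariant"
  shows "(LINT x|M. limit x) \<le> 0"
proof (rule LIMSEQ_le_const)
  show "(\<lambda>n. (1/4) ^ n / 3 :: real) \<longlonglongrightarrow> 0"
    by (intro tendsto_divide_zero LIMSEQ_power_zero) simp
  have "(LINT x|M. limit x) \<le> (1/4) ^ n / 3" for n
  proof -
    have "(LINT x|M. rval (poly (Suc n)) x) \<le> min (LINT x|M. rval (poly n) x) 0 + (1/4) ^ n / 4"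
      using next_poly_properties(6)[OF good_poly M] by (simp add: state_Suc)
    then show ?thesis using integral_limit_le[OF M, of "Suc n"] by simp
  qed
  then show "\<exists>N. \<forall>n\<ge>N. (LINT x|M. limit x) \<le> (1/4) ^ n / 3" by blast
qed

text \<open>
  At a stage \<open>n\<close> that tests \<open>k\<close>, the integral drops below \<open>- 2\<^sup>-\<^sup>n \<bar>\<mu>(e\<^sub>k)\<bar>\<^sup>2 / 4\<close> up to an error of order
  \<open>4\<^sup>-\<^sup>n\<close>. Such stages exist with \<open>n\<close> as large as desired.
\<close>

lemma integral_limit_neg:
  assumes M: "M \<in> invariant" and k: "k \<noteq> 0" and ne: "(LINT x|M. torus_char k x) \<noteq> 0"
  shows "(LINT x|M. limit x) < 0"
proof -
  define v where "v = (norm (LINT x|M. torus_char k x))\<^sup>2"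
  have v: "v > 0" using ne by (simp add: v_def)
  obtain a where a: "k = dec a" using surj_dec unfolding surj_def by metis
  obtain j where j: "(1/2) ^ j < v / 2" using real_arch_pow_inv[of "v / 2" "1/2"] v by auto
  \<comment> \<open>A stage that tests \<open>k\<close> and is so late that \<open>2\<^sup>-\<^sup>n\<close> is small against \<open>v\<close>.\<close>
  define n where "n = prod_encode (a, j)"
  have tk: "target n = k" by (simp add: target_def n_def a)
  have "j \<le> n" unfolding n_def by (rule le_prod_encode_2)
  then have "(1/2) ^ n \<le> ((1/2) ^ j :: real)" by (intro power_decreasing) auto
  then have u: "(1/2) ^ n < v / 2" using j by linarith
  have "(LINT x|M. rval (poly (Suc n)) x) \<le> (1/4) ^ n / 4 - (1/2) ^ n / 4 * v"
    using next_poly_properties(7)[OF good_poly M, of n] k tk by (simp add: state_Suc v_def)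
  then have "(LINT x|M. limit x) \<le> (1/4) ^ n / 3 - (1/2) ^ n / 4 * v"
    using integral_limit_le[OF M, of "Suc n"] by simp
  also have "(1/4) ^ n = (1/2) ^ n * ((1/2) ^ n :: real)"
    by (simp add: power_mult_distrib[symmetric])
  also have "(1/2) ^ n * (1/2) ^ n / 3 - (1/2) ^ n / 4 * v = (1/2) ^ n * ((1/2) ^ n / 3 - v / 4)"
    by (simp add: algebra_simps)
  also have "\<dots> < 0"
    using u v by (intro mult_pos_neg) auto
  finally show ?thesis .
qed

lemma integral_limit_lebesgue: "(LINT x|torus_lebesgue. limit x) = 0"
proof -
  have "(LINT x|torus_lebesgue. rval (poly n) x) = 0" for n
    using good_poly[of n] by (simp add: integral_rval_lebesgue coeff_0 good_def)
  then show ?thesis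
    using integral_limit_tendsto[OF lebesgue_invariant] by (simp add: LIMSEQ_const_iff)
qed

lemma maximizing_limit_iff: "maximizing T limit M \<longleftrightarrow> M = torus_lebesgue"
proof -
  have sup: "(SUP N\<in>invariant. integral\<^sup>L N limit) = 0"
  proof (rule cSup_eq_maximum)
    show "0 \<in> (\<lambda>N. integral\<^sup>L N limit) ` invariant"
      using lebesgue_invariant integral_limit_lebesgue by force
  qed (use integral_limit_nonpos in auto)
  show ?thesis
  proof
    assume "maximizing T limit M"
    then have M: "M \<in> invariant" "(LINT x|M. limit x) = 0"
      by (simp_all add: maximizing_def sup)
    note inv = invariant_prob_measuresD[OF M(1)]
    interpret prob_space M by (rule inv)
    show "M = torus_lebesgue"
    proof (rule torus_measure_eqI[OF inv(1,2) prob_space_torus_lebesgue sets_torus_lebesgue])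
      fix k :: "int^'n"
      show "(LINT x|M. torus_char k x) = (LINT x|torus_lebesgue. torus_char k x)"
      proof (cases "k = 0")
        case True
        then show ?thesis by (simp add: prob_space prob_space.prob_space[OF prob_space_torus_lebesgue])
      next
        case False
        then show ?thesis
          using integral_limit_neg[OF M(1) False] M(2) by (auto simp: integral_torus_char)
      qed
    qed
  qed (simp add: maximizing_def sup lebesgue_invariant integral_limit_lebesgue)
qed

end

section \<open>Computability of the coefficients\<close>

lemma computable_power_nat:
  assumes "computable f"
  shows "computable (\<lambda>x. (c::nat) ^ f x)"
proof -
  have eq: "c ^ n = ((*) c ^^ n) 1" for n
    by (induction n) auto
  show ?thesis
    unfolding eq by (intro computable_funpow computable_intros assms)
qed

lemma computable_uminus_rat:
  assumes "computable f"
  shows "computable (\<lambda>x. - f x :: rat)"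
proof -
  have eq: "- f x = (-1) * f x" for x by simp
  show ?thesis unfolding eq by (intro computable_intros assms)
qed

lemma computable_power2_nat:
  assumes "computable f"
  shows "computable (\<lambda>x. (f x :: nat)\<^sup>2)"
  unfolding power2_eq_square by (intro computable_intros assms)

lemma computable_pscale:
  assumes "computable r" "computable P"
  shows "computable (\<lambda>x. pscale (r x) (P x))"
  unfolding pscale_def by (intro computable_intros computable_comp[OF assms(1)] assms)

lemma computable_pmult:
  assumes "computable P" "computable Q"
  shows "computable (\<lambda>x. pmult (P x) (Q x))"
  unfolding pmult_def by (intro computable_intros computable_comp[OF assms(2)] assms)

lemma computable_pshift:
  assumes "computable P"
  shows "computable (\<lambda>x. pshift A (P x))"
  unfolding pshift_def by (intro computable_intros assms)

lemma computable_funpow_pshift: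
  assumes "computable n" "computable P"
  shows "computable (\<lambda>x. (pshift A ^^ n x) (P x))"
  by (intro computable_funpow computable_pshift computable_intros assms)

lemma computable_pavg:
  assumes "computable N" "computable P"
  shows "computable (\<lambda>x. pavg A (N x) (P x))"
  unfolding pavg_def
  by (intro computable_pscale computable_funpow_pshift computable_intros computable_comp[OF assms(2)] assms)

lemma computable_nonconst:
  assumes "computable P"
  shows "computable (\<lambda>x. nonconst (P x))"
  unfolding nonconst_def by (intro computable_intros assms)

lemma computable_coeff:
  assumes "computable P" "computable k"
  shows "computable (\<lambda>x. coeff (P x) (k x))"
  unfolding coeff_def by (intro computable_intros computable_comp[OF assms(2)] assms)

lemma computable_l1:
  assumes "computable P"
  shows "computable (\<lambda>x. l1 (P x))"
  unfolding l1_def by (intro computable_intros assms)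

lemma computable_penergy:
  assumes "computable N" "computable k"
  shows "computable (\<lambda>x. penergy A (N x) (k x))"
  unfolding penergy_def by (intro computable_pmult computable_pavg computable_intros assms)

lemma computable_pneg:
  assumes "computable n" "computable P"
  shows "computable (\<lambda>x. pneg (n x) (P x))"
  unfolding pneg_def pabs_def
  by (intro computable_pscale computable_pmult computable_funpow computable_intros computable_comp[OF assms(2)] assms)

lemma computable_target:
  assumes "computable s"
  shows "computable (\<lambda>x. target (s x))"
  unfolding target_def
proof (rule computable_comp[OF computable_dec], rule computable_comp[OF _ assms], rule computable_nat1)
  show "rec_nat1 (\<lambda>n. fst (prod_decode n))"
    by (intro rec_nat1_intros rec_nat1_id)
qed

lemma computable_avg_root:
  assumes "computable s" "computable H"
  shows "computable (\<lambda>x. avg_root (s x) (H x))"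
  unfolding avg_root_def
proof (rule computable_Least)
  show "computable (\<lambda>p. of_nat (16 * 4 ^ s (fst p)) * (1 + l1 (H (fst p))) \<le> (of_nat (snd p) :: rat))"
    by (intro computable_l1 computable_power_nat computable_intros computable_comp[OF assms(1)] computable_comp[OF assms(2)])
qed (rule real_arch_simple)

lemma computable_copies:
  assumes "computable s" "computable H"
  shows "computable (\<lambda>x. copies (s x) (H x))"
  unfolding copies_def
proof (rule computable_Least)
  show "computable (\<lambda>p. 1 + of_nat (2 ^ s (fst p)) * l1 (H (fst p)) \<le> (of_nat (snd p) :: rat))"
    by (intro computable_l1 computable_power_nat computable_intros computable_comp[OF assms(1)] computable_comp[OF assms(2)])
qed (rule real_arch_simple)

lemma computable_next_poly:
  assumes "computable s" "computable H"
  shows "computable (\<lambda>x. next_poly A (s x) (H x))"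
  unfolding next_poly_def Let_def
  by (intro computable_append computable_nonconst computable_pneg computable_pavg computable_power2_nat
      computable_avg_root computable_pscale computable_penergy computable_target computable_uminus_rat
      computable_power_nat computable_intros assms)

lemma computable_increment:
  assumes "computable s" "computable H"
  shows "computable (\<lambda>x. increment A (s x) (H x))"
  unfolding increment_def
  by (intro computable_append computable_next_poly computable_pavg computable_power2_nat
      computable_avg_root computable_pscale computable_intros assms)

context toral_dynamics
begin

lemma computable_esc:
  assumes "computable R" "computable d"
  shows "computable (\<lambda>x. esc A (R x) (d x))"
  unfolding esc_def
proof (rule computable_Least)
  show "computable (\<lambda>p. list_all (\<lambda>t. snd t = 0 \<or> R (fst p) < max_norm (snd t)) ((pshift A ^^ snd p) (d (fst p))))"
    by (intro computable_funpow_pshift computable_intros computable_comp[OF assms(1)] computable_comp[OF assms(2)])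
qed (rule esc_exists)

lemma computable_emission:
  assumes "computable s" "computable R" "computable d"
  shows "computable (\<lambda>x. emission A (s x) (R x) (d x))"
  unfolding emission_def emit_step_def Let_def
  by (intro computable_pscale computable_copies computable_funpow computable_funpow_pshift computable_esc computable_intros
      computable_comp[OF assms(3)] assms)

lemma computable_limit_coeff: "computable (limit_coeff A)"
proof -
  have "computable (stage A)"
    unfolding stage_def[abs_def] Let_def
    by (intro computable_emission computable_increment computable_next_poly computable_intros)
  then have "computable (\<lambda>p. stage A (snd p))" by (rule computable_comp) (intro computable_intros)
  then have "computable (\<lambda>k::int^'n. (stage A ^^ Suc (max_norm k)) (0, 0, [], []))"
    by (intro computable_funpow computable_intros)
  then show ?thesis
    unfolding limit_coeff_def[abs_def] state_def by (intro computable_coeff computable_intros)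
qed

end

section \<open>Ergodicity and orbits of frequencies\<close>

text \<open>
  The real part of the sum of the characters along a finite orbit is a continuous invariant function
  of mean zero. By ergodicity it has constant sign almost everywhere, hence vanishes almost everywhere,
  but its Fourier coefficient at \<open>k\<close> is positive.
\<close>

lemma ergodic_imp_free_dual:
  fixes B :: "int^'n^('n::finite)"
  assumes erg: "ergodic (toral_map B) torus_lebesgue" and n: "n \<ge> 1"
    and fixed: "(((*v) (transpose B)) ^^ n) k = k"
    and nz: "\<And>i. (((*v) (transpose B)) ^^ i) k \<noteq> 0"
  shows False
proof -
  interpret prob_space "torus_lebesgue :: 'n torus measure" by (rule prob_space_torus_lebesgue)
  let ?M = "torus_lebesgue :: 'n torus measure" and ?T = "toral_map B"
  define w where "w i = (((*v) (transpose B)) ^^ i) k" for i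
  \<comment> \<open>Invariant because \<open>w n = w 0\<close>.\<close>
  define f where "f x = (\<Sum>i<n. Re (torus_char (w i) x))" for x
  have int: "integrable ?M (torus_char l)" for l
    by (rule integrable_continuous_torus[OF finite_measure_axioms sets_torus_lebesgue continuous_on_torus_char, of _ 1]) simp
  have contf: "continuous_on UNIV f"
    unfolding f_def by (intro continuous_intros continuous_on_torus_char)
  have intf: "integrable ?M f"
    unfolding f_def using int by (intro Bochner_Integration.integrable_sum integrable_Re)
  have inv: "f (?T x) = f x" for x
  proof -
    have "f (?T x) = (\<Sum>i<n. Re (torus_char (w (Suc i)) x))"
      unfolding f_def w_def by (simp only: torus_char_toral_map funpow.simps o_apply)
    also have "\<dots> = f x"
    proof -
      let ?g = "\<lambda>i. Re (torus_char (w i) x)"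
      have "?g n = ?g 0" using fixed by (simp add: w_def)
      then show ?thesis
        unfolding f_def using sum.lessThan_Suc_shift[of ?g n] sum.lessThan_Suc[of ?g n] by linarith
    qed
    finally show ?thesis .
  qed
  have zero: "(LINT x|?M. f x) = 0"
  proof -
    have "(LINT x|?M. Re (torus_char (w i) x)) = 0" for i
      using integral_Re[OF int[of "w i"]] nz[of i] by (simp add: integral_torus_char w_def)
    then show ?thesis unfolding f_def using int by (simp add: integrable_Re)
  qed
  have "{x. f x > 0} \<in> sets borel"
    using borel_measurable_continuous_onI[OF contf] by measurable
  then have S: "{x. f x > 0} \<in> sets ?M" by (simp add: sets_torus_lebesgue)
  have spc: "space ?M = UNIV" using sets_eq_imp_space_eq[OF sets_torus_lebesgue] by simp
  have "?T -` {x. f x > 0} \<inter> space ?M = {x. f x > 0}"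
    using inv spc by auto
  then have "emeasure ?M {x. f x > 0} = 0 \<or> emeasure ?M (space ?M - {x. f x > 0}) = 0"
    using erg S unfolding ergodic_def by blast
  then have "AE x in ?M. f x = 0"
  proof
    assume "emeasure ?M {x. f x > 0} = 0"
    then have "{x. f x > 0} \<in> null_sets ?M" using S by (simp add: null_sets_def)
    from AE_not_in[OF this] have "AE x in ?M. 0 \<le> - f x" by eventually_elim auto
    then show ?thesis
      using integral_nonneg_eq_0_iff_AE[of ?M "\<lambda>x. - f x"] intf zero by simp
  next
    assume "emeasure ?M (space ?M - {x. f x > 0}) = 0"
    then have "space ?M - {x. f x > 0} \<in> null_sets ?M" using S by (auto simp: null_sets_def)
    from AE_not_in[OF this] have "AE x in ?M. 0 \<le> f x" by eventually_elim (use spc in auto)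
    then show ?thesis
      using integral_nonneg_eq_0_iff_AE[of ?M f] intf zero by simp
  qed
  then have "AE x in ?M. complex_of_real (f x) * torus_char (- k) x = 0"
    by eventually_elim simp
  then have "(LINT x|?M. complex_of_real (f x) * torus_char (- k) x) = 0"
    by (rule integral_eq_zero_AE)
  moreover have "complex_of_real (f x) * torus_char (- k) x =
      (\<Sum>i<n. (torus_char (w i - k) x + torus_char (- w i - k) x) / 2)" for x
  proof -
    have re: "complex_of_real (Re (torus_char l x)) = (torus_char l x + torus_char (- l) x) / 2" for l
      by (simp add: torus_char_minus complex_eq_iff)
    have diff: "torus_char (l - k) x = torus_char l x * torus_char (- k) x" for l
      using torus_char_add[of l "- k" x] by simp
    show ?thesis
      unfolding f_def of_real_sum sum_distrib_right re diff by (simp add: distrib_right)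
  qed
  ultimately have "(\<Sum>i<n. ((if w i = k then 1 else 0) + (if - w i = k then 1 else 0)) / (2::complex)) = 0"
    using int by (simp add: integral_torus_char)
  then have "Re (\<Sum>i<n. ((if w i = k then 1 else 0) + (if - w i = k then 1 else 0)) / (2::complex)) = 0"
    by simp
  then have "(\<Sum>i<n. ((if w i = k then 1 else 0) + (if - w i = k then 1 else 0)) / (2::real)) = 0"
    by (simp add: if_distrib[of Re] cong: if_cong)
  moreover have "0 < (\<Sum>i<n. ((if w i = k then 1 else 0) + (if - w i = k then 1 else 0)) / (2::real))"
    by (rule sum_pos2[of _ 0]) (use n in \<open>auto simp: w_def\<close>)
  ultimately show False by simp
qed

text \<open>
  As \<open>B\<close> is invertible, two equal points of an orbit make the starting point periodic.
\<close>

lemma toral_dynamics_of_ergodic: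
  fixes B :: "int^'n^('n::finite)"
  assumes "invertible B" and erg: "ergodic (toral_map B) torus_lebesgue"
  shows "toral_dynamics (transpose B) (toral_map B)"
proof
  show "torus_char k (toral_map B x) = torus_char (transpose B *v k) x" for k x
    by (rule torus_char_toral_map)
  show "torus_lebesgue \<in> invariant_prob_measures (toral_map B)"
    using erg prob_space_torus_lebesgue sets_torus_lebesgue
    by (auto simp: ergodic_def invariant_prob_measures_def)
  obtain C where C: "B ** C = mat 1"
    using assms(1) unfolding invertible_def by blast
  have "transpose C ** transpose B = mat 1"
    using C by (metis matrix_transpose_mul transpose_mat)
  then have "transpose C *v (transpose B *v k) = k" for k :: "int^'n"
    by (simp only: matrix_vector_mul_assoc matrix_vector_mul_lid)
  then have inj: "inj ((*v) (transpose B))"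
    by (rule inj_on_inverseI)
  define w where "w i k = (((*v) (transpose B)) ^^ i) k" for i and k :: "int^'n"
  have injo: "inj (w i)" for i
    unfolding w_def by (rule inj_fn[OF inj])
  have w0: "w i 0 = 0" for i
    unfolding w_def by (induction i) (simp_all del: vector_transpose_matrix transpose_matrix_vector)
  fix k :: "int^'n"
  assume k: "k \<noteq> 0"
  have nz: "w i k \<noteq> 0" for i
    using injo[of i] w0[of i] k by (metis injD)
  have lt: "w i k \<noteq> w j k" if "i < j" for i j
  proof
    assume "w i k = w j k"
    also have "w j k = w i (w (j - i) k)"
      unfolding w_def using that by (metis comp_apply funpow_add le_add_diff_inverse less_imp_le)
    finally have "w (j - i) k = k" using injo[of i] by (metis injD)
    moreover have "1 \<le> j - i" using that by simp
    ultimately show False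
      using ergodic_imp_free_dual[OF erg, of "j - i" k] nz unfolding w_def by blast
  qed
  show "inj (\<lambda>n. (((*v) (transpose B)) ^^ n) k)"
    unfolding w_def[symmetric] by (rule linorder_injI) (use lt in blast)
qed

theorem theorem2:
  fixes B :: "int ^ 'n ^ 'n::finite"
  assumes "CARD('n) \<ge> 2"
    and "invertible B"
    and "ergodic (toral_map B) torus_lebesgue"
  shows "\<exists>(c :: int ^ 'n \<Rightarrow> rat) (F :: 'n torus \<Rightarrow> real).
    continuous_on UNIV F \<and>
    (\<forall>k. fourier_coeff F k = (if k = 0 then 0 else of_rat (c k))) \<and>
    uniform_limit UNIV (square_partial_sum c) (\<lambda>x. complex_of_real (F x)) at_top \<and>
    (\<forall>M. maximizing (toral_map B) F M \<longleftrightarrow> M = torus_lebesgue) \<and>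
    computable_on (- {0}) c"
proof -
  interpret toral_dynamics "transpose B" "toral_map B"
    by (rule toral_dynamics_of_ergodic) fact+
  show ?thesis
    using continuous_on_limit fourier_coeff_limit square_partial_sums_converge maximizing_limit_iff
      computable_imp_computable_on[OF computable_limit_coeff] by blast
qed

end
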